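(* Let $n>1$ be an integer, $1<p<\frac{2n-1}{2(n-1)}$, and let $\mu$ be a nonnegative Borel measure on the open unit ball $B\subset\mathbb{C}^n$ satisfying $\int_B(1-|w|^2)^n\,d\mu(w)<\infty$. Let $G_\mu$ be the invariant Green potential of $\mu$ and let $d\lambda(z)=(1-|z|)^n\,d\mu(z)$. Then $$m_p(r,G_\mu)=O(1),\quad 0<r<1,$$ if and only if $$\left(\int_S\lambda^p\left(C(\xi,\delta)\right)d\sigma(\xi)\right)^{\frac{1}{p}}=O\left(\delta^n\right),\quad 0<\delta<1.$$
   Context: Notation: $\langle z,w\rangle=\sum_{j=1}^n z_j\overline{w}_j$ and $|z|=\sqrt{\langle z,z\rangle}$ on $\mathbb{C}^n$; $B=\{z\in\mathbb{C}^n:|z|<1\}$; $S=\{z\in\mathbb{C}^n:|z|=1\}$; $\sigma$ is the Lebesgue (rotation-invariant surface) measure on $S$ normalized so that $\sigma(S)=1$. For $z,w\in B$ the involutive automorphism $\varphi_w$ of $B$ is $\varphi_w(z)=\frac{w-P_wz-(1-|w|^2)^{1/2}Q_wz}{1-\langle z,w\rangle}$, where $P_0z=0$, $P_wz=\frac{\langle z,w\rangle}{|w|^2}w$ for $w\neq0$, and $Q_w=I-P_w$. The Green's function for the invariant Laplacian is $G(z,w)=g(\varphi_w(z))$, where $g(z)=\frac{n+1}{2n}\int_{|z|}^1(1-t^2)^{n-1}t^{-2n+1}\,dt$. For a nonnegative Borel measure $\mu$ on $B$ the (invariant) Green potential is $G_\mu(z)=\int_B G(z,w)\,d\mu(w)$,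 $z\in B$, provided it is not identically $+\infty$ (which is equivalent to $\int_B(1-|w|^2)^n\,d\mu(w)<\infty$). For $0<p<\infty$ and a measurable, locally integrable function $u$ on $B$, $m_p(r,u)=\left(\int_S|u(r\xi)|^p\,d\sigma(\xi)\right)^{1/p}$. For $a,b\in\overline{B}$, $d(a,b)=|1-\langle a,b\rangle|^{1/2}$. For $\xi\in S$ and $\delta>0$, $C(\xi,\delta)=\{z\in B: d(z,\xi)<\delta^{1/2}\}$. The notation $\lambda^p(E)$ means $(\lambda(E))^p$. "$=O(\cdot)$, $0<\delta<1$" means that the bound holds with one constant for all $\delta\in(0,1)$; likewise "$=O(1)$, $0<r<1$" means bounded by one constant for all $r\in(0,1)$.
   Formalization: The equivalence with O(1) for all 0<r<1 is stated only when G_μ(0)<∞ (it fails for the unit point mass at 0, where m_p(r,G_μ)=g(r)→∞ as r→0); for arbitrary μ it is stated with O(1) on r0<r<1, for every r0 in (0,1). *)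

theory Defs
  imports "HOL-Analysis.Analysis" "HOL-Probability.Probability"
begin

abbreviation unit_ball :: "(complex ^ 'n::finite) set" where
  "unit_ball \<equiv> ball 0 1"

abbreviation unit_sphere :: "(complex ^ 'n::finite) set" where
  "unit_sphere \<equiv> sphere 0 1"

definition herm :: "complex ^ 'n::finite \<Rightarrow> complex ^ 'n \<Rightarrow> complex" where
  "herm z w = (\<Sum>j\<in>UNIV. z $ j * cnj (w $ j))"

lemma herm_self: "herm z z = complex_of_real ((norm z)\<^sup>2)"
  by (simp add: herm_def norm_vec_def L2_set_def sum_nonneg complex_norm_square
        flip: of_real_power)

text \<open>
  Normalised surface measure as the cone measure: the image of the normalised Lebesgue measure of
  the ball under the radial projection \<open>z \<mapsto> z / |z|\<close>. Equivalently, a Borel set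
  \<open>A\<close> of the sphere has mass \<open>vol {r \<xi> | \<xi> \<in> A, 0 < r < 1} / vol (ball 0 1)\<close>.
\<close>

definition sphere_measure :: "(complex ^ 'n::finite) measure" where
  "sphere_measure =
     restrict_space
       (distr (uniform_measure lborel unit_ball) borel (\<lambda>z. z /\<^sub>R norm z)) unit_sphere"

definition proj_on :: "complex ^ 'n::finite \<Rightarrow> complex ^ 'n \<Rightarrow> complex ^ 'n" where
  "proj_on w z = (if w = 0 then 0 else (herm z w / of_real ((norm w)\<^sup>2)) *s w)"

definition ball_aut :: "complex ^ 'n::finite \<Rightarrow> complex ^ 'n \<Rightarrow> complex ^ 'n" where
  "ball_aut w z =
     inverse (1 - herm z w) *s
       (w - proj_on w z - sqrt (1 - (norm w)\<^sup>2) *\<^sub>R (z - proj_on w z))"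

text \<open>
  Green's functions and potentials, and their means, take values in \<open>[0, \<infinity>]\<close>; in particular
  \<open>green_profile 0 = \<infinity>\<close>. The conventional value \<open>0\<close> of the integrand at
  \<open>t = 0\<close> affects only a null set.
\<close>

definition green_profile :: "complex ^ 'n::finite \<Rightarrow> ennreal" where
  "green_profile z =
     ennreal ((real CARD('n) + 1) / (2 * real CARD('n))) *
     (\<integral>\<^sup>+ t \<in> {norm z..1}.
        ennreal ((1 - t\<^sup>2) ^ (CARD('n) - 1) * t powi (1 - 2 * int CARD('n))) \<partial>lborel)"

definition green :: "complex ^ 'n::finite \<Rightarrow> complex ^ 'n \<Rightarrow> ennreal" where
  "green z w = green_profile (ball_aut w z)"

definition green_potential :: "(complex ^ 'n::finite) measure \<Rightarrow> complex ^ 'n \<Rightarrow> ennreal" where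
  "green_potential \<mu> z = (\<integral>\<^sup>+ w. green z w \<partial>\<mu>)"

text \<open>The power \<open>x\<^sup>p\<close> on \<open>[0, \<infinity>]\<close> for an exponent \<open>p > 0\<close>.\<close>

definition epowr :: "ennreal \<Rightarrow> real \<Rightarrow> ennreal" where
  "epowr x p = (if x = \<infinity> then \<infinity> else ennreal (enn2real x powr p))"

definition integral_mean :: "real \<Rightarrow> real \<Rightarrow> (complex ^ 'n::finite \<Rightarrow> ennreal) \<Rightarrow> ennreal" where
  "integral_mean p r u = epowr (\<integral>\<^sup>+ \<xi>. epowr (u (r *\<^sub>R \<xi>)) p \<partial>sphere_measure) (1 / p)"

definition ndist :: "complex ^ 'n::finite \<Rightarrow> complex ^ 'n \<Rightarrow> real" where
  "ndist a b = sqrt (norm (1 - herm a b))"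

definition carleson_region :: "complex ^ 'n::finite \<Rightarrow> real \<Rightarrow> (complex ^ 'n) set" where
  "carleson_region \<xi> \<delta> = {z \<in> unit_ball. ndist z \<xi> < sqrt \<delta>}"

definition weighted_measure :: "(complex ^ 'n::finite) measure \<Rightarrow> (complex ^ 'n) measure" where
  "weighted_measure \<mu> = density \<mu> (\<lambda>z. ennreal ((1 - norm z) ^ CARD('n)))"

definition means_bounded_on :: "real set \<Rightarrow> real \<Rightarrow> (complex ^ 'n::finite \<Rightarrow> ennreal) \<Rightarrow> bool" where
  "means_bounded_on I p u \<longleftrightarrow> (\<exists>C::real. \<forall>r\<in>I. integral_mean p r u \<le> ennreal C)"

definition carleson_growth :: "real \<Rightarrow> (complex ^ 'n::finite) measure \<Rightarrow> bool" where
  "carleson_growth p \<nu> \<longleftrightarrow>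
     (\<exists>C::real. \<forall>\<delta>\<in>{0<..<1}.
        epowr (\<integral>\<^sup>+ \<xi>. epowr (emeasure \<nu> (carleson_region \<xi> \<delta>)) p \<partial>sphere_measure) (1 / p)
          \<le> ennreal (C * \<delta> ^ CARD('n)))"

lemma prob_space_sphere_measure: "prob_space (sphere_measure :: (complex ^ 'n::finite) measure)"
proof -
  let ?U = "uniform_measure lborel (unit_ball :: (complex ^ 'n) set)"
  let ?D = "distr ?U borel (\<lambda>z. z /\<^sub>R norm z)"
  have fin: "emeasure lborel (unit_ball :: (complex ^ 'n) set) \<noteq> \<infinity>"
    using emeasure_lborel_ball_finite[of "0 :: complex ^ 'n" 1] by simp
  have pos: "emeasure lborel (unit_ball :: (complex ^ 'n) set) \<noteq> 0"
    using content_ball_pos[of 1 "0 :: complex ^ 'n"] by (auto simp: measure_def)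
  interpret U: prob_space ?U
    using pos fin by (rule prob_space_uniform_measure)
  have m: "(\<lambda>z :: complex ^ 'n. z /\<^sub>R norm z) \<in> ?U \<rightarrow>\<^sub>M borel" by simp
  interpret D: prob_space ?D by (rule U.prob_space_distr[OF m])
  have eq: "(\<lambda>z :: complex ^ 'n. z /\<^sub>R norm z) -` unit_sphere \<inter> space ?U = - {0}"
    by auto
  have "emeasure ?U {0} = 0"
    by (simp add: emeasure_uniform_measure)
  hence "emeasure ?U (- {0}) = 1"
    using U.emeasure_space_1 emeasure_Diff[of ?U "{0}" UNIV]
    by (simp add: Compl_eq_Diff_UNIV del: emeasure_uniform_measure)
  hence "emeasure ?D unit_sphere = 1"
    by (subst emeasure_distr[OF m]) (simp_all add: eq[simplified] del: emeasure_uniform_measure)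
  thus ?thesis
    unfolding sphere_measure_def
    by (intro prob_spaceI) (simp add: emeasure_restrict_space space_restrict_space)
qed

lemma epowr_epowr_inverse: "p > 0 \<Longrightarrow> epowr (epowr x p) (1 / p) = x"
  by (cases x) (auto simp: epowr_def powr_powr)

lemma ball_aut_0: "ball_aut 0 z = - z"
  by (simp add: ball_aut_def proj_on_def herm_def)

lemma green_potential_return_0:
  "green_potential (return (restrict_space borel unit_ball) 0) z = green_profile z"
proof -
  let ?M = "restrict_space borel unit_ball :: (complex ^ 'a) measure"
  have 0: "0 \<in> space ?M" by (simp add: space_restrict_space)
  interpret prob_space "return ?M 0" by (rule prob_space_return[OF 0])
  have "{w \<in> space ?M. w = 0} \<in> sets ?M"
    by (auto simp: sets_restrict_space space_restrict_space intro!: image_eqI[of _ _ "{0}"])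
  hence "AE w in return ?M 0. w = 0"
    by (subst AE_return[OF 0]) (auto simp: pred_def)
  hence "AE w in return ?M 0. green z w = green z 0" by auto
  hence "green_potential (return ?M 0) z = (\<integral>\<^sup>+ w. green z 0 \<partial>return ?M 0)"
    unfolding green_potential_def by (rule nn_integral_cong_AE)
  also have "\<dots> = green_profile z"
    by (simp only: nn_integral_const emeasure_space_1)
       (simp add: green_def ball_aut_0 green_profile_def)
  finally show ?thesis .
qed

lemma green_profile_lower:
  fixes z :: "complex ^ 'n::finite"
  assumes "0 < norm z" "norm z \<le> 1/2"
  shows "ennreal ((3/4) ^ CARD('n) / 2 * (ln (1/2) - ln (norm z))) \<le> green_profile z"
proof -
  let ?n = "CARD('n)"
  have n: "?n \<ge> 1" by (simp add: Suc_le_eq)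
  have "ennreal ((3/4) ^ ?n * (ln (1/2) - ln (norm z)))
      = ennreal ((3/4) ^ ?n * ln (1/2) - (3/4) ^ ?n * ln (norm z))"
    by (simp add: algebra_simps)
  also have "\<dots> = (\<integral>\<^sup>+ t \<in> {norm z..1/2}. ennreal ((3/4) ^ ?n * inverse t) \<partial>lborel)"
  proof (rule nn_integral_FTC_Icc[symmetric])
    fix t assume "t \<in> {norm z..1/2}"
    hence "norm z \<le> t" by simp
    hence "t > 0" using assms(1) by (rule less_le_trans[rotated])
    thus "((\<lambda>t. (3/4) ^ ?n * ln t) has_real_derivative (3/4) ^ ?n * inverse t) (at t)"
      by (auto intro!: derivative_eq_intros simp: field_simps)
    show "0 \<le> (3/4) ^ ?n * inverse t" using \<open>t > 0\<close> by simp
  qed (use assms in auto)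
  also have "\<dots> \<le> (\<integral>\<^sup>+ t \<in> {norm z..1}.
        ennreal ((1 - t\<^sup>2) ^ (?n - 1) * t powi (1 - 2 * int ?n)) \<partial>lborel)"
  proof (rule nn_integral_mono)
    fix t :: real
    show "ennreal ((3/4) ^ ?n * inverse t) * indicator {norm z..1/2} t
       \<le> ennreal ((1 - t\<^sup>2) ^ (?n - 1) * t powi (1 - 2 * int ?n)) * indicator {norm z..1} t"
    proof (cases "t \<in> {norm z..1/2}")
      case True
      hence "norm z \<le> t" and t2: "t \<le> 1/2" by auto
      hence t: "0 < t" "t \<le> 1/2" using assms(1) by linarith+
      have "t\<^sup>2 \<le> (1/2)\<^sup>2" using t by (intro power_mono) auto
      hence sq: "3/4 \<le> 1 - t\<^sup>2" by (simp add: power2_eq_square)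
      have "(3/4) ^ ?n \<le> (3/4 :: real) ^ (?n - 1)"
        by (rule power_decreasing) auto
      also have "\<dots> \<le> (1 - t\<^sup>2) ^ (?n - 1)" using sq by (intro power_mono) auto
      finally have 1: "(3/4) ^ ?n \<le> (1 - t\<^sup>2) ^ (?n - 1)" .
      have "1 \<le> 2 * ?n - 1" using n by linarith
      hence "t ^ (2 * ?n - 1) \<le> t ^ 1" using t by (intro power_decreasing) auto
      hence "inverse t \<le> inverse (t ^ (2 * ?n - 1))" using t by (intro le_imp_inverse_le) auto
      also have "\<dots> = t powi (- int (2 * ?n - 1))" by (simp only: power_int_minus power_int_of_nat)
      also have "- int (2 * ?n - 1) = 1 - 2 * int ?n" using n by (simp add: of_nat_diff)
      finally have "(3/4) ^ ?n * inverse t \<le> (1 - t\<^sup>2) ^ (?n - 1) * t powi (1 - 2 * int ?n)"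
        using 1 t sq by (intro mult_mono) auto
      thus ?thesis using True by (auto intro!: ennreal_leI)
    qed auto
  qed
  finally have *: "ennreal ((3/4) ^ ?n * (ln (1/2) - ln (norm z))) \<le> \<dots>" .
  have "ennreal ((3/4) ^ ?n / 2 * (ln (1/2) - ln (norm z)))
      = ennreal (1/2) * ennreal ((3/4) ^ ?n * (ln (1/2) - ln (norm z)))"
    by (subst ennreal_mult'[symmetric]) auto
  also have "\<dots> \<le> green_profile z"
    unfolding green_profile_def
    using n by (intro mult_mono * ennreal_leI) (auto simp: field_simps)
  finally show ?thesis .
qed

text \<open>
  A bound of the means over all of \<open>{0<..<1}\<close> cannot be deduced from the growth condition
  alone, because the latter does not see mass at the origin: for a unit point mass at \<open>0\<close> it
  holds trivially, while the potential is \<open>green_profile\<close>, which is radial with a pole at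
  \<open>0\<close>. The full range of radii therefore needs a potential that is finite at \<open>0\<close>;
  for an arbitrary measure the radii have to stay away from \<open>0\<close>.
\<close>

lemma point_mass_at_0:
  fixes \<mu> :: "(complex ^ 'n::finite) measure"
  assumes p: "p > 0" and \<mu>: "\<mu> = return (restrict_space borel unit_ball) 0"
  shows "sets \<mu> = sets (restrict_space borel unit_ball)"
    and "(\<integral>\<^sup>+ w. ennreal ((1 - (norm w)\<^sup>2) ^ CARD('n)) \<partial>\<mu>) < \<infinity>"
    and "carleson_growth p (weighted_measure \<mu>)"
    and "\<not> means_bounded_on {0<..<1} p (green_potential \<mu>)"
proof -
  let ?M = "restrict_space borel unit_ball :: (complex ^ 'n) measure"
  have 0: "0 \<in> space ?M" by (simp add: space_restrict_space)
  interpret prob_space \<mu> unfolding \<mu> by (rule prob_space_return[OF 0])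
  show sets: "sets \<mu> = sets ?M" by (simp add: \<mu>)
  have sp: "space \<mu> = unit_ball" by (simp add: \<mu> space_restrict_space)
  have "(\<integral>\<^sup>+ w. ennreal ((1 - (norm w)\<^sup>2) ^ CARD('n)) \<partial>\<mu>) \<le> (\<integral>\<^sup>+ w. 1 \<partial>\<mu>)"
  proof (rule nn_integral_mono)
    fix w assume "w \<in> space \<mu>"
    hence "norm w \<le> 1" by (simp add: sp)
    hence "(norm w)\<^sup>2 \<le> 1" by (simp add: power_le_one)
    hence "(1 - (norm w)\<^sup>2) ^ CARD('n) \<le> 1" by (intro power_le_one) simp_all
    thus "ennreal ((1 - (norm w)\<^sup>2) ^ CARD('n)) \<le> 1" by simp
  qed
  also have "\<dots> = 1" by (simp add: emeasure_space_1)
  finally show "(\<integral>\<^sup>+ w. ennreal ((1 - (norm w)\<^sup>2) ^ CARD('n)) \<partial>\<mu>) < \<infinity>"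
    by (simp add: le_less_trans[OF _ ennreal_one_less_top])
  have null: "emeasure (weighted_measure \<mu>) (carleson_region \<xi> \<delta>) = 0"
    if "\<delta> < 1" for \<xi> \<delta>
  proof (cases "carleson_region \<xi> \<delta> \<in> sets \<mu>")
    case True
    have "0 \<notin> carleson_region \<xi> \<delta>"
      using that by (simp add: carleson_region_def ndist_def herm_def)
    hence "emeasure \<mu> (carleson_region \<xi> \<delta>) = 0"
      using True by (simp add: \<mu> emeasure_return)
    hence "carleson_region \<xi> \<delta> \<in> null_sets \<mu>" using True by auto
    moreover have "(\<lambda>z :: complex ^ 'n. ennreal ((1 - norm z) ^ CARD('n))) \<in> borel_measurable \<mu>"
      by (subst measurable_cong_sets[OF sets refl]) (intro measurable_restrict_space1, measurable)
    ultimately have "carleson_region \<xi> \<delta> \<in> null_sets (weighted_measure \<mu>)"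
      unfolding weighted_measure_def
      using absolutely_continuousI_density by (auto simp: absolutely_continuous_def)
    thus ?thesis by auto
  qed (simp add: weighted_measure_def emeasure_notin_sets)
  show "carleson_growth p (weighted_measure \<mu>)"
    unfolding carleson_growth_def
    by (intro exI[of _ 0]) (auto simp: null epowr_def)
  show "\<not> means_bounded_on {0<..<1} p (green_potential \<mu>)"
  proof
    interpret S: prob_space "sphere_measure :: (complex ^ 'n) measure"
      by (rule prob_space_sphere_measure)
    obtain e :: "complex ^ 'n" where e: "norm e = 1"
      using vector_choose_size[of 1] by auto
    have mean: "integral_mean p r (green_potential \<mu>) = green_profile (r *\<^sub>R e)" for r
    proof -
      have "(\<integral>\<^sup>+ \<xi>. epowr (green_potential \<mu> (r *\<^sub>R \<xi>)) p \<partial>sphere_measure)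
          = (\<integral>\<^sup>+ (\<xi> :: complex ^ 'n). epowr (green_profile (r *\<^sub>R e)) p
              \<partial>sphere_measure)"
        by (intro nn_integral_cong)
           (auto simp: \<mu> green_potential_return_0 green_profile_def sphere_measure_def
              space_restrict_space e)
      thus ?thesis
        using p by (simp add: integral_mean_def S.emeasure_space_1 epowr_epowr_inverse)
    qed
    assume "means_bounded_on {0<..<1} p (green_potential \<mu>)"
    then obtain C where C: "\<And>r. 0 < r \<Longrightarrow> r < 1 \<Longrightarrow> integral_mean p r (green_potential \<mu>) \<le> ennreal C"
      unfolding means_bounded_on_def greaterThanLessThan_iff Ball_def by blast
    define K where "K = \<bar>C\<bar> + 1"
    define c where "c = (3/4 :: real) ^ CARD('n) / 2"
    define r where "r = exp (- K / c) / 2"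
    have c: "c > 0" by (simp add: c_def)
    have K: "K > 0" by (simp add: K_def)
    have r: "0 < r" "r \<le> 1/2" using c K by (auto simp: r_def)
    have "c * (ln (1/2) - ln r) = K"
      using c by (simp add: r_def ln_div field_simps)
    hence "ennreal K \<le> green_profile (r *\<^sub>R e)"
      using green_profile_lower[of "r *\<^sub>R e"] r
      by (simp add: e c_def)
    also have "\<dots> \<le> ennreal C" using C[of r] r mean[of r] by simp
    finally have "K \<le> C" using K by (simp add: ennreal_le_iff2)
    thus False by (simp add: K_def)
  qed
qed

end

theory Submission
  imports Defs
begin

text \<open>
  By Moebius invariance everything is governed by the pseudo-hyperbolic distance
  \<open>\<rho> = |\<phi>\<^sub>w(z)|\<close>, where \<open>1 - \<rho>\<^sup>2 = (1 - |z|\<^sup>2) (1 - |w|\<^sup>2) / |1 - \<langle>z, w\<rangle>|\<^sup>2\<close>, and the Green function is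
  comparable to \<open>(1 - \<rho>\<^sup>2)\<^sup>n \<rho>\<^sup>2\<^sup>-\<^sup>2\<^sup>n\<close>. For \<open>z = r \<xi>\<close> with \<open>1 - r = \<delta>\<close> and \<open>w \<in> C(\<xi>, \<delta>)\<close> this gives
  \<open>G(z, w) \<ge> c \<delta>\<^sup>-\<^sup>n (1 - |w|)\<^sup>n\<close>, hence \<open>\<lambda>(C(\<xi>, \<delta>)) \<le> C \<delta>\<^sup>n G\<^sub>\<mu>(r \<xi>)\<close> and the necessity of the growth
  condition.

  Conversely, the part of \<open>G\<^sub>\<mu>(r \<xi>)\<close> with \<open>\<rho> \<ge> 1/2\<close> is at most a constant times
  \<open>\<Sum>\<^sub>k 4\<^sup>-\<^sup>k\<^sup>n \<delta>\<^sup>-\<^sup>n \<lambda>(C(\<xi>, 2\<^sup>k\<^sup>+\<^sup>2 \<delta>))\<close>, which is bounded in \<open>L\<^sup>p\<close> by Minkowski's inequality. The part with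
  \<open>\<rho> < 1/2\<close> is at most a constant times \<open>\<Sum>\<^sub>j 2\<^sup>j\<^sup>(\<^sup>2\<^sup>n\<^sup>-\<^sup>2\<^sup>) \<delta>\<^sup>-\<^sup>n T\<^sub>j\<close> with
  \<open>T\<^sub>j(\<xi>) = \<lambda>{w. \<rho> < 2\<^sup>-\<^sup>j}\<close>. Writing \<open>T\<^sub>j\<^sup>p = T\<^sub>j\<^sup>p\<^sup>-\<^sup>1 T\<^sub>j\<close>, bounding the first factor by an average of
  \<open>\<lambda>(C(\<xi>', 200 \<delta>))\<^sup>p\<^sup>-\<^sup>1\<close> over \<open>\<xi>'\<close> near \<open>w\<close>, and using Fubini together with
  \<open>\<sigma>{\<xi>. \<rho> < 2\<^sup>-\<^sup>j} \<le> C \<delta>\<^sup>n 2\<^sup>-\<^sup>j\<^sup>(\<^sup>2\<^sup>n\<^sup>-\<^sup>1\<^sup>)\<close>, one finds that the \<open>L\<^sup>p\<close> norm of \<open>\<delta>\<^sup>-\<^sup>n T\<^sub>j\<close> is \<open>O(2\<^sup>-\<^sup>j\<^sup>(\<^sup>2\<^sup>n\<^sup>-\<^sup>1\<^sup>)\<^sup>/\<^sup>p)\<close>.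
  The sum converges exactly when \<open>p < (2n - 1) / (2n - 2)\<close>. For radii near \<open>0\<close> the same argument applies to
  the measure with density \<open>G(0, \<cdot>)\<close>, which is finite when \<open>G\<^sub>\<mu>(0) < \<infinity>\<close>.
\<close>

section \<open>Isometry invariance of Lebesgue measure\<close>

text \<open>Preimages of boxes are boxes with the same side lengths in another order, and boxes
  determine Lebesgue measure. This moves the problem between two Euclidean spaces of equal
  dimension.\<close>

lemma distr_lborel_relabel_basis:
  fixes h :: "'a::euclidean_space \<Rightarrow> 'b::euclidean_space"
  assumes h: "bij_betw h Basis Basis"
  shows "distr lborel borel (\<lambda>x. \<Sum>b\<in>Basis. (x \<bullet> b) *\<^sub>R h b) = lborel"
proof (rule lborel_eqI[symmetric])
  let ?T = "\<lambda>x. \<Sum>b\<in>Basis. (x \<bullet> b) *\<^sub>R h b"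
  let ?S = "\<lambda>y. \<Sum>b\<in>Basis. (y \<bullet> h b) *\<^sub>R b"
  have hB: "h b \<in> Basis" if "b \<in> Basis" for b
    using h that by (auto simp: bij_betw_def)
  have inj: "inj_on h Basis" using h by (auto simp: bij_betw_def)
  have Tc: "?T x \<bullet> h b = x \<bullet> b" if "b \<in> Basis" for x b
    using that hB inj by (auto simp: inner_sum_left inner_Basis inj_on_eq_iff if_distrib cong: if_cong)
  have Sc: "?S y \<bullet> b = y \<bullet> h b" if "b \<in> Basis" for y b
    using that by (auto simp: inner_sum_left inner_Basis if_distrib cong: if_cong)
  have all: "(\<forall>i\<in>Basis. P i) \<longleftrightarrow> (\<forall>b\<in>Basis. P (h b))" for P
    using bij_betw_imp_surj_on[OF h] by (metis image_iff)
  fix l u :: 'b assume lu: "\<And>b. b \<in> Basis \<Longrightarrow> l \<bullet> b \<le> u \<bullet> b"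
  have T[measurable]: "?T \<in> borel_measurable borel" by simp
  have "?T -` box l u = box (?S l) (?S u)"
    by (auto simp: mem_box all Tc Sc)
  hence "emeasure (distr lborel borel ?T) (box l u) = emeasure lborel (box (?S l) (?S u))"
    by (subst emeasure_distr) auto
  also have "\<dots> = (\<Prod>b\<in>Basis. (?S u - ?S l) \<bullet> b)"
    using lu by (subst emeasure_lborel_box) (auto simp: Sc hB)
  also have "(\<Prod>b\<in>Basis. (?S u - ?S l) \<bullet> b) = (\<Prod>b\<in>Basis. (u - l) \<bullet> h b)"
    by (intro prod.cong) (auto simp: inner_diff_left Sc)
  also have "\<dots> = (\<Prod>b\<in>Basis. (u - l) \<bullet> b)"
    using h by (rule prod.reindex_bij_betw)
  finally show "emeasure (distr lborel borel ?T) (box l u) = ennreal (\<Prod>b\<in>Basis. (u - l) \<bullet> b)" .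
qed simp

text \<open>Testing on boxes suffices, and the preimage of a box under \<open>g\<close> is its image
  under the orthogonal map \<open>inv g\<close>, whose effect on volume is known.\<close>

lemma distr_lborel_orthogonal_cart:
  fixes g :: "real ^ 'n::{finite,wellorder} \<Rightarrow> real ^ 'n::_"
  assumes g: "orthogonal_transformation g"
  shows "distr lborel borel g = lborel"
proof (rule lborel_eqI[symmetric])
  fix l u :: "real ^ 'n::{finite,wellorder}"
  assume lu: "\<And>b. b \<in> Basis \<Longrightarrow> l \<bullet> b \<le> u \<bullet> b"
  have bij: "bij g" by (rule orthogonal_transformation_bij[OF g])
  have inv: "orthogonal_transformation (inv g)" by (rule orthogonal_transformation_inv[OF g])
  have gm[measurable]: "g \<in> borel_measurable borel"
    by (intro borel_measurable_continuous_onI linear_continuous_on linear_conv_bounded_linear[THEN iffD1]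
          orthogonal_transformation_linear[OF g])
  have eq: "g -` box l u = inv g ` box l u" using bij by (simp add: bij_vimage_eq_inv_image)
  have m: "inv g ` box l u \<in> lmeasurable"
    by (rule measurable_orthogonal_image[OF inv]) simp
  have b: "inv g ` box l u \<in> sets borel"
    unfolding eq[symmetric] using measurable_sets[OF gm, of "box l u"] by simp
  have "emeasure (distr lborel borel g) (box l u) = emeasure lborel (inv g ` box l u)"
    by (subst emeasure_distr) (auto simp: eq)
  also have "\<dots> = emeasure lebesgue (inv g ` box l u)" using b by simp
  also have "\<dots> = ennreal (measure lebesgue (inv g ` box l u))"
    using m by (rule emeasure_eq_measure2)
  also have "measure lebesgue (inv g ` box l u) = measure lebesgue (box l u)"
    by (rule measure_orthogonal_image[OF inv]) simp
  also have "\<dots> = (\<Prod>b\<in>Basis. (u - l) \<bullet> b)"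
    using lu by (simp add: inner_diff_left)
  finally show "emeasure (distr lborel borel g) (box l u) = ennreal (\<Prod>b\<in>Basis. (u - l) \<bullet> b)" .
qed simp

text \<open>The change of variables theorem of the library needs a well-ordered index type; the type
  \<open>'n bit0\<close> is one, and it has \<open>2n\<close> elements.\<close>

lemma distr_lborel_orthogonal:
  fixes f :: "complex ^ 'n::finite \<Rightarrow> complex ^ 'n"
  assumes f: "orthogonal_transformation f"
  shows "distr lborel borel f = lborel"
proof -
  have "card (Basis :: (complex ^ 'n) set) = card (Basis :: (real ^ 'n bit0) set)"
    by simp
  then obtain h :: "complex ^ 'n \<Rightarrow> real ^ 'n bit0" where h: "bij_betw h Basis Basis"
    by (metis finite_same_card_bij finite_Basis)
  define T where "T x = (\<Sum>b\<in>Basis. (x \<bullet> b) *\<^sub>R h b)" for x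
  define T' where "T' y = (\<Sum>b\<in>Basis. (y \<bullet> b) *\<^sub>R inv_into Basis h b)" for y
  have inj: "inj_on h Basis" using h by (auto simp: bij_betw_def)
  have T'eq: "T' y = (\<Sum>b\<in>Basis. (y \<bullet> h b) *\<^sub>R b)" for y
  proof -
    have "(\<Sum>b\<in>Basis. (y \<bullet> h b) *\<^sub>R b) = (\<Sum>b\<in>Basis. (y \<bullet> h b) *\<^sub>R inv_into Basis h (h b))"
      using inj by (intro sum.cong) auto
    also have "\<dots> = T' y" unfolding T'_def
      by (rule sum.reindex_bij_betw[OF h, of "\<lambda>b. (y \<bullet> b) *\<^sub>R inv_into Basis h b"])
    finally show ?thesis by simp
  qed
  have hB: "h b \<in> Basis" if "b \<in> Basis" for b
    using h that by (auto simp: bij_betw_def)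
  have Tc: "T x \<bullet> h b = x \<bullet> b" if "b \<in> Basis" for x b
    unfolding T_def
    using that hB inj by (auto simp: inner_sum_left inner_Basis inj_on_eq_iff if_distrib cong: if_cong)
  have T'T: "T' (T x) = x" for x
    by (simp add: T'eq Tc euclidean_representation)
  have T'c: "T' y \<bullet> b = y \<bullet> h b" if "b \<in> Basis" for y b
    unfolding T'eq using that by (auto simp: inner_sum_left inner_Basis if_distrib cong: if_cong)
  have lin: "linear T" "linear T'"
    unfolding T_def T'_def
    by (auto intro!: linearI simp: inner_add_left scaleR_add_left sum.distrib scaleR_sum_right)
  have nT': "T' x \<bullet> T' y = x \<bullet> y" for x y
  proof -
    have "T' x \<bullet> T' y = (\<Sum>b\<in>Basis. (x \<bullet> h b) * (y \<bullet> h b))"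
      by (subst euclidean_inner) (simp add: T'c)
    also have "\<dots> = x \<bullet> y"
      by (subst (2) euclidean_inner) (rule sum.reindex_bij_betw[OF h])
    finally show ?thesis .
  qed
  have nT: "T x \<bullet> T y = x \<bullet> y" for x y
    using nT'[of "T x" "T y"] by (simp add: T'T)
  have meas: "T \<in> borel_measurable borel" "T' \<in> borel_measurable borel" "f \<in> borel_measurable borel"
    by (intro borel_measurable_continuous_onI linear_continuous_on linear_conv_bounded_linear[THEN iffD1]
          lin orthogonal_transformation_linear[OF f])+
  \<comment> \<open>Conjugation carries \<open>f\<close> over to \<open>real ^ 'n bit0\<close>.
    Since \<open>T'\<close> preserves Lebesgue measure and \<open>T'\<close> after \<open>T\<close>
    is the identity, invariance under the conjugate gives back invariance under
    \<open>f\<close>.\<close>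
  have o: "orthogonal_transformation (T \<circ> f \<circ> T')"
    using f lin unfolding orthogonal_transformation_def
    by (auto simp: nT nT' intro!: linear_compose)
  have d1: "distr lborel borel T = lborel"
    unfolding T_def[abs_def] by (rule distr_lborel_relabel_basis[OF h])
  have d2: "distr lborel borel T' = lborel"
    unfolding T'_def[abs_def] by (rule distr_lborel_relabel_basis[OF bij_betw_inv_into[OF h]])
  have "lborel = distr (distr lborel borel (T \<circ> f \<circ> T')) borel T'"
    by (simp add: distr_lborel_orthogonal_cart[OF o] d2)
  also have "\<dots> = distr lborel borel (f \<circ> T')"
  proof (subst distr_distr)
    show "T \<circ> f \<circ> T' \<in> lborel \<rightarrow>\<^sub>M borel"
      using meas by (auto intro!: measurable_comp[of _ _ borel])
    show "T' \<in> borel \<rightarrow>\<^sub>M borel" by (rule meas)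
    have "T' \<circ> (T \<circ> f \<circ> T') = f \<circ> T'" by (auto simp: T'T)
    thus "distr lborel borel (T' \<circ> (T \<circ> f \<circ> T')) = distr lborel borel (f \<circ> T')" by simp
  qed
  also have "\<dots> = distr (distr lborel borel T') borel f"
    using meas by (subst distr_distr) auto
  finally show ?thesis by (simp add: d2)
qed

section \<open>The Hermitian form\<close>

lemma Re_herm: "Re (herm z w) = z \<bullet> w"
  by (simp add: herm_def inner_vec_def inner_complex_def)

lemma herm_cnj: "herm w z = cnj (herm z w)"
  by (simp add: herm_def mult.commute)

lemma herm_add_left: "herm (x + y) z = herm x z + herm y z"
  and herm_diff_left: "herm (x - y) z = herm x z - herm y z"
  and herm_scale_left: "herm (c *s x) z = c * herm x z"
  by (simp_all add: herm_def algebra_simps sum.distrib sum_subtractf sum_distrib_left)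

lemma herm_scaleR_left: "herm (t *\<^sub>R x) z = of_real t * herm x z"
  unfolding herm_def vector_scaleR_component
  by (simp add: scaleR_conv_of_real sum_distrib_left mult_ac)

lemma herm_add_right: "herm z (x + y) = herm z x + herm z y"
  and herm_diff_right: "herm z (x - y) = herm z x - herm z y"
  and herm_scale_right: "herm z (c *s x) = cnj c * herm z x"
  by (simp_all add: herm_def algebra_simps sum.distrib sum_subtractf sum_distrib_left)

lemma herm_scaleR_right: "herm z (t *\<^sub>R x) = of_real t * herm z x"
  unfolding herm_def vector_scaleR_component
  by (simp add: scaleR_conv_of_real sum_distrib_left mult_ac)

lemmas herm_simps = herm_add_left herm_diff_left herm_scale_left herm_scaleR_left
  herm_add_right herm_diff_right herm_scale_right herm_scaleR_right

lemma norm_cscale: "norm (c *s x) = norm c * norm (x :: complex ^ 'n::finite)"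
  by (simp add: norm_vec_def norm_mult L2_set_right_distrib)

section \<open>Cauchy-Schwarz inequality and transitivity of the unitary group on the sphere\<close>

lemma obtain_phase:
  fixes a :: complex
  obtains c where "norm c = 1" "c * a = of_real (norm a)"
proof (cases "a = 0")
  case True thus ?thesis using that[of 1] by simp
next
  case False
  have "cnj a / of_real (norm a) * a = of_real (norm a)"
    using False complex_norm_square[of a]
    by (simp add: field_simps power2_eq_square)
  moreover have "norm (cnj a / of_real (norm a)) = 1"
    using False by (simp add: norm_divide)
  ultimately show ?thesis using that by blast
qed

text \<open>A phase makes the form real and nonnegative without changing norms; it is then the real
  inner product, so the real Cauchy-Schwarz inequality applies.\<close>

lemma norm_herm_le: "norm (herm z w) \<le> norm z * norm w"
proof -
  obtain c where c: "norm c = 1" "c * herm z w = of_real (norm (herm z w))"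
    by (rule obtain_phase)
  have "norm (herm z w) = (c *s z) \<bullet> w"
    using c(2) by (simp add: herm_scale_left flip: Re_herm)
  also have "\<dots> \<le> norm (c *s z) * norm w" by (rule norm_cauchy_schwarz)
  finally show ?thesis by (simp add: norm_cscale c)
qed

lemma herm_axis: "herm x (axis j 1) = x $ j"
proof -
  have "herm x (axis j 1) = (\<Sum>i\<in>UNIV. if i = j then x $ i else 0)"
    unfolding herm_def axis_def by (intro sum.cong) auto
  thus ?thesis by simp
qed

text \<open>\<open>U\<close> is multiplication by a phase \<open>c\<close> followed by the complex
  reflection along \<open>c *s a - b\<close>. The phase makes \<open>herm (c *s a) b\<close> real,
  which is exactly what lets a reflection send \<open>c *s a\<close> to \<open>b\<close>.\<close>

lemma exists_unitary:
  fixes a b :: "complex ^ 'n::finite"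
  assumes "norm a = 1" "norm b = 1"
  obtains U where "orthogonal_transformation U" "\<And>x y. herm (U x) (U y) = herm x y" "U a = b"
proof -
  obtain c where c: "norm c = 1" "c * herm a b = of_real (norm (herm a b))"
    by (rule obtain_phase)
  define t where "t = norm (herm a b)"
  define v where "v = c *s a - b"
  define U where "U x = c *s x - (2 * herm (c *s x) v / of_real ((norm v)\<^sup>2)) *s v" for x
  have cc: "c * cnj c = 1" by (simp add: complex_norm_square[symmetric] c)
  have aa: "herm a a = 1" "herm b b = 1" by (simp_all add: herm_self assms)
  have ab: "c * herm a b = of_real t" using c by (simp add: t_def)
  have "cnj (c * herm a b) = of_real t" by (simp add: ab)
  hence ba: "cnj c * herm b a = of_real t" by (simp add: herm_cnj[of b a])
  have vv: "herm v v = of_real (2 - 2 * t)"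
    using cc aa ab ba by (simp add: v_def herm_simps algebra_simps)
  hence nv: "(norm v)\<^sup>2 = 2 - 2 * t"
    unfolding herm_self of_real_eq_iff .
  have Uab: "U a = b"
  proof (cases "v = 0")
    case True thus ?thesis by (simp add: U_def v_def)
  next
    case False
    hence "2 - 2 * t \<noteq> 0" using nv by (metis norm_eq_zero zero_eq_power2)
    moreover have "2 * herm (c *s a) v = of_real (2 - 2 * t)"
      using cc aa ab by (simp add: v_def herm_simps algebra_simps)
    ultimately have "2 * herm (c *s a) v / of_real ((norm v)\<^sup>2) = 1"
      unfolding nv by (metis divide_self of_real_eq_0_iff)
    thus ?thesis by (simp add: U_def v_def)
  qed
  have herm: "herm (U x) (U y) = herm x y" for x y
  proof -
    define k where "k = 2 / (norm v)\<^sup>2"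
    define X Y where "X = c *s x" and "Y = c *s y"
    have U: "U x = X - (of_real k * herm X v) *s v" "U y = Y - (of_real k * herm Y v) *s v"
      by (simp_all add: U_def X_def Y_def k_def)
    \<comment> \<open>This makes the quadratic term of the reflection cancel the two cross terms. It
      also holds for \<open>v = 0\<close>, where division by zero gives
      \<open>k = 0\<close>.\<close>
    have kk: "of_real k * of_real k * herm v v = (2 * of_real k :: complex)"
      unfolding herm_self k_def of_real_mult[symmetric]
      by (cases "v = 0") (simp_all add: power2_eq_square)
    have "herm (U x) (U y) = herm X Y - 2 * of_real k * herm X v * cnj (herm Y v)
        + (of_real k * of_real k * herm v v) * herm X v * cnj (herm Y v)"
      unfolding U herm_simps by (simp add: herm_cnj[of v Y] algebra_simps)
    also have "\<dots> = herm X Y" unfolding kk by simp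
    also have "\<dots> = herm x y"
      using cc by (simp add: X_def Y_def herm_simps algebra_simps)
    finally show ?thesis .
  qed
  have "linear U"
    by (rule linearI)
       (simp_all add: U_def herm_simps vec_eq_iff algebra_simps add_divide_distrib scaleR_conv_of_real[where 'a=complex])
  moreover have "U x \<bullet> U y = x \<bullet> y" for x y
    by (simp add: herm flip: Re_herm)
  ultimately show ?thesis using that herm Uab by (auto simp: orthogonal_transformation_def)
qed

section \<open>Anisotropic boxes and caps on the sphere\<close>

lemma space_sphere_measure: "space sphere_measure = unit_sphere"
  by (simp add: sphere_measure_def space_restrict_space)

lemma sets_sphere_measure: "sets sphere_measure = sets (restrict_space borel unit_sphere)"
  unfolding sphere_measure_def by (rule sets_restrict_space_cong) simp

lemma id_measurable_sphere [measurable]: "(\<lambda>\<xi>. \<xi>) \<in> sphere_measure \<rightarrow>\<^sub>M borel"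
  by (subst measurable_cong_sets[OF sets_sphere_measure refl]) (rule measurable_restrict_space1, simp)

text \<open>Every estimate on the sphere is reduced through this cone formula to comparing a cone in
  the unit ball with a box.\<close>

lemma emeasure_sphere_measure:
  fixes A :: "(complex ^ 'n::finite) set"
  assumes A: "A \<in> sets borel"
  shows "emeasure sphere_measure (A \<inter> unit_sphere)
    = emeasure lborel (unit_ball \<inter> {x. x /\<^sub>R norm x \<in> A \<inter> unit_sphere})
        / emeasure lborel (unit_ball :: (complex ^ 'n) set)"
proof -
  let ?p = "\<lambda>z :: complex ^ 'n. z /\<^sub>R norm z"
  let ?U = "uniform_measure lborel (unit_ball :: (complex ^ 'n) set)"
  have m: "?p \<in> ?U \<rightarrow>\<^sub>M borel"
    by (subst measurable_cong_sets[of _ lborel _ borel]) simp_all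
  have AS: "A \<inter> unit_sphere \<in> sets borel" using A by simp
  have "emeasure sphere_measure (A \<inter> unit_sphere) = emeasure (distr ?U borel ?p) (A \<inter> unit_sphere)"
    unfolding sphere_measure_def by (subst emeasure_restrict_space) auto
  also have "\<dots> = emeasure ?U (?p -` (A \<inter> unit_sphere) \<inter> space ?U)"
    by (rule emeasure_distr[OF m AS])
  also have "\<dots> = emeasure lborel (unit_ball \<inter> (?p -` (A \<inter> unit_sphere) \<inter> space ?U)) / emeasure lborel (unit_ball :: (complex ^ 'n) set)"
    using measurable_sets[OF m AS] by (subst emeasure_uniform_measure) simp_all
  also have "unit_ball \<inter> (?p -` (A \<inter> unit_sphere) \<inter> space ?U)
      = unit_ball \<inter> {x. x /\<^sub>R norm x \<in> A \<inter> unit_sphere}" by auto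
  finally show ?thesis .
qed

lemma prod_Basis_complex_vec:
  fixes f :: "complex ^ 'n::finite \<Rightarrow> real"
  shows "(\<Prod>b\<in>Basis. f b) = (\<Prod>i\<in>UNIV. f (axis i 1) * f (axis i \<i>))"
proof -
  have "(\<Prod>b\<in>Basis. f b) = (\<Prod>i\<in>UNIV. \<Prod>b\<in>{axis i 1, axis i \<i>}. f b)"
    unfolding Basis_vec_def Basis_complex_def
    by (subst prod.UNION_disjoint) (auto simp: axis_eq_axis mult_ac)
  also have "\<dots> = (\<Prod>i\<in>UNIV. f (axis i 1) * f (axis i \<i>))"
    by (intro prod.cong refl) (auto simp: axis_eq_axis mult_ac)
  finally show ?thesis .
qed

lemma emeasure_cbox_complex_vec:
  fixes l u :: "complex ^ 'n::finite"
  assumes "\<And>i. Re (l $ i) \<le> Re (u $ i)" "\<And>i. Im (l $ i) \<le> Im (u $ i)"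
  shows "emeasure lborel (cbox l u)
    = ennreal (\<Prod>i\<in>UNIV. (Re (u $ i) - Re (l $ i)) * (Im (u $ i) - Im (l $ i)))"
proof -
  have "emeasure lborel (cbox l u) = ennreal (\<Prod>b\<in>Basis. (u - l) \<bullet> b)"
    using assms by (intro emeasure_lborel_cbox) (auto simp: Basis_vec_def Basis_complex_def inner_axis inner_complex_def)
  thus ?thesis
    unfolding prod_Basis_complex_vec by (simp add: inner_axis inner_complex_def)
qed

lemma mem_cbox_complex_vec:
  "x \<in> cbox l (u :: complex ^ 'n::finite) \<longleftrightarrow>
    (\<forall>i. Re (l $ i) \<le> Re (x $ i) \<and> Re (x $ i) \<le> Re (u $ i) \<and>
         Im (l $ i) \<le> Im (x $ i) \<and> Im (x $ i) \<le> Im (u $ i))"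
  by (auto simp: mem_box Basis_vec_def Basis_complex_def inner_axis inner_complex_def)

lemma norm_vec_split:
  fixes x :: "complex ^ 'n::finite"
  shows "(norm x)\<^sup>2 = (norm (x $ j))\<^sup>2 + (\<Sum>k\<in>UNIV - {j}. (norm (x $ k))\<^sup>2)"
proof -
  have "(norm x)\<^sup>2 = (\<Sum>k\<in>UNIV. (norm (x $ k))\<^sup>2)"
    by (simp add: norm_vec_def L2_set_def sum_nonneg)
  thus ?thesis by (simp add: sum.remove[of UNIV j])
qed

lemma emeasure_unitary_vimage:
  fixes U :: "complex ^ 'n::finite \<Rightarrow> complex ^ 'n"
  assumes U: "orthogonal_transformation U" and A: "A \<in> sets borel"
  shows "emeasure lborel (U -` A) = emeasure lborel A"
proof -
  have [measurable]: "U \<in> borel_measurable borel"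
    by (intro borel_measurable_continuous_onI linear_continuous_on linear_conv_bounded_linear[THEN iffD1]
          orthogonal_transformation_linear[OF U])
  have "emeasure lborel A = emeasure (distr lborel borel U) A"
    by (simp add: distr_lborel_orthogonal[OF U])
  also have "\<dots> = emeasure lborel (U -` A)" using A by (subst emeasure_distr) auto
  finally show ?thesis by simp
qed

lemma herm_measurable [measurable (raw)]:
  assumes f[measurable]: "f \<in> borel_measurable M" and g[measurable]: "g \<in> borel_measurable M"
  shows "(\<lambda>x. herm (f x) (g x :: complex ^ 'n::finite)) \<in> borel_measurable M"
proof -
  have "(\<lambda>x. f x $ i) \<in> borel_measurable M" "(\<lambda>x. g x $ i) \<in> borel_measurable M" for i
    by (rule measurable_compose[OF f] measurable_compose[OF g],
        intro borel_measurable_continuous_onI continuous_intros)+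
  moreover have "(\<lambda>x. cnj (g x $ i)) \<in> borel_measurable M" if "(\<lambda>x. g x $ i) \<in> borel_measurable M" for i
    using that by (intro measurable_compose[OF that borel_measurable_continuous_onI]) (intro continuous_intros)
  ultimately show ?thesis unfolding herm_def by (intro borel_measurable_sum borel_measurable_times) auto
qed

text \<open>The exponents reflect the anisotropy of the sphere: one real direction of size \<open>a\<close>, and
  \<open>2n - 2\<close> real directions of size \<open>b\<close> spanning the complex tangent space.\<close>

lemma sphere_measure_box_upper:
  fixes \<eta> :: "complex ^ 'n::finite"
  assumes \<eta>: "norm \<eta> = 1" and a: "0 \<le> a" and b: "0 \<le> b"
  shows "emeasure sphere_measure
      {\<xi> \<in> unit_sphere. \<bar>Im (herm \<xi> \<eta>)\<bar> \<le> a \<and> (norm \<xi>)\<^sup>2 - (norm (herm \<xi> \<eta>))\<^sup>2 \<le> b\<^sup>2}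
    \<le> ennreal (4 ^ CARD('n) / measure lborel (unit_ball :: (complex ^ 'n) set) * a * b ^ (2 * (CARD('n) - 1)))"
proof -
  obtain j :: 'n where True by auto
  have "norm (axis j 1 :: complex ^ 'n) = 1"
    by (simp add: norm_eq_1 inner_axis_axis)
  then obtain U where U: "orthogonal_transformation U" "\<And>x y. herm (U x) (U y) = herm x y" "U \<eta> = axis j 1"
    using exists_unitary[OF \<eta>] by metis
  have Uj: "U x $ j = herm x \<eta>" for x
    using U(2)[of x \<eta>] U(3) by (simp add: herm_axis)
  have Un: "norm (U x) = norm x" for x using U(1) by (simp add: orthogonal_transformation)
  define A where "A = {\<xi>. \<bar>Im (herm \<xi> \<eta>)\<bar> \<le> a \<and> (norm \<xi>)\<^sup>2 - (norm (herm \<xi> \<eta>))\<^sup>2 \<le> b\<^sup>2}"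
  \<comment> \<open>With \<eta> rotated to the axis \<open>j\<close>, the cone fits into this box:
    the real part of coordinate \<open>j\<close> is limited only by the ball, its imaginary part by
    \<open>a\<close>, and all other coordinates by \<open>b\<close>.\<close>
  define u :: "complex ^ 'n" where "u = (\<chi> k. if k = j then Complex 1 a else Complex b b)"
  have A: "A \<in> sets borel" unfolding A_def by measurable
  have "unit_ball \<inter> {x. x /\<^sub>R norm x \<in> A \<inter> unit_sphere} \<subseteq> U -` cbox (-u) u"
  proof
    fix x :: "complex ^ 'n" assume x: "x \<in> unit_ball \<inter> {x. x /\<^sub>R norm x \<in> A \<inter> unit_sphere}"
    hence x0: "x \<noteq> 0" "0 < norm x" and x1: "norm x \<le> 1" by auto
    have "\<bar>Im (herm x \<eta>)\<bar> / norm x \<le> a"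
      using x x0 by (simp add: A_def herm_scaleR_left abs_mult field_simps)
    hence "\<bar>Im (herm x \<eta>)\<bar> \<le> a * norm x" using x0 by (simp add: field_simps)
    also have "\<dots> \<le> a * 1" using a x1 by (intro mult_left_mono)
    finally have 1: "\<bar>Im (U x $ j)\<bar> \<le> a" by (simp add: Uj)
    have "\<bar>Re (U x $ j)\<bar> \<le> norm (U x $ j)" by (rule abs_Re_le_cmod)
    also have "\<dots> \<le> norm (U x)" by (rule Finite_Cartesian_Product.norm_nth_le)
    also have "\<dots> \<le> 1" using x1 by (simp add: Un)
    finally have 2: "\<bar>Re (U x $ j)\<bar> \<le> 1" .
    have "1 - (norm (herm x \<eta>) / norm x)\<^sup>2 \<le> b\<^sup>2"
      using x x0 by (simp add: A_def herm_scaleR_left norm_mult norm_inverse divide_inverse mult_ac)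
    \<comment> \<open>Multiplying by |x|^2 \<le> 1 turns the condition on the direction of
      \<open>x\<close> into one on \<open>x\<close> itself.\<close>
    hence "(norm x)\<^sup>2 * (1 - (norm (herm x \<eta>) / norm x)\<^sup>2) \<le> 1 * b\<^sup>2"
      using x1 x0(2) by (intro mult_mono') (auto simp: power_le_one divide_le_eq_1 intro!: power_le_one order_trans[OF norm_herm_le] simp: \<eta>)
    moreover have "(norm x)\<^sup>2 * (1 - (norm (herm x \<eta>) / norm x)\<^sup>2) = (norm x)\<^sup>2 - (norm (herm x \<eta>))\<^sup>2"
      using x0 by (simp add: right_diff_distrib power_divide)
    ultimately have 3: "(norm (U x))\<^sup>2 - (norm (U x $ j))\<^sup>2 \<le> b\<^sup>2"
      by (simp add: Un Uj)
    have 4: "norm (U x $ k) \<le> b" if "k \<noteq> j" for k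
    proof (rule power2_le_imp_le[OF _ b])
      have "(norm (U x $ k))\<^sup>2 \<le> (\<Sum>k\<in>UNIV - {j}. (norm (U x $ k))\<^sup>2)"
        using that by (intro member_le_sum) auto
      thus "(norm (U x $ k))\<^sup>2 \<le> b\<^sup>2" using 3 norm_vec_split[of "U x" j] by linarith
    qed
    show "x \<in> U -` cbox (-u) u"
      using 1 2 order_trans[OF abs_Re_le_cmod 4] order_trans[OF abs_Im_le_cmod 4]
      by (auto simp: mem_cbox_complex_vec u_def abs_le_iff minus_le_iff)
  qed
  hence "emeasure lborel (unit_ball \<inter> {x. x /\<^sub>R norm x \<in> A \<inter> unit_sphere}) \<le> emeasure lborel (U -` cbox (-u) u)"
    using A U(1) by (intro emeasure_mono) (auto intro!: measurable_sets_borel[of U borel, simplified] linear_continuous_on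
       borel_measurable_continuous_onI linear_conv_bounded_linear[THEN iffD1] orthogonal_transformation_linear)
  also have "\<dots> = emeasure lborel (cbox (-u) u)" by (rule emeasure_unitary_vimage[OF U(1)]) simp
  also have "\<dots> = ennreal (\<Prod>i\<in>UNIV. (2 * Re (u $ i)) * (2 * Im (u $ i)))"
    using a b by (subst emeasure_cbox_complex_vec) (auto simp: u_def)
  also have "(\<Prod>i\<in>UNIV. (2 * Re (u $ i)) * (2 * Im (u $ i))) = 4 * a * (\<Prod>i\<in>UNIV - {j}. 4 * b\<^sup>2)"
    by (subst prod.remove[of UNIV j]) (auto simp: u_def power2_eq_square intro!: prod.cong)
  also have "(\<Prod>i\<in>UNIV - {j}. 4 * b\<^sup>2) = 4 ^ (CARD('n) - 1) * b ^ (2 * (CARD('n) - 1))"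
    by (simp add: power_mult_distrib power_mult)
  also have "4 * a * (4 ^ (CARD('n) - 1) * b ^ (2 * (CARD('n) - 1))) = 4 ^ CARD('n) * a * b ^ (2 * (CARD('n) - 1))"
    using power_Suc[of "4::real" "CARD('n) - 1"] by (simp add: Suc_diff_1)
  finally have *: "emeasure lborel (unit_ball \<inter> {x. x /\<^sub>R norm x \<in> A \<inter> unit_sphere})
    \<le> ennreal (4 ^ CARD('n) * a * b ^ (2 * (CARD('n) - 1)))" .
  have V: "measure lborel (unit_ball :: (complex ^ 'n) set) > 0" by (rule content_ball_pos) simp
  have Ve: "emeasure lborel (unit_ball :: (complex ^ 'n) set) = ennreal (measure lborel (unit_ball :: (complex ^ 'n) set))"
    using emeasure_lborel_ball_finite[of "0 :: complex ^ 'n" 1] by (intro emeasure_eq_ennreal_measure) auto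
  have "{\<xi> \<in> unit_sphere. \<bar>Im (herm \<xi> \<eta>)\<bar> \<le> a \<and> (norm \<xi>)\<^sup>2 - (norm (herm \<xi> \<eta>))\<^sup>2 \<le> b\<^sup>2} = A \<inter> unit_sphere"
    by (auto simp: A_def)
  hence "emeasure sphere_measure {\<xi> \<in> unit_sphere. \<bar>Im (herm \<xi> \<eta>)\<bar> \<le> a \<and> (norm \<xi>)\<^sup>2 - (norm (herm \<xi> \<eta>))\<^sup>2 \<le> b\<^sup>2}
    \<le> ennreal (4 ^ CARD('n) * a * b ^ (2 * (CARD('n) - 1))) / ennreal (measure lborel (unit_ball :: (complex ^ 'n) set))"
    using * by (simp only: emeasure_sphere_measure[OF A] Ve divide_right_mono_ennreal)
  also have "\<dots> = ennreal (4 ^ CARD('n) / measure lborel (unit_ball :: (complex ^ 'n) set) * a * b ^ (2 * (CARD('n) - 1)))"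
    using V a b by (subst divide_ennreal) (auto simp: field_simps)
  finally show ?thesis .
qed

text \<open>The cone over the cap contains a rotated box with sides of order 1 and \<delta> in the
  coordinate along \<eta> and of order sqrt \<delta> in the other complex coordinates, so of volume
  of order \<delta>^n.\<close>

lemma sphere_measure_cap_lower:
  shows "\<exists>c>0. \<forall>(\<eta> :: complex ^ 'n::finite) \<delta>. norm \<eta> = 1 \<longrightarrow> 0 < \<delta> \<longrightarrow> \<delta> \<le> 1 \<longrightarrow>
    ennreal (c * \<delta> ^ CARD('n)) \<le> emeasure sphere_measure {\<xi> \<in> unit_sphere. norm (1 - herm \<xi> \<eta>) < \<delta>}"
proof -
  define V where "V = measure lborel (unit_ball :: (complex ^ 'n) set)"
  define N where "N = real CARD('n)"
  \<comment> \<open>With this size the squared imaginary part along \<eta> and all transverse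
    coordinates together contribute at most \<delta>/32 to |x|^2, and the imaginary part itself is
    at most \<delta>/8.\<close>
  define \<kappa> where "\<kappa> = 1 / (8 * N)"
  have N1: "N \<ge> 1" by (simp add: N_def Suc_le_eq)
  have \<kappa>0: "0 < \<kappa>" and \<kappa>N: "\<kappa> * N = 1 / 8" using N1 by (auto simp: \<kappa>_def)
  have \<kappa>1: "\<kappa> \<le> 1 / 8" using N1 by (simp add: \<kappa>_def field_simps)
  have V: "V > 0" unfolding V_def by (rule content_ball_pos) simp
  have Ve: "emeasure lborel (unit_ball :: (complex ^ 'n) set) = ennreal V"
    unfolding V_def
    using emeasure_lborel_ball_finite[of "0 :: complex ^ 'n" 1] by (intro emeasure_eq_ennreal_measure) auto
  define c where "c = (1/4) * (2 * \<kappa>) * (4 * \<kappa>\<^sup>2) ^ (CARD('n) - 1) / V"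
  have c0: "c > 0" using V \<kappa>0 by (auto simp: c_def)
  have "ennreal (c * \<delta> ^ CARD('n)) \<le> emeasure sphere_measure {\<xi> \<in> unit_sphere. norm (1 - herm \<xi> \<eta>) < \<delta>}"
    if \<eta>: "norm \<eta> = 1" and \<delta>: "0 < \<delta>" "\<delta> \<le> 1" for \<eta> :: "complex ^ 'n" and \<delta>
  proof -
    obtain j :: 'n where True by auto
    have "norm (axis j 1 :: complex ^ 'n) = 1"
      by (simp add: norm_eq_1 inner_axis_axis)
    then obtain U where U: "orthogonal_transformation U" "\<And>x y. herm (U x) (U y) = herm x y" "U \<eta> = axis j 1"
      using exists_unitary[OF \<eta>] by metis
    have Uj: "U x $ j = herm x \<eta>" for x
      using U(2)[of x \<eta>] U(3) by (simp add: herm_axis)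
    have Un: "norm (U x) = norm x" for x using U(1) by (simp add: orthogonal_transformation)
    define A where "A = {\<xi>. norm (1 - herm \<xi> \<eta>) < \<delta>}"
    define b where "b = \<kappa> * sqrt \<delta>"
    have b: "0 < b" "b\<^sup>2 = \<kappa>\<^sup>2 * \<delta>" using \<delta> \<kappa>0 by (auto simp: b_def power_mult_distrib)
    \<comment> \<open>The real part along \<eta> runs over [1/2, 3/4]: then |x| \<ge> 1/2, so
      normalising \<open>x\<close> costs at most a factor 2, while |x|^2 \<le> 9/16 + 1/32 stays
      below 1.\<close>
    define l :: "complex ^ 'n" where "l = (\<chi> k. if k = j then Complex (1/2) (- \<kappa> * \<delta>) else Complex (-b) (-b))"
    define u :: "complex ^ 'n" where "u = (\<chi> k. if k = j then Complex (3/4) (\<kappa> * \<delta>) else Complex b b)"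
    have A: "A \<in> sets borel" unfolding A_def by measurable
    have lu: "Re (l $ i) \<le> Re (u $ i)" "Im (l $ i) \<le> Im (u $ i)" for i
      using b \<kappa>0 \<delta> by (auto simp: l_def u_def)
    have "U -` cbox l u \<subseteq> unit_ball \<inter> {x. x /\<^sub>R norm x \<in> A \<inter> unit_sphere}"
    proof
      fix x assume "x \<in> U -` cbox l u"
      hence cb: "Re (l $ i) \<le> Re (U x $ i)" "Re (U x $ i) \<le> Re (u $ i)"
        "Im (l $ i) \<le> Im (U x $ i)" "Im (U x $ i) \<le> Im (u $ i)" for i
        by (auto simp: mem_cbox_complex_vec)
      define y where "y = herm x \<eta>"
      have y: "1/2 \<le> Re y" "Re y \<le> 3/4" "\<bar>Im y\<bar> \<le> \<kappa> * \<delta>"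
        using cb[of j] by (auto simp: l_def u_def y_def Uj)
      have k: "(norm (U x $ k))\<^sup>2 \<le> 2 * (\<kappa>\<^sup>2 * \<delta>)" if "k \<noteq> j" for k
      proof -
        have "\<bar>Re (U x $ k)\<bar> \<le> b" "\<bar>Im (U x $ k)\<bar> \<le> b" using cb[of k] that by (auto simp: l_def u_def)
        hence "(Re (U x $ k))\<^sup>2 \<le> b\<^sup>2" "(Im (U x $ k))\<^sup>2 \<le> b\<^sup>2"
          using b(1) by (simp_all add: abs_le_square_iff[symmetric])
        thus ?thesis by (simp add: cmod_power2 b(2))
      qed
      have "(norm x)\<^sup>2 = (norm y)\<^sup>2 + (\<Sum>k\<in>UNIV - {j}. (norm (U x $ k))\<^sup>2)"
        using norm_vec_split[of "U x" j] by (simp add: Un Uj y_def)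
      also have "(\<Sum>k\<in>UNIV - {j}. (norm (U x $ k))\<^sup>2) \<le> (\<Sum>k\<in>UNIV - {j}. 2 * (\<kappa>\<^sup>2 * \<delta>))"
        by (intro sum_mono k) auto
      also have "\<dots> = (N - 1) * (2 * (\<kappa>\<^sup>2 * \<delta>))"
        using N1 by (simp add: N_def card_Diff_singleton of_nat_diff Suc_leI)
      also have "(norm y)\<^sup>2 = (Re y)\<^sup>2 + (Im y)\<^sup>2" by (simp add: cmod_power2)
      finally have nx: "(norm x)\<^sup>2 \<le> (Re y)\<^sup>2 + (Im y)\<^sup>2 + (N - 1) * (2 * (\<kappa>\<^sup>2 * \<delta>))" by simp
      have "(Im y)\<^sup>2 \<le> (\<kappa> * \<delta>)\<^sup>2" using y(3) by (simp add: abs_le_square_iff[symmetric])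
      also have "\<dots> \<le> 2 * (\<kappa>\<^sup>2 * \<delta>)" using \<delta> \<kappa>0 by (simp add: power_mult_distrib power2_eq_square field_simps)
      finally have "(norm x)\<^sup>2 \<le> (Re y)\<^sup>2 + N * (2 * (\<kappa>\<^sup>2 * \<delta>))" using nx by (simp add: algebra_simps)
      also have "N * (2 * (\<kappa>\<^sup>2 * \<delta>)) = 2 * (\<kappa> * N) * \<kappa> * \<delta>" by (simp add: power2_eq_square)
      also have "\<dots> \<le> \<delta> / 32" unfolding \<kappa>N using \<kappa>1 \<delta> by (simp add: field_simps)
      finally have nx: "(norm x)\<^sup>2 \<le> (Re y)\<^sup>2 + \<delta> / 32" by simp
      have "(Re y)\<^sup>2 \<le> (3/4)\<^sup>2" using y by (intro power_mono) auto
      hence "(norm x)\<^sup>2 < 1\<^sup>2" using nx \<delta> by (simp add: power2_eq_square)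
      hence x1: "norm x < 1" by (rule power2_less_imp_less) simp
      have yx: "Re y \<le> norm x"
        using order_trans[OF complex_Re_le_cmod norm_herm_le[of x \<eta>]] by (simp add: y_def \<eta>)
      hence x2: "norm x \<ge> 1/2" using y by simp
      \<comment> \<open>Both \<open>norm x\<close> and \<open>Re y\<close> are at least 1/2, so
        their sum is at least 1 and the difference of squares bounds the difference.\<close>
      have "(norm x - Re y) * 1 \<le> (norm x - Re y) * (norm x + Re y)"
        using yx x2 y by (intro mult_left_mono) auto
      also have "\<dots> \<le> \<delta> / 32" using nx by (simp add: power2_eq_square algebra_simps)
      finally have re: "norm x - Re y \<le> \<delta> / 32" by simp
      have "norm (of_real (norm x) - y) \<le> \<bar>Re (of_real (norm x) - y)\<bar> + \<bar>Im (of_real (norm x) - y)\<bar>"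
        by (rule cmod_le)
      also have "\<dots> \<le> \<delta> / 32 + \<kappa> * \<delta>" using re yx y(3) by simp
      also have "\<dots> < 1/2 * \<delta>" using mult_right_mono[OF \<kappa>1, of \<delta>] \<delta> by linarith
      also have "\<dots> \<le> norm x * \<delta>" using x2 \<delta> by (intro mult_right_mono) auto
      finally have "norm (of_real (norm x) - y) < norm x * \<delta>" .
      moreover have xp: "0 < norm x" using x2 by linarith
      ultimately have "norm (of_real (norm x) - y) / norm x < \<delta>" by (simp only: pos_divide_less_eq mult.commute)
      moreover have "1 - herm (x /\<^sub>R norm x) \<eta> = (of_real (norm x) - y) / of_real (norm x)"
        using xp by (simp add: herm_scaleR_left y_def divide_inverse algebra_simps)
      ultimately have "norm (1 - herm (x /\<^sub>R norm x) \<eta>) < \<delta>" by (simp add: norm_divide)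
      thus "x \<in> unit_ball \<inter> {x. x /\<^sub>R norm x \<in> A \<inter> unit_sphere}"
        using x1 xp by (auto simp: A_def)
    qed
    hence "emeasure lborel (U -` cbox l u) \<le> emeasure lborel (unit_ball \<inter> {x. x /\<^sub>R norm x \<in> A \<inter> unit_sphere})"
    proof (rule emeasure_mono)
      have [measurable]: "(\<lambda>x :: complex ^ 'n. x /\<^sub>R norm x) \<in> borel_measurable borel" by simp
      have "(\<lambda>x. x /\<^sub>R norm x) -` (A \<inter> unit_sphere) \<in> sets borel"
        using A by (intro measurable_sets_borel[of _ borel]) auto
      moreover have "{x. x /\<^sub>R norm x \<in> A \<inter> unit_sphere} = (\<lambda>x. x /\<^sub>R norm x) -` (A \<inter> unit_sphere)" by auto
      ultimately show "unit_ball \<inter> {x. x /\<^sub>R norm x \<in> A \<inter> unit_sphere} \<in> sets lborel" by simp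
    qed
    moreover have "emeasure lborel (U -` cbox l u) = emeasure lborel (cbox l u)" by (rule emeasure_unitary_vimage[OF U(1)]) simp
    moreover have "\<dots> = ennreal (\<Prod>i\<in>UNIV. (Re (u $ i) - Re (l $ i)) * (Im (u $ i) - Im (l $ i)))"
      by (rule emeasure_cbox_complex_vec[OF lu])
    moreover have "(\<Prod>i\<in>UNIV. (Re (u $ i) - Re (l $ i)) * (Im (u $ i) - Im (l $ i)))
       = (1/4) * (2 * \<kappa> * \<delta>) * (\<Prod>i\<in>UNIV - {j}. 4 * b\<^sup>2)"
      by (subst prod.remove[of UNIV j]) (auto simp: u_def l_def power2_eq_square intro!: prod.cong)
    moreover have "(\<Prod>i\<in>UNIV - {j}. 4 * b\<^sup>2) = (4 * \<kappa>\<^sup>2) ^ (CARD('n) - 1) * \<delta> ^ (CARD('n) - 1)"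
      unfolding b(2) by (simp add: power_mult_distrib)
    moreover have "(1/4) * (2 * \<kappa> * \<delta>) * ((4 * \<kappa>\<^sup>2) ^ (CARD('n) - 1) * \<delta> ^ (CARD('n) - 1)) = c * \<delta> ^ CARD('n) * V"
      using power_Suc[of \<delta> "CARD('n) - 1"] V by (simp add: Suc_diff_1 c_def)
    ultimately have "ennreal (c * \<delta> ^ CARD('n) * V) \<le> emeasure lborel (unit_ball \<inter> {x. x /\<^sub>R norm x \<in> A \<inter> unit_sphere})"
      by (simp only:)
    hence "ennreal (c * \<delta> ^ CARD('n) * V) / ennreal V \<le> emeasure sphere_measure (A \<inter> unit_sphere)"
      by (simp only: emeasure_sphere_measure[OF A] Ve divide_right_mono_ennreal)
    moreover have "ennreal (c * \<delta> ^ CARD('n) * V) / ennreal V = ennreal (c * \<delta> ^ CARD('n))"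
      using V c0 \<delta> by (subst divide_ennreal) auto
    moreover have "A \<inter> unit_sphere = {\<xi> \<in> unit_sphere. norm (1 - herm \<xi> \<eta>) < \<delta>}" by (auto simp: A_def)
    ultimately show ?thesis by simp
  qed
  with c0 show ?thesis by blast
qed

section \<open>The pseudo-hyperbolic distance\<close>

text \<open>The closed form of |\<phi>_w(z)|^2 on the ball, as \<open>norm_ball_aut\<close> shows;
  it avoids the projections in the automorphism.\<close>

definition pseudo_dist2 :: "complex ^ 'n::finite \<Rightarrow> complex ^ 'n \<Rightarrow> real" where
  "pseudo_dist2 z w = 1 - (1 - (norm z)\<^sup>2) * (1 - (norm w)\<^sup>2) / (norm (1 - herm z w))\<^sup>2"

lemma obtain_polar:
  fixes w :: "complex ^ 'n::finite"
  obtains \<eta> where "norm \<eta> = 1" "w = norm w *\<^sub>R \<eta>"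
proof (cases "w = 0")
  case True
  have "norm (axis undefined 1 :: complex ^ 'n) = 1" by (simp add: norm_eq_1 inner_axis_axis)
  with True show ?thesis using that by (metis norm_zero scaleR_zero_left)
next
  case False
  thus ?thesis using that[of "w /\<^sub>R norm w"] by simp
qed

lemma one_minus_norm_mult_le: "1 - norm z * norm w \<le> norm (1 - herm z w)"
proof -
  have "1 - norm z * norm w \<le> norm (1::complex) - norm (herm z w)" using norm_herm_le[of z w] by simp
  also have "\<dots> \<le> norm (1 - herm z w)" by (rule norm_triangle_ineq2)
  finally show ?thesis .
qed

lemma one_minus_norm_le:
  assumes "norm z \<le> 1" "norm w \<le> 1"
  shows "1 - norm z \<le> norm (1 - herm z w)" "1 - norm w \<le> norm (1 - herm z w)"
  using one_minus_norm_mult_le[of z w] assms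
    mult_left_mono[of "norm w" 1 "norm z"] mult_right_mono[of "norm z" 1 "norm w"] by auto

lemma norm_one_minus_herm_pos:
  assumes "norm z < 1" "norm w \<le> 1"
  shows "0 < norm (1 - herm z w)"
  using one_minus_norm_le[of z w] assms by linarith

lemma norm_one_minus_herm_commute: "norm (1 - herm w z) = norm (1 - herm z w)"
proof -
  have "1 - herm w z = cnj (1 - herm z w)" by (simp add: herm_cnj[of w z])
  thus ?thesis by (simp only: complex_mod_cnj)
qed

text \<open>A sum of two nonnegative terms, one for the component of \<open>z\<close> along \<eta>
  and one for the orthogonal component, weighted by \<open>1 - s\<^sup>2\<close>. Each can be
  bounded separately, which yields the anisotropic size of pseudo-hyperbolic balls.\<close>

lemma pseudo_dist2_polar:
  assumes "norm \<eta> = 1" "0 \<le> s" "s < 1" "norm z < 1"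
  shows "pseudo_dist2 z (s *\<^sub>R \<eta>) * (norm (1 - herm z (s *\<^sub>R \<eta>)))\<^sup>2
    = (norm (herm z \<eta> - of_real s))\<^sup>2 + (1 - s\<^sup>2) * ((norm z)\<^sup>2 - (norm (herm z \<eta>))\<^sup>2)"
proof -
  have "0 < norm (1 - herm z (s *\<^sub>R \<eta>))" using assms by (intro norm_one_minus_herm_pos) auto
  hence "pseudo_dist2 z (s *\<^sub>R \<eta>) * (norm (1 - herm z (s *\<^sub>R \<eta>)))\<^sup>2
    = (norm (1 - herm z (s *\<^sub>R \<eta>)))\<^sup>2 - (1 - (norm z)\<^sup>2) * (1 - s\<^sup>2)"
  proof -
    have gen: "(1 - A / q) * q = q - A" if "q \<noteq> 0" for A q :: real
      using that by (simp add: field_simps)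
    show ?thesis
      unfolding pseudo_dist2_def using \<open>0 < _\<close> assms by (subst gen) auto
  qed
  also have "\<dots> = (norm (herm z \<eta> - of_real s))\<^sup>2 + (1 - s\<^sup>2) * ((norm z)\<^sup>2 - (norm (herm z \<eta>))\<^sup>2)"
    unfolding cmod_power2 herm_scaleR_right by (simp add: power2_eq_square algebra_simps)
  finally show ?thesis .
qed

text \<open>The numerator of the automorphism is an orthogonal sum: a multiple of \<eta> and a
  multiple of the part of \<open>z\<close> orthogonal to \<eta>. By Pythagoras its squared norm is
  the right-hand side of \<open>pseudo_dist2_polar\<close>.\<close>

lemma norm_ball_aut:
  assumes z: "norm z < 1" and w: "norm w < 1"
  shows "(norm (ball_aut w z))\<^sup>2 = pseudo_dist2 z w"
proof (cases "w = 0")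
  case True
  thus ?thesis by (simp add: ball_aut_0 pseudo_dist2_def herm_def)
next
  case False
  define s where "s = norm w"
  obtain \<eta> where \<eta>: "norm \<eta> = 1" "w = s *\<^sub>R \<eta>" unfolding s_def by (rule obtain_polar)
  have s: "0 < s" "s < 1" using False w by (auto simp: s_def)
  define \<alpha> k where "\<alpha> = herm z \<eta>" and "k = sqrt (1 - s\<^sup>2)"
  have k: "k\<^sup>2 = 1 - s\<^sup>2" using s by (simp add: k_def power_le_one)
  have hw: "herm z w = of_real s * \<alpha>" by (simp add: \<eta> \<alpha>_def herm_scaleR_right)
  have P: "proj_on w z = \<alpha> *s \<eta>"
    using False s unfolding proj_on_def hw s_def[symmetric]
    by (simp add: \<eta>(2) vec_eq_iff scaleR_conv_of_real[where 'a=complex] power2_eq_square)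
  define v where "v = w - proj_on w z - k *\<^sub>R (z - proj_on w z)"
  have hn: "herm \<eta> \<eta> = 1" "herm \<eta> z = cnj \<alpha>" "herm z \<eta> = \<alpha>" by (simp_all add: herm_self \<eta>(1) \<alpha>_def flip: herm_cnj)
  have "herm v v = (\<alpha> - s) * cnj (\<alpha> - s) + of_real (k\<^sup>2) * (herm z z - \<alpha> * cnj \<alpha>)"
    unfolding v_def P unfolding \<eta>(2) by (simp add: herm_simps hn algebra_simps power2_eq_square)
  also have "\<dots> = of_real ((norm (\<alpha> - s))\<^sup>2 + (1 - s\<^sup>2) * ((norm z)\<^sup>2 - (norm \<alpha>)\<^sup>2))"
    unfolding herm_self k of_real_add of_real_mult of_real_diff complex_norm_square by simp
  finally have v: "(norm v)\<^sup>2 = (norm (\<alpha> - s))\<^sup>2 + (1 - s\<^sup>2) * ((norm z)\<^sup>2 - (norm \<alpha>)\<^sup>2)"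
    unfolding herm_self of_real_eq_iff .
  have pos: "0 < norm (1 - herm z w)" using z w by (intro norm_one_minus_herm_pos) auto
  have "ball_aut w z = inverse (1 - herm z w) *s v"
    by (simp add: ball_aut_def v_def k_def s_def)
  hence "(norm (ball_aut w z))\<^sup>2 * (norm (1 - herm z w))\<^sup>2 = (norm v)\<^sup>2"
    using pos by (simp add: norm_cscale norm_inverse power_mult_distrib power_inverse)
  also have "\<dots> = pseudo_dist2 z w * (norm (1 - herm z w))\<^sup>2"
    unfolding v \<eta>(2) using pseudo_dist2_polar[of \<eta> s z] \<eta>(1) s z by (simp add: \<alpha>_def)
  finally show ?thesis using pos by simp
qed

text \<open>Write 1 - \<langle>a,c\<rangle> as (1 - \<langle>a,b\<rangle>) + \<langle>a-b,
  b-c\<rangle> + (|b|^2 - 1) + (1 - \<langle>b,c\<rangle>). The mixed term is controlled by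
  Cauchy-Schwarz and |u-v|^2 \<le> 2 |1 - \<langle>u,v\<rangle>|, the third term by 1 - |b| \<le> |1
  - \<langle>b,c\<rangle>|.\<close>

lemma one_minus_herm_quasi_triangle:
  assumes "norm a \<le> 1" "norm b \<le> 1" "norm c \<le> 1"
  shows "norm (1 - herm a c) \<le> 2 * norm (1 - herm a b) + 4 * norm (1 - herm b c)"
proof -
  define X Y where "X = norm (1 - herm a b)" and "Y = norm (1 - herm b c)"
  have sq: "(norm (u - v))\<^sup>2 \<le> 2 * norm (1 - herm u v)" if "norm u \<le> 1" "norm v \<le> 1"
    for u v :: "complex ^ 'a"
  proof -
    have "(norm (u - v))\<^sup>2 = (norm u)\<^sup>2 + (norm v)\<^sup>2 - 2 * Re (herm u v)"
      by (simp add: Re_herm power2_norm_eq_inner inner_diff inner_commute)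
    also have "\<dots> \<le> 2 * Re (1 - herm u v)"
      using power_le_one[OF norm_ge_zero that(1), of 2] power_le_one[OF norm_ge_zero that(2), of 2] by simp
    also have "\<dots> \<le> 2 * norm (1 - herm u v)" using complex_Re_le_cmod[of "1 - herm u v"] by simp
    finally show ?thesis .
  qed
  have "1 - herm a c = (1 - herm a b) + herm (a - b) (b - c) + (of_real ((norm b)\<^sup>2) - 1) + (1 - herm b c)"
    unfolding herm_self[symmetric] by (simp add: herm_simps)
  hence "norm (1 - herm a c) \<le> X + norm (herm (a - b) (b - c)) + norm (of_real ((norm b)\<^sup>2) - 1 :: complex) + Y"
    unfolding X_def Y_def by (metis (no_types, lifting) norm_triangle_le norm_triangle_ineq add_mono_thms_linordered_semiring(3))
  moreover have "norm (of_real ((norm b)\<^sup>2) - 1 :: complex) \<le> 2 * Y"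
  proof -
    have "norm (of_real ((norm b)\<^sup>2) - 1 :: complex) = norm (of_real ((norm b)\<^sup>2 - 1) :: complex)" by simp
    also have "\<dots> = \<bar>(norm b)\<^sup>2 - 1\<bar>" by (simp only: norm_of_real)
    also have "\<dots> = 1 - (norm b)\<^sup>2"
      using power_le_one[OF norm_ge_zero assms(2), of 2] by simp
    also have "\<dots> = (1 - norm b) * (1 + norm b)" by (simp add: power2_eq_square algebra_simps)
    also have "\<dots> \<le> (1 - norm b) * 2" using assms by (intro mult_left_mono) auto
    also have "\<dots> \<le> 2 * Y" using one_minus_norm_le(1)[of b c] assms by (simp add: Y_def)
    finally show ?thesis .
  qed
  moreover have "norm (herm (a - b) (b - c)) \<le> X + Y"
  proof -
    have "norm (herm (a - b) (b - c)) \<le> norm (a - b) * norm (b - c)" by (rule norm_herm_le)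
    also have "\<dots> \<le> ((norm (a - b))\<^sup>2 + (norm (b - c))\<^sup>2) / 2"
      using sum_squares_bound[of "norm (a - b)" "norm (b - c)"] by simp
    also have "\<dots> \<le> X + Y"
      using sq[of a b] sq[of b c] assms by (simp add: X_def Y_def)
    finally show ?thesis .
  qed
  ultimately show ?thesis by (simp add: X_def Y_def)
qed

text \<open>If 1 - \<rho>^2 > 3/4, then (3/4) D^2 < 4 (1-|z|)(1-|w|) with D = |1 -
  \<langle>z,w\<rangle>|. Each factor on the right is at most D, so cancelling one D makes all three
  quantities comparable with constant 16/3.\<close>

lemma pseudo_dist2_near:
  assumes z: "norm z < 1" and w: "norm w < 1" and near: "pseudo_dist2 z w < 1/4"
  shows "norm (1 - herm z w) \<le> 16/3 * (1 - norm z)" "3/16 * (1 - norm z) \<le> 1 - norm w"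
    "1 - norm w \<le> 16/3 * (1 - norm z)"
proof -
  define D where "D = norm (1 - herm z w)"
  have D: "0 < D" "1 - norm z \<le> D" "1 - norm w \<le> D"
    using norm_one_minus_herm_pos[of z w] one_minus_norm_le[of z w] z w by (auto simp: D_def)
  have "3/4 * D\<^sup>2 < (1 - (norm z)\<^sup>2) * (1 - (norm w)\<^sup>2)"
    using near D(1) by (simp add: pseudo_dist2_def D_def[symmetric] field_simps)
  also have "\<dots> = (1 - norm z) * (1 - norm w) * ((1 + norm z) * (1 + norm w))"
    by (simp add: power2_eq_square algebra_simps)
  also have "\<dots> \<le> (1 - norm z) * (1 - norm w) * (2 * 2)"
    using z w by (intro mult_left_mono mult_mono) auto
  finally have *: "3/4 * D\<^sup>2 < 4 * ((1 - norm z) * (1 - norm w))" by simp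
  also have "(1 - norm z) * (1 - norm w) \<le> (1 - norm z) * D" using D z by (intro mult_left_mono) auto
  finally have "D * (3/4 * D) < D * (4 * (1 - norm z))" by (simp add: power2_eq_square mult_ac)
  hence 1: "D \<le> 16/3 * (1 - norm z)" using D(1) by simp
  have "(1 - norm z) * (1 - norm w) \<le> D * (1 - norm w)" using D w by (intro mult_right_mono) auto
  with * have "3/4 * D\<^sup>2 < 4 * (D * (1 - norm w))" by linarith
  hence "D * (3/4 * D) < D * (4 * (1 - norm w))" by (simp add: power2_eq_square mult_ac)
  hence 2: "D \<le> 16/3 * (1 - norm w)" using D(1) by simp
  show "norm (1 - herm z w) \<le> 16/3 * (1 - norm z)" using 1 by (simp add: D_def)
  show "3/16 * (1 - norm z) \<le> 1 - norm w" using order_trans[OF D(2) 2] by (simp add: field_simps)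
  show "1 - norm w \<le> 16/3 * (1 - norm z)" using order_trans[OF D(3) 1] .
qed

text \<open>Replacing the interior point \<open>r *\<^sub>R \<xi>\<close> by its boundary projection
  \<xi> changes the form by (1-r) times a number of modulus at most 1.\<close>

lemma one_minus_herm_radial:
  assumes "norm \<xi> = 1" "0 \<le> r" "r < 1" "norm w < 1"
  shows "norm (1 - herm w \<xi>) \<le> norm (1 - herm (r *\<^sub>R \<xi>) w) + (1 - r)"
    and "norm (1 - herm (r *\<^sub>R \<xi>) w) \<le> norm (1 - herm w \<xi>) + (1 - r)"
proof -
  have e: "norm ((1 - herm w (r *\<^sub>R \<xi>)) - (1 - herm w \<xi>)) \<le> 1 - r"
  proof -
    have "(1 - herm w (r *\<^sub>R \<xi>)) - (1 - herm w \<xi>) = of_real (1 - r) * herm w \<xi>"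
      by (simp add: herm_simps algebra_simps)
    hence "norm ((1 - herm w (r *\<^sub>R \<xi>)) - (1 - herm w \<xi>)) = (1 - r) * norm (herm w \<xi>)"
      using assms by (simp add: norm_mult del: of_real_diff)
    also have "\<dots> \<le> (1 - r) * 1"
      using assms norm_herm_le[of w \<xi>] by (intro mult_left_mono) auto
    finally show ?thesis by simp
  qed
  show "norm (1 - herm w \<xi>) \<le> norm (1 - herm (r *\<^sub>R \<xi>) w) + (1 - r)"
    using norm_triangle_sub[of "1 - herm w \<xi>" "1 - herm w (r *\<^sub>R \<xi>)"] e
    by (simp add: norm_one_minus_herm_commute[of "r *\<^sub>R \<xi>"] norm_minus_commute)
  show "norm (1 - herm (r *\<^sub>R \<xi>) w) \<le> norm (1 - herm w \<xi>) + (1 - r)"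
    using norm_triangle_sub[of "1 - herm w (r *\<^sub>R \<xi>)" "1 - herm w \<xi>"] e
    by (simp add: norm_one_minus_herm_commute[of "r *\<^sub>R \<xi>"])
qed

section \<open>Sphere measure of pseudo-hyperbolic and Euclidean balls\<close>

lemma pseudo_dist2_measurable [measurable (raw)]:
  assumes [measurable]: "f \<in> borel_measurable M" "g \<in> borel_measurable M"
  shows "(\<lambda>x. pseudo_dist2 (f x) (g x :: complex ^ 'n::finite)) \<in> borel_measurable M"
  unfolding pseudo_dist2_def by measurable

lemma sphere_set_measurable [measurable]:
  assumes "Measurable.pred borel P"
  shows "{\<xi> \<in> unit_sphere. P \<xi>} \<in> sets sphere_measure"
proof -
  have "{\<xi>. P \<xi>} \<in> sets borel" using assms by (simp add: pred_def)
  thus ?thesis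
    by (auto simp: sets_sphere_measure sets_restrict_space intro!: image_eqI[of _ _ "{\<xi>. P \<xi>}"])
qed

lemma Suc_double_card: "Suc (2 * (CARD('n::finite) - 1)) = 2 * CARD('n) - 1"
  using zero_less_card_finite[where 'a='n] by presburger

text \<open>By \<open>pseudo_dist2_polar\<close> the set lies in an anisotropic box with a =
  O(\<rho> \<delta>) and b = O(\<rho> sqrt \<delta>), where \<delta> = 1 - r, and a b^(2n-2) =
  O(\<rho>^(2n-1) \<delta>^n). The lower bound \<open>r0\<close> permits division by
  \<open>r\<close>.\<close>

lemma sphere_measure_pseudo_ball:
  assumes r0: "0 < r0"
  shows "\<exists>C\<ge>0. \<forall>r (w :: complex ^ 'n::finite) \<rho>. r0 \<le> r \<longrightarrow> r < 1 \<longrightarrow> norm w < 1 \<longrightarrow> 0 < \<rho> \<longrightarrow> \<rho> \<le> 1/2 \<longrightarrow>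
    emeasure sphere_measure {\<xi> \<in> unit_sphere. pseudo_dist2 (r *\<^sub>R \<xi>) w < \<rho>\<^sup>2}
      \<le> ennreal (C * \<rho> ^ (2 * CARD('n) - 1) * (1 - r) ^ CARD('n))"
proof -
  define V where "V = measure lborel (unit_ball :: (complex ^ 'n) set)"
  have V: "V > 0" unfolding V_def by (rule content_ball_pos) simp
  \<comment> \<open>The factors 16/3 come from \<open>pseudo_dist2_near\<close>: one in
    \<open>K\<close> for D; in \<open>L\<close> two for D^2 and a third for dividing by 1 - s \<ge>
    (3/16) \<delta>. The powers of \<open>r0\<close> come from passing from
    \<open>r *\<^sub>R \<xi>\<close> to \<xi>.\<close>
  define K L where "K = 16 / 3 / r0" and "L = (16/3) ^ 3 / r0\<^sup>2"
  have KL: "K > 0" "L > 0" using r0 by (auto simp: K_def L_def)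
  define C where "C = 4 ^ CARD('n) / V * K * L ^ (CARD('n) - 1)"
  have "emeasure sphere_measure {\<xi> \<in> unit_sphere. pseudo_dist2 (r *\<^sub>R \<xi>) w < \<rho>\<^sup>2}
      \<le> ennreal (C * \<rho> ^ (2 * CARD('n) - 1) * (1 - r) ^ CARD('n))"
    if r: "r0 \<le> r" "r < 1" and w: "norm w < 1" and \<rho>: "0 < \<rho>" "\<rho> \<le> 1/2" for r and w :: "complex ^ 'n" and \<rho>
  proof -
    define s where "s = norm w"
    obtain \<eta> where \<eta>: "norm \<eta> = 1" "w = s *\<^sub>R \<eta>" unfolding s_def by (rule obtain_polar)
    have s: "0 \<le> s" "s < 1" using w by (auto simp: s_def)
    have r': "0 < r" using r r0 by linarith
    define \<delta> where "\<delta> = 1 - r"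
    have \<delta>: "0 < \<delta>" using r by (simp add: \<delta>_def)
    define a b where "a = K * \<rho> * \<delta>" and "b = \<rho> * sqrt (L * \<delta>)"
    have ab: "0 \<le> a" "0 \<le> b" using KL \<rho> \<delta> by (auto simp: a_def b_def)
    have b2: "b\<^sup>2 = \<rho>\<^sup>2 * L * \<delta>" using KL \<delta> by (simp add: b_def power_mult_distrib)
    have "\<rho>\<^sup>2 \<le> (1/2)\<^sup>2" using \<rho> by (intro power_mono) auto
    hence \<rho>2: "\<rho>\<^sup>2 \<le> 1/4" by (simp add: power2_eq_square)
    have "{\<xi> \<in> unit_sphere. pseudo_dist2 (r *\<^sub>R \<xi>) w < \<rho>\<^sup>2}
      \<subseteq> {\<xi> \<in> unit_sphere. \<bar>Im (herm \<xi> \<eta>)\<bar> \<le> a \<and> (norm \<xi>)\<^sup>2 - (norm (herm \<xi> \<eta>))\<^sup>2 \<le> b\<^sup>2}"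
    proof
      fix \<xi> assume "\<xi> \<in> {\<xi> \<in> unit_sphere. pseudo_dist2 (r *\<^sub>R \<xi>) w < \<rho>\<^sup>2}"
      hence \<xi>: "norm \<xi> = 1" and pd: "pseudo_dist2 (r *\<^sub>R \<xi>) w < \<rho>\<^sup>2" by auto
      have nz: "norm (r *\<^sub>R \<xi>) = r" using \<xi> r' by simp
      define D where "D = norm (1 - herm (r *\<^sub>R \<xi>) w)"
      have D0: "D \<ge> 0" by (simp add: D_def)
      have near: "D \<le> 16/3 * \<delta>" "3/16 * \<delta> \<le> 1 - s"
        using pseudo_dist2_near[of "r *\<^sub>R \<xi>" w] pd \<rho>2 r w nz by (auto simp: D_def \<delta>_def s_def)
      define h where "h = herm \<xi> \<eta>"
      have h1: "norm h \<le> 1" using norm_herm_le[of \<xi> \<eta>] by (simp add: \<xi> \<eta> h_def)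
      have "(norm (of_real r * h - of_real s))\<^sup>2 + (1 - s\<^sup>2) * (r\<^sup>2 - (r * norm h)\<^sup>2)
          = pseudo_dist2 (r *\<^sub>R \<xi>) w * D\<^sup>2"
        using pseudo_dist2_polar[OF \<eta>(1) s, of "r *\<^sub>R \<xi>"] nz r' r
        by (simp add: \<eta>(2)[symmetric] herm_scaleR_left norm_mult D_def h_def)
      also have "\<dots> \<le> \<rho>\<^sup>2 * D\<^sup>2" using pd by (intro mult_right_mono) auto
      also have "\<dots> = (\<rho> * D)\<^sup>2" by (simp add: power_mult_distrib)
      also have "\<dots> \<le> (\<rho> * (16/3 * \<delta>))\<^sup>2" using near D0 \<rho> by (intro power_mono mult_left_mono) auto
      finally have sum: "(norm (of_real r * h - of_real s))\<^sup>2 + (1 - s\<^sup>2) * (r\<^sup>2 - (r * norm h)\<^sup>2) \<le> (\<rho> * (16/3 * \<delta>))\<^sup>2" .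
      have s2: "1 - s \<le> 1 - s\<^sup>2" using s by (simp add: power2_eq_square mult_left_le)
      have rh: "0 \<le> r\<^sup>2 - (r * norm h)\<^sup>2"
        using h1 r' by (simp add: power_mult_distrib mult_left_le power_le_one)
      have "0 \<le> (1 - s\<^sup>2) * (r\<^sup>2 - (r * norm h)\<^sup>2)" using s s2 rh by (intro mult_nonneg_nonneg) auto
      hence "(norm (of_real r * h - of_real s))\<^sup>2 \<le> (\<rho> * (16/3 * \<delta>))\<^sup>2" using sum by linarith
      hence "norm (of_real r * h - of_real s) \<le> \<rho> * (16/3 * \<delta>)"
        by (rule power2_le_imp_le) (use \<rho> \<delta> in auto)
      moreover have "r * \<bar>Im h\<bar> \<le> norm (of_real r * h - of_real s)"
        using abs_Im_le_cmod[of "of_real r * h - of_real s"] r' by (simp add: abs_mult)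
      moreover have "r0 * \<bar>Im h\<bar> \<le> r * \<bar>Im h\<bar>" using r by (intro mult_right_mono) auto
      ultimately have "r0 * \<bar>Im h\<bar> \<le> \<rho> * (16/3 * \<delta>)" by linarith
      hence 1: "\<bar>Im h\<bar> \<le> a" using r0 by (simp add: a_def K_def field_simps)
      have h2: "0 \<le> 1 - (norm h)\<^sup>2" using h1 by (simp add: power_le_one)
      have "(3/16 * \<delta>) * (r0\<^sup>2 * (1 - (norm h)\<^sup>2)) \<le> (1 - s\<^sup>2) * (r\<^sup>2 * (1 - (norm h)\<^sup>2))"
        using near s s2 r r0 h2 \<delta> by (intro mult_mono power_mono) auto
      also have "\<dots> = (1 - s\<^sup>2) * (r\<^sup>2 - (r * norm h)\<^sup>2)" by (simp add: power_mult_distrib algebra_simps)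
      also have "\<dots> \<le> (\<rho> * (16/3 * \<delta>))\<^sup>2" using sum zero_le_power2[of "norm (of_real r * h - of_real s)"] by linarith
      also have "(\<rho> * (16/3 * \<delta>))\<^sup>2 = (3/16 * \<delta>) * (r0\<^sup>2 * (\<rho>\<^sup>2 * L * \<delta>))"
        using r0 by (simp add: L_def power2_eq_square power3_eq_cube)
      finally have "r0\<^sup>2 * (1 - (norm h)\<^sup>2) \<le> r0\<^sup>2 * (\<rho>\<^sup>2 * L * \<delta>)"
        using \<delta> by (subst (asm) mult_le_cancel_left_pos) auto
      hence 2: "1 - (norm h)\<^sup>2 \<le> b\<^sup>2"
        unfolding b2 using r0 by (subst (asm) mult_le_cancel_left_pos) auto
      show "\<xi> \<in> {\<xi> \<in> unit_sphere. \<bar>Im (herm \<xi> \<eta>)\<bar> \<le> a \<and> (norm \<xi>)\<^sup>2 - (norm (herm \<xi> \<eta>))\<^sup>2 \<le> b\<^sup>2}"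
        using 1 2 \<xi> by (simp add: h_def)
    qed
    hence "emeasure sphere_measure {\<xi> \<in> unit_sphere. pseudo_dist2 (r *\<^sub>R \<xi>) w < \<rho>\<^sup>2}
      \<le> emeasure sphere_measure {\<xi> \<in> unit_sphere. \<bar>Im (herm \<xi> \<eta>)\<bar> \<le> a \<and> (norm \<xi>)\<^sup>2 - (norm (herm \<xi> \<eta>))\<^sup>2 \<le> b\<^sup>2}"
      by (rule emeasure_mono) measurable
    also have "\<dots> \<le> ennreal (4 ^ CARD('n) / V * a * b ^ (2 * (CARD('n) - 1)))"
      unfolding V_def by (rule sphere_measure_box_upper[OF \<eta>(1) ab])
    also have "b ^ (2 * (CARD('n) - 1)) = (\<rho>\<^sup>2 * L * \<delta>) ^ (CARD('n) - 1)"
      by (simp only: power_mult b2)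
    also have "4 ^ CARD('n) / V * a * (\<rho>\<^sup>2 * L * \<delta>) ^ (CARD('n) - 1)
      = C * (\<rho> * \<rho> ^ (2 * (CARD('n) - 1))) * (\<delta> * \<delta> ^ (CARD('n) - 1))"
      by (simp add: C_def a_def power_mult_distrib power_mult)
    also have "\<rho> * \<rho> ^ (2 * (CARD('n) - 1)) = \<rho> ^ (2 * CARD('n) - 1)"
      by (simp only: power_Suc[symmetric] Suc_double_card)
    also have "\<delta> * \<delta> ^ (CARD('n) - 1) = \<delta> ^ CARD('n)"
      using power_Suc[of \<delta> "CARD('n) - 1"] by (simp add: Suc_diff_1)
    finally show ?thesis unfolding \<delta>_def .
  qed
  moreover have "C \<ge> 0" using V KL by (auto simp: C_def)
  ultimately show ?thesis by blast
qed

text \<open>The counterpart for small radii. A Euclidean ball of relative radius \<rho> has angular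
  size of order \<rho> in all 2n-1 real tangential directions, so the box has a = b.\<close>

lemma sphere_measure_euclidean_ball:
  shows "\<exists>C\<ge>0. \<forall>r (w :: complex ^ 'n::finite) \<rho>. 0 \<le> r \<longrightarrow> w \<noteq> 0 \<longrightarrow> 0 < \<rho> \<longrightarrow> \<rho> \<le> 1 \<longrightarrow>
    emeasure sphere_measure {\<xi> \<in> unit_sphere. norm (r *\<^sub>R \<xi> - w) < \<rho> * norm w}
      \<le> ennreal (C * \<rho> ^ (2 * CARD('n) - 1))"
proof -
  define V where "V = measure lborel (unit_ball :: (complex ^ 'n) set)"
  have V: "V > 0" unfolding V_def by (rule content_ball_pos) simp
  define m where "m = 2 * CARD('n) - 1"
  define C where "C = (4 ^ CARD('n) / V + 1) * 2 ^ m"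
  have "emeasure sphere_measure {\<xi> \<in> unit_sphere. norm (r *\<^sub>R \<xi> - w) < \<rho> * norm w}
      \<le> ennreal (C * \<rho> ^ m)"
    if r: "0 \<le> r" and w: "w \<noteq> 0" and \<rho>: "0 < \<rho>" "\<rho> \<le> 1" for r and w :: "complex ^ 'n" and \<rho>
  proof -
    define s where "s = norm w"
    obtain \<eta> where \<eta>: "norm \<eta> = 1" "w = s *\<^sub>R \<eta>" unfolding s_def by (rule obtain_polar)
    have s: "0 < s" using w by (auto simp: s_def)
    let ?E = "{\<xi> \<in> unit_sphere. norm (r *\<^sub>R \<xi> - w) < \<rho> * norm w}"
    show ?thesis
    \<comment> \<open>If \<open>r < s / 2\<close>, every point of the sphere of radius
      \<open>r\<close> is farther than s/2 from \<open>w\<close>, so the set is empty unless \<rho>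
      > 1/2; then the factor \<open>2 ^ m\<close> in \<open>C\<close> makes the bound at least 1.
      Otherwise s \<le> 2r and the radius is at most 2 r \<rho>.\<close>
    proof (cases "r < s / 2")
      case True
      show ?thesis
      proof (cases "?E = {}")
        case False
        then obtain \<xi> where "norm \<xi> = 1" "norm (r *\<^sub>R \<xi> - w) < \<rho> * s" by (auto simp: s_def)
        moreover have "s - r * norm \<xi> \<le> norm (r *\<^sub>R \<xi> - w)"
          using norm_triangle_ineq2[of w "r *\<^sub>R \<xi>"] r by (simp add: s_def norm_minus_commute)
        ultimately have "s * (1/2) < s * \<rho>" using True by (simp add: mult.commute)
        hence "1 \<le> 2 * \<rho>" using s by (simp add: field_simps)
        hence "1 \<le> (2 * \<rho>) ^ m" by (rule one_le_power)
        also have "\<dots> = 1 * (2 ^ m * \<rho> ^ m)" by (simp add: power_mult_distrib)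
        also have "\<dots> \<le> (4 ^ CARD('n) / V + 1) * (2 ^ m * \<rho> ^ m)"
          using \<rho> V by (intro mult_right_mono) auto
        also have "\<dots> = C * \<rho> ^ m" by (simp add: C_def)
        finally have "1 \<le> ennreal (C * \<rho> ^ m)" by simp
        moreover interpret prob_space "sphere_measure :: (complex ^ 'n) measure" by (rule prob_space_sphere_measure)
        have "emeasure sphere_measure ?E \<le> 1" by (rule emeasure_le_1)
        ultimately show ?thesis by (rule order_trans[rotated])
      next
        case True
        show ?thesis unfolding True by simp
      qed
    next
      case False
      hence r2: "s \<le> 2 * r" "0 < r" using s by auto
      define a where "a = 2 * \<rho>"
      have a: "0 \<le> a" using \<rho> by (simp add: a_def)
      have "?E \<subseteq> {\<xi> \<in> unit_sphere. \<bar>Im (herm \<xi> \<eta>)\<bar> \<le> a \<and> (norm \<xi>)\<^sup>2 - (norm (herm \<xi> \<eta>))\<^sup>2 \<le> a\<^sup>2}"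
      proof
        fix \<xi> assume "\<xi> \<in> ?E"
        hence \<xi>: "norm \<xi> = 1" and "norm (r *\<^sub>R \<xi> - w) < \<rho> * s" by (auto simp: s_def)
        moreover have "\<rho> * s \<le> \<rho> * (2 * r)" using r2 \<rho> by (intro mult_left_mono) auto
        ultimately have "norm (r *\<^sub>R \<xi> - w) \<le> r * a" by (simp add: a_def mult_ac)
        hence *: "(norm (r *\<^sub>R \<xi> - w))\<^sup>2 \<le> (r * a)\<^sup>2" by (rule power_mono) simp
        define h where "h = herm \<xi> \<eta>"
        have h1: "norm h \<le> 1" using norm_herm_le[of \<xi> \<eta>] by (simp add: \<xi> \<eta> h_def)
        have hw: "Re h = \<xi> \<bullet> \<eta>" by (simp add: h_def Re_herm)
        have "(norm (r *\<^sub>R \<xi> - w))\<^sup>2 = r\<^sup>2 + s\<^sup>2 - 2 * r * s * Re h"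
          unfolding \<eta>(2) power2_norm_eq_inner using \<xi> \<eta>(1)
          by (simp add: inner_diff inner_commute hw norm_eq_1 power2_eq_square)
        \<comment> \<open>The radial, phase and transverse parts of the squared distance; the last
          two give the box conditions.\<close>
        also have "\<dots> = (r * Re h - s)\<^sup>2 + (r * Im h)\<^sup>2 + r\<^sup>2 * (1 - (norm h)\<^sup>2)"
          unfolding cmod_power2 by (simp add: power2_eq_square algebra_simps)
        finally have e: "(r * Re h - s)\<^sup>2 + (r * Im h)\<^sup>2 + r\<^sup>2 * (1 - (norm h)\<^sup>2) \<le> (r * a)\<^sup>2" using * by simp
        have p: "0 \<le> r\<^sup>2 * (1 - (norm h)\<^sup>2)" using h1 by (simp add: power_le_one)
        have "(r * Im h)\<^sup>2 \<le> (r * a)\<^sup>2" using e p zero_le_power2[of "r * Re h - s"] by linarith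
        hence "\<bar>r * Im h\<bar> \<le> \<bar>r * a\<bar>" by (simp only: abs_le_square_iff)
        hence 1: "\<bar>Im h\<bar> \<le> a" using r2 a by (simp add: abs_mult)
        have "r\<^sup>2 * (1 - (norm h)\<^sup>2) \<le> (r * a)\<^sup>2"
          using e zero_le_power2[of "r * Re h - s"] zero_le_power2[of "r * Im h"] by linarith
        hence 2: "1 - (norm h)\<^sup>2 \<le> a\<^sup>2" using r2 by (simp add: power_mult_distrib)
        show "\<xi> \<in> {\<xi> \<in> unit_sphere. \<bar>Im (herm \<xi> \<eta>)\<bar> \<le> a \<and> (norm \<xi>)\<^sup>2 - (norm (herm \<xi> \<eta>))\<^sup>2 \<le> a\<^sup>2}"
          using 1 2 \<xi> by (simp add: h_def)
      qed
      hence "emeasure sphere_measure ?E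
        \<le> emeasure sphere_measure {\<xi> \<in> unit_sphere. \<bar>Im (herm \<xi> \<eta>)\<bar> \<le> a \<and> (norm \<xi>)\<^sup>2 - (norm (herm \<xi> \<eta>))\<^sup>2 \<le> a\<^sup>2}"
        by (rule emeasure_mono) measurable
      also have "\<dots> \<le> ennreal (4 ^ CARD('n) / V * a * a ^ (2 * (CARD('n) - 1)))"
        unfolding V_def by (rule sphere_measure_box_upper[OF \<eta>(1) a a])
      also have "4 ^ CARD('n) / V * a * a ^ (2 * (CARD('n) - 1)) = 4 ^ CARD('n) / V * a ^ m"
        by (simp only: mult.assoc m_def power_Suc[symmetric] Suc_double_card)
      also have "\<dots> = 4 ^ CARD('n) / V * (2 ^ m * \<rho> ^ m)" by (simp add: a_def power_mult_distrib)
      also have "\<dots> \<le> (4 ^ CARD('n) / V + 1) * (2 ^ m * \<rho> ^ m)"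
        using \<rho> by (intro mult_right_mono) auto
      also have "\<dots> = C * \<rho> ^ m" by (simp add: C_def)
      finally show ?thesis by (simp add: ennreal_leI)
    qed
  qed
  moreover have "C \<ge> 0" using V by (auto simp: C_def)
  ultimately show ?thesis unfolding m_def by blast
qed

section \<open>Estimates of the Green profile\<close>

text \<open>In \<open>[0, \<infinity>]\<close> the quotient is \<open>\<infinity>\<close> at the origin.\<close>

definition green_model :: "complex ^ 'n::finite \<Rightarrow> ennreal" where
  "green_model z = ennreal ((1 - (norm z)\<^sup>2) ^ CARD('n)) / ennreal (norm z ^ (2 * (CARD('n) - 1)))"

lemma green_model_measurable [measurable]: "green_model \<in> borel_measurable borel"
  unfolding green_model_def[abs_def] by measurable

lemma green_model_eq:
  fixes z :: "complex ^ 'n::finite"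
  assumes "0 < norm z" "norm z \<le> 1"
  shows "green_model z = ennreal ((1 - (norm z)\<^sup>2) ^ CARD('n) * inverse (norm z) ^ (2 * (CARD('n) - 1)))"
  unfolding green_model_def using assms
  by (subst divide_ennreal) (auto simp: power_le_one divide_inverse power_inverse)

text \<open>The function \<open>F t = (1 - t\<^sup>2)\<^sup>n t\<^sup>2\<^sup>-\<^sup>2\<^sup>n\<close> satisfies
  \<open>- F' t = (2 n - 2 + 2 t\<^sup>2) (1 - t\<^sup>2)\<^sup>n\<^sup>-\<^sup>1 t\<^sup>1\<^sup>-\<^sup>2\<^sup>n\<close>, so that \<open>- F'\<close> and the integrand of the
  Green profile are comparable.\<close>

lemma green_profile_integral:
  fixes s :: real
  assumes s: "0 < s" "s \<le> 1"
  shows "(\<integral>\<^sup>+ t \<in> {s..1}. ennreal ((2 * real k + 2 * t\<^sup>2) * ((1 - t\<^sup>2) ^ k * inverse t ^ (2 * k + 1))) \<partial>lborel)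
    = ennreal ((1 - s\<^sup>2) ^ Suc k * inverse s ^ (2 * k))"
proof -
  let ?F = "\<lambda>t::real. - ((1 - t\<^sup>2) ^ Suc k * inverse t ^ (2 * k))"
  have "(\<integral>\<^sup>+ t \<in> {s..1}. ennreal ((2 * real k + 2 * t\<^sup>2) * ((1 - t\<^sup>2) ^ k * inverse t ^ (2 * k + 1))) \<partial>lborel)
    = ennreal (?F 1 - ?F s)"
  proof (rule nn_integral_FTC_Icc)
    fix t :: real assume "t \<in> {s..1}"
    hence t: "0 < t" "t \<le> 1" using s by auto
    show "0 \<le> (2 * real k + 2 * t\<^sup>2) * ((1 - t\<^sup>2) ^ k * inverse t ^ (2 * k + 1))"
      using t by (intro mult_nonneg_nonneg add_nonneg_nonneg zero_le_power) (auto simp: power_le_one)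
    have "((\<lambda>t. inverse t ^ (2 * k)) has_real_derivative - (2 * real k * inverse t ^ (2 * k + 1))) (at t)"
    proof (cases k)
      case (Suc l)
      have "((\<lambda>t. inverse t ^ (2 * k)) has_real_derivative
          of_nat (2 * k) * (- (inverse t * 1 * inverse t) * inverse t ^ (2 * k - Suc 0))) (at t)"
        using t by (intro DERIV_power DERIV_inverse') auto
      also have "of_nat (2 * k) * (- (inverse t * 1 * inverse t) * inverse t ^ (2 * k - Suc 0))
        = - (2 * real k * (inverse t * inverse t * inverse t ^ (2 * k - Suc 0)))" by simp
      also have "inverse t * inverse t * inverse t ^ (2 * k - Suc 0) = inverse t ^ (2 * k + 1)"
        by (simp add: Suc)
      finally show ?thesis .
    qed simp
    moreover have "((\<lambda>t. (1 - t\<^sup>2) ^ Suc k) has_real_derivative (1 + real k) * (- (2 * t) * (1 - t\<^sup>2) ^ k)) (at t)"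
      by (rule DERIV_power_Suc) (auto intro!: derivative_eq_intros)
    ultimately have "(?F has_real_derivative
      - ((1 + real k) * (- (2 * t) * (1 - t\<^sup>2) ^ k) * inverse t ^ (2 * k)
        + - (2 * real k * inverse t ^ (2 * k + 1)) * (1 - t\<^sup>2) ^ Suc k)) (at t)"
      by (intro DERIV_minus DERIV_mult)
    also have "inverse t ^ (2 * k) = t * inverse t ^ (2 * k + 1)" using t by simp
    also have "- ((1 + real k) * (- (2 * t) * (1 - t\<^sup>2) ^ k) * (t * inverse t ^ (2 * k + 1))
        + - (2 * real k * inverse t ^ (2 * k + 1)) * (1 - t\<^sup>2) ^ Suc k)
      = (2 * real k + 2 * t\<^sup>2) * ((1 - t\<^sup>2) ^ k * inverse t ^ (2 * k + 1))"
      by (simp add: power2_eq_square algebra_simps del: power_inverse)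
    finally show "(?F has_real_derivative (2 * real k + 2 * t\<^sup>2) * ((1 - t\<^sup>2) ^ k * inverse t ^ (2 * k + 1))) (at t)" .
  qed (use s in auto)
  thus ?thesis by simp
qed

lemma powi_green:
  assumes "0 < (t::real)"
  shows "t powi (1 - 2 * int CARD('n::finite)) = inverse t ^ (2 * (CARD('n) - 1) + 1)"
proof -
  have "1 - 2 * int CARD('n) = - int (2 * (CARD('n) - 1) + 1)"
    using zero_less_card_finite[where 'a='n] by (simp add: of_nat_diff Suc_leI)
  thus ?thesis by (simp only: power_int_minus power_int_of_nat power_inverse)
qed

text \<open>The model integrates the integrand of the profile times 2k + 2t^2 with k = n-1. On the
  range of integration this weight lies between 2k \<ge> 2 and 2n, and the prefactor (n+1)/(2n) lies
  between 1/2 and 1.\<close>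

lemma green_profile_le_model:
  fixes z :: "complex ^ 'n::finite"
  assumes n: "CARD('n) > 1" and z: "0 < norm z" "norm z \<le> 1"
  shows "green_profile z \<le> green_model z"
    and "green_model z \<le> ennreal (4 * real CARD('n)) * green_profile z"
proof -
  define k where "k = CARD('n) - 1"
  have k: "k \<ge> 1" "Suc k = CARD('n)" using n by (auto simp: k_def)
  let ?f = "\<lambda>t::real. (1 - t\<^sup>2) ^ k * inverse t ^ (2 * k + 1)"
  define I where "I = (\<integral>\<^sup>+ t \<in> {norm z..1}. ennreal (?f t) \<partial>lborel)"
  have f0: "0 \<le> ?f t" if "norm z \<le> t" "t \<le> 1" for t
  proof -
    have "0 < t" using that z by linarith
    thus ?thesis using that by (intro mult_nonneg_nonneg zero_le_power) (auto simp: power_le_one)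
  qed
  have model: "green_model z = (\<integral>\<^sup>+ t \<in> {norm z..1}. ennreal ((2 * real k + 2 * t\<^sup>2) * ?f t) \<partial>lborel)"
    unfolding green_profile_integral[OF z] k(2) green_model_eq[OF z] by (simp add: k_def)
  have prof: "green_profile z = ennreal ((real CARD('n) + 1) / (2 * real CARD('n))) * I"
    unfolding green_profile_def I_def
  proof (rule arg_cong2[of _ _ _ _ "(*)"], rule refl, rule nn_integral_cong)
    fix t
    show "ennreal ((1 - t\<^sup>2) ^ (CARD('n) - 1) * t powi (1 - 2 * int CARD('n))) * indicator {norm z..1} t
      = ennreal (?f t) * indicator {norm z..1} t"
    proof (cases "t \<in> {norm z..1}")
      case True
      hence "norm z \<le> t" by simp
      hence "0 < t" using z by linarith
      thus ?thesis by (simp only: powi_green k_def)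
    qed simp
  qed
  have "ennreal (2 * real k) * I = (\<integral>\<^sup>+ t. ennreal (2 * real k) * (ennreal (?f t) * indicator {norm z..1} t) \<partial>lborel)"
    unfolding I_def by (rule nn_integral_cmult[symmetric]) simp
  also have "\<dots> \<le> green_model z"
    unfolding model
  proof (intro nn_integral_mono)
    fix t
    show "ennreal (2 * real k) * (ennreal (?f t) * indicator {norm z..1} t)
      \<le> ennreal ((2 * real k + 2 * t\<^sup>2) * ?f t) * indicator {norm z..1} t"
      using f0[of t] by (auto simp: ennreal_mult'[symmetric] intro!: ennreal_leI mult_right_mono split: split_indicator)
  qed
  finally have 1: "ennreal (2 * real k) * I \<le> green_model z" .
  have "green_model z \<le> (\<integral>\<^sup>+ t. ennreal (2 * real CARD('n)) * (ennreal (?f t) * indicator {norm z..1} t) \<partial>lborel)"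
    unfolding model
  proof (intro nn_integral_mono)
    fix t
    have "t\<^sup>2 \<le> 1" if "norm z \<le> t" "t \<le> 1"
      using that z by (intro power_le_one) linarith+
    hence "2 * real k + 2 * t\<^sup>2 \<le> 2 * real CARD('n)" if "norm z \<le> t" "t \<le> 1"
      using that by (simp flip: k(2))
    thus "ennreal ((2 * real k + 2 * t\<^sup>2) * ?f t) * indicator {norm z..1} t
      \<le> ennreal (2 * real CARD('n)) * (ennreal (?f t) * indicator {norm z..1} t)"
      using f0[of t] by (auto simp: ennreal_mult'[symmetric] intro!: ennreal_leI mult_right_mono split: split_indicator)
  qed
  also have "\<dots> = ennreal (2 * real CARD('n)) * I"
    unfolding I_def by (rule nn_integral_cmult) simp
  finally have 2: "green_model z \<le> ennreal (2 * real CARD('n)) * I" .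
  have "green_profile z \<le> ennreal (2 * real k) * I"
    unfolding prof
  proof (intro mult_right_mono ennreal_leI)
    have "(real CARD('n) + 1) / (2 * real CARD('n)) \<le> 1" using n by simp
    also have "\<dots> \<le> 2 * real k" using k by simp
    finally show "(real CARD('n) + 1) / (2 * real CARD('n)) \<le> 2 * real k" .
  qed simp
  thus "green_profile z \<le> green_model z" using 1 by (rule order_trans)
  have "ennreal (2 * real CARD('n)) * I \<le> ennreal (4 * real CARD('n) * ((real CARD('n) + 1) / (2 * real CARD('n)))) * I"
    using n by (intro mult_right_mono ennreal_leI) (auto simp: field_simps)
  also have "\<dots> = ennreal (4 * real CARD('n)) * green_profile z"
    unfolding prof by (subst ennreal_mult) (auto simp: mult.assoc)
  finally show "green_model z \<le> ennreal (4 * real CARD('n)) * green_profile z" using 2 by (rule order_trans[rotated])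
qed

lemma green_profile_antimono:
  fixes z w :: "complex ^ 'n::finite"
  shows "norm z \<le> norm w \<Longrightarrow> green_profile w \<le> green_profile z"
  unfolding green_profile_def
  by (intro mult_left_mono nn_integral_mono) (auto split: split_indicator)

text \<open>The logarithmic lower bound at small radii, carried to the origin by monotonicity,
  exceeds every integer.\<close>

lemma green_profile_0:
  assumes n: "CARD('n::finite) > 1"
  shows "green_profile (0 :: complex ^ 'n) = \<infinity>"
proof -
  have "ennreal (real m) \<le> green_profile (0 :: complex ^ 'n)" for m
  proof -
    define c where "c = (3/4 :: real) ^ CARD('n) / 2"
    have c: "c > 0" by (simp add: c_def)
    define r where "r = exp (- real m / c) / 2"
    have r: "0 < r" "r \<le> 1/2" using c by (auto simp: r_def)
    obtain e :: "complex ^ 'n" where e: "norm e = 1"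
      using vector_choose_size[of 1] by auto
    have "c * (ln (1/2) - ln r) = real m"
      using c by (simp add: r_def ln_div field_simps)
    hence "ennreal (real m) \<le> green_profile (r *\<^sub>R e)"
      using green_profile_lower[of "r *\<^sub>R e"] r by (simp add: e c_def)
    also have "\<dots> \<le> green_profile (0 :: complex ^ 'n)" by (rule green_profile_antimono) simp
    finally show ?thesis .
  qed
  note ge = this
  show ?thesis
  proof (cases "green_profile (0 :: complex ^ 'n)")
    case (real x)
    obtain m where "x < real m" using reals_Archimedean2 by blast
    thus ?thesis using ge[of m] real by simp
  qed simp
qed

lemma green_model_0: "CARD('n::finite) > 1 \<Longrightarrow> green_model (0 :: complex ^ 'n) = \<infinity>"
  by (simp add: green_model_def power_0_left)

lemma green_le_model:
  fixes z :: "complex ^ 'n::finite"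
  assumes n: "CARD('n) > 1" and z: "norm z \<le> 1"
  shows "green_profile z \<le> green_model z"
    and "green_model z \<le> ennreal (4 * real CARD('n)) * green_profile z"
proof -
  have "green_profile z \<le> green_model z \<and> green_model z \<le> ennreal (4 * real CARD('n)) * green_profile z"
  proof (cases "z = 0")
    case True
    thus ?thesis using n by (simp add: green_profile_0[OF n] green_model_0[OF n] ennreal_mult_top)
  next
    case False
    thus ?thesis using green_profile_le_model[OF n, of z] z by auto
  qed
  thus "green_profile z \<le> green_model z" "green_model z \<le> ennreal (4 * real CARD('n)) * green_profile z"
    by auto
qed

lemma green_model_ge:
  fixes z :: "complex ^ 'n::finite"
  assumes n: "CARD('n) > 1" and z: "norm z \<le> 1"
  shows "ennreal ((1 - (norm z)\<^sup>2) ^ CARD('n)) \<le> green_model z"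
proof (cases "z = 0")
  case False
  have "(1 - (norm z)\<^sup>2) ^ CARD('n) * 1 \<le> (1 - (norm z)\<^sup>2) ^ CARD('n) * inverse (norm z) ^ (2 * (CARD('n) - 1))"
    using False z by (intro mult_left_mono one_le_power zero_le_power) (auto simp: power_le_one one_le_inverse)
  thus ?thesis using False z by (subst green_model_eq) (auto intro!: ennreal_leI)
qed (use n in \<open>simp add: green_model_0\<close>)

section \<open>Means of infinite sums\<close>

lemma epowr_ennreal: "epowr (ennreal a) p = ennreal (max 0 a powr p)"
proof (cases "0 \<le> a")
  case False
  hence "ennreal a = 0" by (simp add: ennreal_neg)
  thus ?thesis using False by (simp add: epowr_def)
qed (simp add: epowr_def max_absorb2)

lemma epowr_mono: "x \<le> y \<Longrightarrow> 0 \<le> p \<Longrightarrow> epowr x p \<le> epowr y p"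
  by (cases x; cases y) (auto simp: epowr_ennreal epowr_def powr_mono2 top_unique intro!: ennreal_leI)

lemma epowr_mult_ennreal: "0 < c \<Longrightarrow> epowr (ennreal c * x) p = ennreal (c powr p) * epowr x p"
proof (cases x)
  case (real r)
  assume "0 < c"
  thus ?thesis using real by (simp add: epowr_ennreal powr_mult flip: ennreal_mult')
qed (simp add: epowr_def ennreal_mult_top)

lemma epowr_add_le:
  assumes "0 \<le> p"
  shows "epowr (x + y) p \<le> ennreal (2 powr p) * (epowr x p + epowr y p)"
proof -
  have "x + y \<le> ennreal 2 * max x y"
    using add_mono[of x "max x y" y "max x y"] by (simp add: mult_2)
  hence "epowr (x + y) p \<le> epowr (ennreal 2 * max x y) p" using assms by (rule epowr_mono)
  also have "\<dots> = ennreal (2 powr p) * epowr (max x y) p" by (rule epowr_mult_ennreal) simp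
  also have "epowr (max x y) p \<le> epowr x p + epowr y p"
    by (cases "x \<le> y") (auto simp: max_def)
  finally show ?thesis by (simp add: mult_left_mono)
qed

lemma epowr_measurable [measurable (raw)]:
  assumes [measurable]: "f \<in> borel_measurable M"
  shows "(\<lambda>x. epowr (f x) p) \<in> borel_measurable M"
  unfolding epowr_def by measurable

lemma epowr_inverse_epowr: "p > 0 \<Longrightarrow> epowr (epowr x (1 / p)) p = x"
  by (cases x) (auto simp: epowr_def powr_powr)

lemma epowr_root_le_iff:
  assumes "p > 0" "0 \<le> C"
  shows "epowr x (1 / p) \<le> ennreal C \<longleftrightarrow> x \<le> ennreal (C powr p)"
proof
  assume "epowr x (1 / p) \<le> ennreal C"
  hence "epowr (epowr x (1 / p)) p \<le> epowr (ennreal C) p" using assms by (intro epowr_mono) auto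
  thus "x \<le> ennreal (C powr p)" using assms by (simp add: epowr_inverse_epowr epowr_ennreal max_absorb2)
next
  assume "x \<le> ennreal (C powr p)"
  hence "epowr x (1 / p) \<le> epowr (epowr (ennreal C) p) (1 / p)"
    using assms by (intro epowr_mono) (auto simp: epowr_ennreal max_absorb2)
  thus "epowr x (1 / p) \<le> ennreal C" using assms by (simp add: epowr_epowr_inverse)
qed

text \<open>Young's inequality with a free scale \<open>a\<close>, chosen so that equality holds at
  y = a. It linearises the p-th power, and the scale is optimised afterwards.\<close>

lemma young_scaled:
  fixes y a p :: real
  assumes p: "p > 1" and a: "a > 0" and y: "y \<ge> 0"
  shows "y \<le> a powr (1 - p) * y powr p / p + (1 - 1 / p) * a"
proof (cases "y = 0")
  case False
  hence y: "y > 0" using y by simp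
  have "(a powr (1 - p) * y powr p) powr (1 / p) * a powr (1 - 1 / p)
    \<le> (1 / p) * (a powr (1 - p) * y powr p) + (1 - 1 / p) * a"
    using p a y by (intro Youngs_inequality_0) auto
  also have "(a powr (1 - p) * y powr p) powr (1 / p) * a powr (1 - 1 / p) = y * (a powr ((1 - p) * (1 / p)) * a powr (1 - 1 / p))"
    using p a y by (simp add: powr_mult powr_powr)
  also have "a powr ((1 - p) * (1 / p)) * a powr (1 - 1 / p) = 1"
    using p a by (simp add: powr_add[symmetric] field_simps)
  finally show ?thesis by simp
qed (use p a in auto)

lemma weighted_power_mean_suminf:
  fixes f :: "nat \<Rightarrow> ennreal" and c m :: "nat \<Rightarrow> real"
  assumes p: "p > 1" and c: "\<And>j. c j > 0" and m: "\<And>j. m j > 0"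
    and sm: "summable (\<lambda>j. c j * m j)"
  defines "H \<equiv> (\<Sum>j. c j * m j)"
  shows "epowr (\<Sum>j. ennreal (c j) * f j) p
    \<le> ennreal (H powr (p - 1)) * (\<Sum>j. ennreal (c j * m j powr (1 - p)) * epowr (f j) p)"
    (is "epowr ?S p \<le> _ * ?Y")
proof -
  have H: "H > 0" unfolding H_def using c m by (intro suminf_pos sm) simp
  \<comment> \<open>Young's inequality with scale a m_j in the j-th term, summed over j;
    \<open>a\<close> stays free.\<close>
  have key: "?S \<le> ennreal (a powr (1 - p) / p) * ?Y + ennreal ((1 - 1 / p) * a * H)" if a: "a > 0" for a
  proof -
    have gen: "ennreal (u * (v * w)) = ennreal u * (ennreal v * ennreal w)" if "0 \<le> u" "0 \<le> v" "0 \<le> w" for u v w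
      using that by (simp add: ennreal_mult)
    have "ennreal (c j) * f j \<le> ennreal (a powr (1 - p) / p) * (ennreal (c j * m j powr (1 - p)) * epowr (f j) p)
        + ennreal ((1 - 1 / p) * a) * ennreal (c j * m j)" for j
    proof (cases "f j")
      case (real y)
      have "c j * y \<le> c j * ((a * m j) powr (1 - p) * y powr p / p + (1 - 1 / p) * (a * m j))"
        using c[of j] m[of j] a p real by (intro mult_left_mono young_scaled) auto
      also have "\<dots> = a powr (1 - p) / p * (c j * m j powr (1 - p) * y powr p) + (1 - 1 / p) * a * (c j * m j)"
        using a m[of j] by (simp add: powr_mult algebra_simps)
      finally have "ennreal (c j * y) \<le> ennreal (a powr (1 - p) / p * (c j * m j powr (1 - p) * y powr p) + (1 - 1 / p) * a * (c j * m j))"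
        by (rule ennreal_leI)
      also have "\<dots> = ennreal (a powr (1 - p) / p * (c j * m j powr (1 - p) * y powr p)) + ennreal ((1 - 1 / p) * a * (c j * m j))"
        using c[of j] m[of j] a p real by (intro ennreal_plus) auto
      also have "ennreal (a powr (1 - p) / p * (c j * m j powr (1 - p) * y powr p))
          = ennreal (a powr (1 - p) / p) * (ennreal (c j * m j powr (1 - p)) * ennreal (y powr p))"
        by (rule gen) (use c[of j] m[of j] a p real in auto)
      also have "ennreal ((1 - 1 / p) * a * (c j * m j)) = ennreal ((1 - 1 / p) * a) * ennreal (c j * m j)"
        using c[of j] m[of j] a p by (intro ennreal_mult) auto
      finally show ?thesis
        using real c[of j] by (simp add: epowr_ennreal max_absorb2 ennreal_mult')
    next
      case top
      thus ?thesis using c[of j] m[of j] a p by (simp add: epowr_def ennreal_mult_top)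
    qed
    hence "?S \<le> (\<Sum>j. ennreal (a powr (1 - p) / p) * (ennreal (c j * m j powr (1 - p)) * epowr (f j) p)
        + ennreal ((1 - 1 / p) * a) * ennreal (c j * m j))"
      by (intro suminf_le) auto
    also have "\<dots> = ennreal (a powr (1 - p) / p) * ?Y + ennreal ((1 - 1 / p) * a) * (\<Sum>j. ennreal (c j * m j))"
      by (subst suminf_add[symmetric]) (simp_all add: ennreal_suminf_cmult)
    also have "(\<Sum>j. ennreal (c j * m j)) = ennreal H"
      unfolding H_def using c m by (intro suminf_ennreal2 sm) (simp add: less_imp_le)
    also have "ennreal ((1 - 1 / p) * a) * ennreal H = ennreal ((1 - 1 / p) * a * H)"
      using p a H by (intro ennreal_mult[symmetric]) auto
    finally show ?thesis .
  qed
  show ?thesis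
  proof (cases ?Y)
    case top
    thus ?thesis using H by (simp add: ennreal_mult_top)
  next
    case (real y)
    show ?thesis
    proof (cases "y = 0")
      case True
      hence Y0: "?Y = 0" using real by simp
      \<comment> \<open>Only the term linear in \<open>a\<close> survives, so letting
        \<open>a\<close> tend to 0 forces the sum to vanish; this \<open>a\<close> makes the term
        equal to \<open>e\<close>.\<close>
      have "?S \<le> ennreal (0 + e)" if "e > 0" for e
      proof -
        define q where "q = 1 - 1 / p"
        have q: "q > 0" using p by (simp add: q_def)
        define a where "a = e / (q * H)"
        have "a > 0" using that q H by (simp add: a_def)
        moreover have "q * a * H = e" using q H by (simp add: a_def)
        ultimately show ?thesis using key[of a] unfolding Y0 q_def[symmetric] by simp
      qed
      note le = this
      have "?S \<le> 0"
      proof (rule ennreal_le_epsilon)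
        fix e :: real assume "0 < e"
        thus "?S \<le> 0 + ennreal e" using le[of e] by simp
      qed
      hence "?S = 0" by simp
      thus ?thesis by (simp add: epowr_def)
    next
      case False
      hence y: "y > 0" using real by simp
      \<comment> \<open>The minimiser of the bound in \<open>key\<close>; it makes the right-hand
        side equal to a H.\<close>
      define a where "a = (y / H) powr (1 / p)"
      have a: "a > 0" using y H by (simp add: a_def)
      have ap: "a powr p = y / H" using p y H by (simp add: a_def powr_powr)
      have "a powr (1 - p) * y = a * H"
        using a H y by (simp add: powr_diff ap)
      hence "a powr (1 - p) / p * y + (1 - 1 / p) * a * H = a * H"
        using p by (simp add: field_simps)
      hence "?S \<le> ennreal (a * H)"
        using key[OF a] real y a p H by (simp add: ennreal_mult[symmetric] ennreal_plus[symmetric] del: ennreal_plus)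
      hence "epowr ?S p \<le> epowr (ennreal (a * H)) p" using p by (intro epowr_mono) auto
      also have "\<dots> = ennreal ((a * H) powr p)" using a H by (simp add: epowr_ennreal max_absorb2)
      also have "(a * H) powr p = H powr (p - 1) * y"
        using a H by (simp add: powr_mult ap powr_diff)
      finally show ?thesis using real by (simp add: ennreal_mult)
    qed
  qed
qed

text \<open>Integrate the pointwise inequality with m_j taken as the bound for the L^p norm of f_j.
  The j-th term then contributes at most c_j m_j, and H^(p-1) times H is H^p.\<close>

lemma minkowski_suminf:
  fixes f :: "nat \<Rightarrow> 'a \<Rightarrow> ennreal" and c m :: "nat \<Rightarrow> real"
  assumes p: "p > 1" and c: "\<And>j. c j > 0" and m: "\<And>j. m j > 0"
    and sm: "summable (\<lambda>j. c j * m j)"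
    and f[measurable]: "\<And>j. f j \<in> borel_measurable M"
    and le: "\<And>j. (\<integral>\<^sup>+ x. epowr (f j x) p \<partial>M) \<le> ennreal (m j powr p)"
  shows "(\<integral>\<^sup>+ x. epowr (\<Sum>j. ennreal (c j) * f j x) p \<partial>M) \<le> ennreal ((\<Sum>j. c j * m j) powr p)"
proof -
  define H where "H = (\<Sum>j. c j * m j)"
  have H: "H > 0" unfolding H_def using c m by (intro suminf_pos sm) simp
  have "(\<integral>\<^sup>+ x. epowr (\<Sum>j. ennreal (c j) * f j x) p \<partial>M)
    \<le> (\<integral>\<^sup>+ x. ennreal (H powr (p - 1)) * (\<Sum>j. ennreal (c j * m j powr (1 - p)) * epowr (f j x) p) \<partial>M)"
    unfolding H_def by (intro nn_integral_mono weighted_power_mean_suminf p c m sm)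
  also have "\<dots> = ennreal (H powr (p - 1)) * (\<Sum>j. ennreal (c j * m j powr (1 - p)) * (\<integral>\<^sup>+ x. epowr (f j x) p \<partial>M))"
    by (simp add: nn_integral_cmult nn_integral_suminf)
  also have "\<dots> \<le> ennreal (H powr (p - 1)) * (\<Sum>j. ennreal (c j * m j))"
  proof (intro mult_left_mono suminf_le allI)
    fix j
    have "ennreal (c j * m j powr (1 - p)) * (\<integral>\<^sup>+ x. epowr (f j x) p \<partial>M)
      \<le> ennreal (c j * m j powr (1 - p)) * ennreal (m j powr p)"
      by (intro mult_left_mono le) simp
    also have "\<dots> = ennreal (c j * (m j powr (1 - p) * m j powr p))"
      using c[of j] by (simp add: ennreal_mult[symmetric] mult.assoc)
    also have "m j powr (1 - p) * m j powr p = m j"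
      using m[of j] by (simp add: powr_add[symmetric])
    finally show "ennreal (c j * m j powr (1 - p)) * (\<integral>\<^sup>+ x. epowr (f j x) p \<partial>M) \<le> ennreal (c j * m j)" .
  qed auto
  also have "(\<Sum>j. ennreal (c j * m j)) = ennreal H"
    unfolding H_def using c m by (intro suminf_ennreal2 sm) (simp add: less_imp_le)
  also have "ennreal (H powr (p - 1)) * ennreal H = ennreal (H powr p)"
    using H by (simp add: ennreal_mult[symmetric] powr_diff)
  finally show ?thesis unfolding H_def .
qed

section \<open>Measures on the ball\<close>

lemma carleson_region_eq: "carleson_region \<xi> \<delta> = {z \<in> unit_ball. norm (1 - herm z \<xi>) < \<delta>}"
  by (auto simp: carleson_region_def ndist_def)

lemma epowr_mult_self:
  assumes "1 < p"
  shows "epowr x p = x * epowr x (p - 1)"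
proof (cases x)
  case (real r)
  have "r powr p = r * r powr (p - 1)"
    using assms real by (cases "r = 0") (auto simp: powr_diff)
  thus ?thesis using real by (simp add: epowr_ennreal max_absorb2 ennreal_mult)
qed (simp add: epowr_def)

text \<open>This makes it possible to replace \<open>\<xi>\<close> by an average over the \<open>\<xi>'\<close> whose Carleson region
  contains \<open>w\<close>.\<close>

lemma pseudo_ball_subset_carleson:
  fixes \<xi> \<xi>' w :: "complex ^ 'n::finite"
  assumes \<xi>: "norm \<xi> = 1" "norm \<xi>' = 1" and r: "0 \<le> r" "r < 1" and w: "norm w < 1"
    and pd: "pseudo_dist2 (r *\<^sub>R \<xi>) w < 1/4" and w': "norm (1 - herm w \<xi>') < 7 * (1 - r)"
  shows "{v \<in> unit_ball. pseudo_dist2 (r *\<^sub>R \<xi>) v < 1/4} \<subseteq> carleson_region \<xi>' (200 * (1 - r))"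
proof
  have nr: "norm (r *\<^sub>R \<xi>) = r" using \<xi> r by simp
  \<comment> \<open>The constant 7 exceeds 16/3 + 1: the first summand from
    \<open>pseudo_dist2_near\<close>, the second from replacing \<open>r *\<^sub>R \<xi>\<close> by
    \<xi>.\<close>
  have near: "norm (1 - herm v \<xi>) < 7 * (1 - r)"
    if "norm v < 1" "pseudo_dist2 (r *\<^sub>R \<xi>) v < 1/4" for v
    using pseudo_dist2_near(1)[of "r *\<^sub>R \<xi>" v] one_minus_herm_radial(1)[of \<xi> r v] that \<xi> r nr by auto
  fix v assume "v \<in> {v \<in> unit_ball. pseudo_dist2 (r *\<^sub>R \<xi>) v < 1/4}"
  hence v: "norm v < 1" "pseudo_dist2 (r *\<^sub>R \<xi>) v < 1/4" by auto
  have "norm (1 - herm \<xi> \<xi>') \<le> 2 * norm (1 - herm \<xi> w) + 4 * norm (1 - herm w \<xi>')"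
    using \<xi> w by (intro one_minus_herm_quasi_triangle) auto
  moreover have "norm (1 - herm v \<xi>') \<le> 2 * norm (1 - herm v \<xi>) + 4 * norm (1 - herm \<xi> \<xi>')"
    using \<xi> v by (intro one_minus_herm_quasi_triangle) auto
  \<comment> \<open>The two quasi-triangle steps give 2*7 + 4*7 = 42 and then 2*7 + 4*42 = 182,
    which is below 200.\<close>
  moreover have "d < 200 * t"
    if "a \<le> 2 * b + 4 * c" "d \<le> 2 * e + 4 * a" "e < 7 * t" "b < 7 * t" "c < 7 * t" "0 < t" for a b c d e t :: real
    using that by linarith
  ultimately have "norm (1 - herm v \<xi>') < 200 * (1 - r)"
    using near[OF v] near[OF w pd] w' norm_one_minus_herm_commute[of w \<xi>] r by simp
  thus "v \<in> carleson_region \<xi>' (200 * (1 - r))" using v by (simp add: carleson_region_eq)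
qed

text \<open>Used for two measures: \<lambda>, and near the origin the measure with density
  \<open>green_model\<close>. Finiteness makes Fubini's theorem against the sphere measure
  available.\<close>

locale finite_ball_measure = finite_measure N for N :: "(complex ^ 'n::finite) measure" +
  assumes sets_N: "sets N = sets (restrict_space borel unit_ball)"
begin

lemma space_N: "space N = unit_ball"
  using sets_eq_imp_space_eq[OF sets_N] by (simp add: space_restrict_space)

lemma id_measurable [measurable]: "(\<lambda>w. w) \<in> N \<rightarrow>\<^sub>M borel"
  by (subst measurable_cong_sets[OF sets_N refl]) (rule measurable_restrict_space1, simp)

sublocale sphere: prob_space "sphere_measure :: (complex ^ 'n) measure"
  by (rule prob_space_sphere_measure)

sublocale pair_sigma_finite "sphere_measure :: (complex ^ 'n) measure" N ..

text \<open>Measurability is checked on the full product of Borel spaces and then restricted,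
  because both factors carry trace \<sigma>-algebras.\<close>

lemma measurable_pairI:
  fixes F :: "complex ^ 'n \<Rightarrow> complex ^ 'n \<Rightarrow> 'c"
  assumes "case_prod F \<in> borel \<Otimes>\<^sub>M borel \<rightarrow>\<^sub>M K"
  shows "case_prod F \<in> sphere_measure \<Otimes>\<^sub>M N \<rightarrow>\<^sub>M K"
proof -
  have "(\<lambda>x. (fst x, snd x)) \<in> sphere_measure \<Otimes>\<^sub>M N \<rightarrow>\<^sub>M (borel :: (complex ^ 'n) measure) \<Otimes>\<^sub>M (borel :: (complex ^ 'n) measure)"
    by (intro measurable_Pair measurable_compose[OF measurable_fst id_measurable_sphere]
          measurable_compose[OF measurable_snd id_measurable])
  from measurable_compose[OF this assms] show ?thesis by simp
qed

lemma pred_sectionI: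
  fixes P :: "complex ^ 'n \<Rightarrow> complex ^ 'n \<Rightarrow> bool"
  assumes "Measurable.pred (borel \<Otimes>\<^sub>M borel) (case_prod P)"
  shows "{x \<in> space (sphere_measure \<Otimes>\<^sub>M N). case_prod P x} \<in> sets (sphere_measure \<Otimes>\<^sub>M N)"
  using measurable_pairI[OF assms] by (simp add: pred_def)

lemma section_in_sets:
  fixes P :: "complex ^ 'n \<Rightarrow> complex ^ 'n \<Rightarrow> bool"
  assumes "Measurable.pred (borel \<Otimes>\<^sub>M borel) (case_prod P)"
  shows "{w \<in> unit_ball. P \<xi> w} \<in> sets N"
proof -
  have "Measurable.pred borel (\<lambda>w. P \<xi> w)"
    using measurable_compose[OF measurable_Pair1'[of \<xi> borel borel] assms] by simp
  hence "Measurable.pred N (\<lambda>w. P \<xi> w)" by (rule measurable_compose[OF id_measurable])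
  thus ?thesis by (simp add: pred_def space_N)
qed

lemma emeasure_section_measurable:
  fixes P :: "complex ^ 'n \<Rightarrow> complex ^ 'n \<Rightarrow> bool"
  assumes "Measurable.pred (borel \<Otimes>\<^sub>M borel) (case_prod P)"
  shows "(\<lambda>\<xi>. emeasure N {w \<in> unit_ball. P \<xi> w}) \<in> borel_measurable sphere_measure"
proof (rule sigma_finite_measure.measurable_emeasure[of N])
  show "sigma_finite_measure N" by unfold_locales
  show "{x \<in> space (sphere_measure \<Otimes>\<^sub>M N). snd x \<in> {w \<in> unit_ball. P (fst x) w}} \<in> sets (sphere_measure \<Otimes>\<^sub>M N)"
    using pred_sectionI[OF assms]
    by (rule back_subst[of "\<lambda>A. A \<in> _"]) (auto simp: space_pair_measure space_N)
qed (auto simp: space_N)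

text \<open>Exchanges the mass of {w. P \<xi> w} for the sphere measure of {\<xi>. P \<xi> w}, which
  geometry controls; the weight \<open>h\<close> carries the remaining p-1 powers.\<close>

lemma fubini_section:
  fixes P :: "complex ^ 'n \<Rightarrow> complex ^ 'n \<Rightarrow> bool"
  assumes P: "Measurable.pred (borel \<Otimes>\<^sub>M borel) (case_prod P)"
    and h: "h \<in> borel_measurable sphere_measure"
  shows "(\<integral>\<^sup>+ \<xi>. h \<xi> * emeasure N {w \<in> unit_ball. P \<xi> w} \<partial>sphere_measure)
    = (\<integral>\<^sup>+ w. \<integral>\<^sup>+ \<xi>. h \<xi> * indicator {\<xi>. P \<xi> w} \<xi> \<partial>sphere_measure \<partial>N)"
proof -
  have "(\<integral>\<^sup>+ \<xi>. h \<xi> * emeasure N {w \<in> unit_ball. P \<xi> w} \<partial>sphere_measure)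
      = (\<integral>\<^sup>+ \<xi>. \<integral>\<^sup>+ w. h \<xi> * indicator {w \<in> unit_ball. P \<xi> w} w \<partial>N \<partial>sphere_measure)"
    using section_in_sets[OF P] by (intro nn_integral_cong) (simp add: nn_integral_cmult_indicator)
  also have "\<dots> = (\<integral>\<^sup>+ \<xi>. \<integral>\<^sup>+ w. h \<xi> * indicator {x. case_prod P x} (\<xi>, w) \<partial>N \<partial>sphere_measure)"
    by (intro nn_integral_cong) (auto simp: space_N split: split_indicator)
  also have "\<dots> = (\<integral>\<^sup>+ w. \<integral>\<^sup>+ \<xi>. h \<xi> * indicator {x. case_prod P x} (\<xi>, w) \<partial>sphere_measure \<partial>N)"
  proof (rule Fubini'[symmetric])
    have "(\<lambda>x. indicator {x. case_prod P x} x :: ennreal) \<in> borel_measurable (sphere_measure \<Otimes>\<^sub>M N)"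
      using measurable_pairI[OF P] by measurable
    thus "(\<lambda>(\<xi>, w). h \<xi> * indicator {x. case_prod P x} (\<xi>, w)) \<in> borel_measurable (sphere_measure \<Otimes>\<^sub>M N)"
      unfolding case_prod_beta' prod.collapse
      by (intro borel_measurable_times_ennreal measurable_compose[OF measurable_fst h])
  qed
  also have "\<dots> = (\<integral>\<^sup>+ w. \<integral>\<^sup>+ \<xi>. h \<xi> * indicator {\<xi>. P \<xi> w} \<xi> \<partial>sphere_measure \<partial>N)"
    by (intro nn_integral_cong) (auto split: split_indicator)
  finally show ?thesis .
qed

lemma carleson_pred: "Measurable.pred (borel \<Otimes>\<^sub>M borel) (\<lambda>(\<xi>, w). norm (1 - herm w (\<xi> :: complex ^ 'n)) < \<delta>)"
  by measurable

lemma pseudo_pred: "Measurable.pred (borel \<Otimes>\<^sub>M borel) (\<lambda>(\<xi>, w :: complex ^ 'n). pseudo_dist2 (r *\<^sub>R \<xi>) w < t)"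
  by measurable

lemma carleson_in_sets: "carleson_region \<xi> \<delta> \<in> sets N"
  unfolding carleson_region_eq using carleson_pred by (intro section_in_sets) simp

lemma emeasure_carleson_measurable [measurable]:
  "(\<lambda>\<xi>. emeasure N (carleson_region \<xi> \<delta>)) \<in> borel_measurable sphere_measure"
  unfolding carleson_region_eq using carleson_pred by (intro emeasure_section_measurable) simp

text \<open>One factor of T^p is spent on Fubini and gains the sphere measure O(\<rho>^(2n-1)
  \<delta>^n) of the dual section. The factor T^(p-1) is dominated by an average of L^(p-1) over a
  cap of measure at least c \<delta>^n, and a second use of Fubini reassembles the integral of L^p.
  The powers of \<delta> cancel.\<close>

lemma near_estimate:
  assumes p: "1 < p" and r0: "0 < r0"
  shows "\<exists>C\<ge>0. \<forall>r \<rho>. r0 \<le> r \<longrightarrow> r < 1 \<longrightarrow> 0 < \<rho> \<longrightarrow> \<rho> \<le> 1/2 \<longrightarrow>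
    (\<integral>\<^sup>+ \<xi>. epowr (emeasure N {w \<in> unit_ball. pseudo_dist2 (r *\<^sub>R \<xi>) w < \<rho>\<^sup>2}) p \<partial>sphere_measure)
    \<le> ennreal (C * \<rho> ^ (2 * CARD('n) - 1)) *
       (\<integral>\<^sup>+ \<xi>. epowr (emeasure N (carleson_region \<xi> (200 * (1 - r)))) p \<partial>sphere_measure)"
proof -
  obtain c where c: "c > 0"
    and lower: "\<And>(\<eta> :: complex ^ 'n) \<delta>. norm \<eta> = 1 \<Longrightarrow> 0 < \<delta> \<Longrightarrow> \<delta> \<le> 1 \<Longrightarrow>
      ennreal (c * \<delta> ^ CARD('n)) \<le> emeasure sphere_measure {\<xi> \<in> unit_sphere. norm (1 - herm \<xi> \<eta>) < \<delta>}"
    using sphere_measure_cap_lower[where 'n='n] by auto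
  obtain C where C: "C \<ge> 0"
    and upper: "\<And>r (w :: complex ^ 'n) \<rho>. r0 \<le> r \<Longrightarrow> r < 1 \<Longrightarrow> norm w < 1 \<Longrightarrow> 0 < \<rho> \<Longrightarrow> \<rho> \<le> 1/2 \<Longrightarrow>
    emeasure sphere_measure {\<xi> \<in> unit_sphere. pseudo_dist2 (r *\<^sub>R \<xi>) w < \<rho>\<^sup>2}
      \<le> ennreal (C * \<rho> ^ (2 * CARD('n) - 1) * (1 - r) ^ CARD('n))"
    using sphere_measure_pseudo_ball[OF r0, where 'n='n] by blast
  have "(\<integral>\<^sup>+ \<xi>. epowr (emeasure N {w \<in> unit_ball. pseudo_dist2 (r *\<^sub>R \<xi>) w < \<rho>\<^sup>2}) p \<partial>sphere_measure)
    \<le> ennreal (C / c * \<rho> ^ (2 * CARD('n) - 1)) *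
       (\<integral>\<^sup>+ \<xi>. epowr (emeasure N (carleson_region \<xi> (200 * (1 - r)))) p \<partial>sphere_measure)"
    if r: "r0 \<le> r" "r < 1" and \<rho>: "0 < \<rho>" "\<rho> \<le> 1/2" for r \<rho>
  proof -
    define \<delta> where "\<delta> = 1 - r"
    have r1: "0 \<le> r" using r r0 by simp
    have \<delta>: "0 < \<delta>" "\<delta> \<le> 1" using r r1 by (auto simp: \<delta>_def)
    have "\<rho>\<^sup>2 \<le> (1/2)\<^sup>2" using \<rho> by (intro power_mono) auto
    hence \<rho>2: "\<rho>\<^sup>2 \<le> 1/4" by (simp add: power2_eq_square)
    define P where "P \<xi> w \<longleftrightarrow> pseudo_dist2 (r *\<^sub>R \<xi>) w < \<rho>\<^sup>2" for \<xi> w :: "complex ^ 'n"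
    define T where "T \<xi> = emeasure N {w \<in> unit_ball. P \<xi> w}" for \<xi>
    define L where "L \<xi> = emeasure N (carleson_region \<xi> (200 * \<delta>))" for \<xi>
    \<comment> \<open>An unnormalised average of L^(p-1) over the boundary points whose region of
      size 7\<delta> contains \<open>w\<close>. It depends on \<open>w\<close> only, so it can be
      taken out of the inner integral over \<xi>.\<close>
    define Z where "Z w = (\<integral>\<^sup>+ \<xi>. epowr (L \<xi>) (p - 1) * indicator {\<xi>. norm (1 - herm w \<xi>) < 7 * \<delta>} \<xi> \<partial>sphere_measure)" for w
    have P: "Measurable.pred (borel \<Otimes>\<^sub>M borel) (case_prod P)"
      unfolding P_def by (rule pseudo_pred)
    have Tm[measurable]: "T \<in> borel_measurable sphere_measure"
      unfolding T_def by (rule emeasure_section_measurable[OF P])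
    have Lm[measurable]: "L \<in> borel_measurable sphere_measure" unfolding L_def by measurable
    have LLm: "(\<lambda>\<xi>. epowr (L \<xi>) (p - 1)) \<in> borel_measurable sphere_measure" by measurable
    have ineq: "ennreal (c * \<delta> ^ CARD('n)) * epowr (T \<xi>) (p - 1) \<le> Z w"
      if \<xi>: "\<xi> \<in> unit_sphere" and w: "w \<in> unit_ball" and "P \<xi> w" for \<xi> w
    proof -
      have pd: "pseudo_dist2 (r *\<^sub>R \<xi>) w < 1/4" using that \<rho>2 by (simp add: P_def)
      define s where "s = norm w"
      obtain \<eta> where \<eta>: "norm \<eta> = 1" "w = s *\<^sub>R \<eta>" unfolding s_def by (rule obtain_polar)
      have s: "0 \<le> s" "s < 1" using w by (auto simp: s_def)
      have s1: "1 - s \<le> 16/3 * \<delta>"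
        using pseudo_dist2_near(3)[OF _ _ pd] \<xi> w r r1 by (simp add: \<delta>_def s_def)
      \<comment> \<open>The whole cap of size \<delta> around the direction \<eta> of
        \<open>w\<close> enters the average, since 1 - |w| \<le> (16/3) \<delta> and 16/3 + 1 <
        7.\<close>
      have sees: "norm (1 - herm w \<xi>') < 7 * \<delta>" if "norm \<xi>' = 1" "norm (1 - herm \<xi>' \<eta>) < \<delta>" for \<xi>'
      proof -
        have "1 - herm w \<xi>' = (1 - herm \<eta> \<xi>') + of_real (1 - s) * herm \<eta> \<xi>'"
          by (simp add: \<eta>(2) herm_scaleR_left algebra_simps)
        hence "norm (1 - herm w \<xi>') \<le> norm (1 - herm \<eta> \<xi>') + norm (of_real (1 - s) * herm \<eta> \<xi>')"
          by (simp only: norm_triangle_ineq)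
        also have "norm (of_real (1 - s) * herm \<eta> \<xi>') = (1 - s) * norm (herm \<eta> \<xi>')"
          using s by (simp add: norm_mult del: of_real_diff)
        also have "\<dots> \<le> (1 - s) * 1"
          using s norm_herm_le[of \<eta> \<xi>'] that \<eta>(1) by (intro mult_left_mono) auto
        finally show ?thesis using that s1 \<delta> by (simp add: norm_one_minus_herm_commute[of \<eta>])
      qed
      have TL: "T \<xi> \<le> L \<xi>'" if "norm \<xi>' = 1" "norm (1 - herm w \<xi>') < 7 * \<delta>" for \<xi>'
      proof -
        have "{v \<in> unit_ball. P \<xi> v} \<subseteq> {v \<in> unit_ball. pseudo_dist2 (r *\<^sub>R \<xi>) v < 1/4}"
          using \<rho>2 by (auto simp: P_def)
        also have "\<dots> \<subseteq> carleson_region \<xi>' (200 * \<delta>)"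
          unfolding \<delta>_def using \<xi> w r r1 pd that by (intro pseudo_ball_subset_carleson[of _ _ _ w]) (auto simp: \<delta>_def)
        finally show ?thesis unfolding T_def L_def by (rule emeasure_mono[OF _ carleson_in_sets])
      qed
      have "ennreal (c * \<delta> ^ CARD('n)) * epowr (T \<xi>) (p - 1)
          \<le> emeasure sphere_measure {\<xi>' \<in> unit_sphere. norm (1 - herm \<xi>' \<eta>) < \<delta>} * epowr (T \<xi>) (p - 1)"
        by (intro mult_right_mono lower \<eta> \<delta>) simp
      also have "\<dots> = (\<integral>\<^sup>+ \<xi>'. epowr (T \<xi>) (p - 1) * indicator {\<xi>' \<in> unit_sphere. norm (1 - herm \<xi>' \<eta>) < \<delta>} \<xi>' \<partial>sphere_measure)"
        by (subst nn_integral_cmult_indicator) (measurable, simp add: mult.commute)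
      also have "\<dots> \<le> Z w"
        unfolding Z_def using sees TL p
        by (intro nn_integral_mono) (auto intro!: epowr_mono split: split_indicator)
      finally show ?thesis .
    qed
    have Zm: "Z \<in> borel_measurable N"
    proof -
      have "(\<lambda>(w, \<xi>). epowr (L \<xi>) (p - 1) * indicator {\<xi>. norm (1 - herm w \<xi>) < 7 * \<delta>} \<xi>) \<in> borel_measurable (N \<Otimes>\<^sub>M sphere_measure)"
      proof -
        have "Measurable.pred (N \<Otimes>\<^sub>M sphere_measure) (\<lambda>x. norm (1 - herm (fst x) (snd x)) < 7 * \<delta>)"
          using measurable_compose[OF measurable_fst id_measurable] measurable_compose[OF measurable_snd id_measurable_sphere]
          by measurable
        hence "(\<lambda>x. indicator {x. norm (1 - herm (fst x) (snd x)) < 7 * \<delta>} x :: ennreal) \<in> borel_measurable (N \<Otimes>\<^sub>M sphere_measure)"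
          by measurable
        moreover have "(\<lambda>x. indicator {x. norm (1 - herm (fst x) (snd x)) < 7 * \<delta>} x :: ennreal)
          = (\<lambda>x. indicator {\<xi>. norm (1 - herm (fst x) \<xi>) < 7 * \<delta>} (snd x))"
          by (auto split: split_indicator)
        ultimately show ?thesis
          unfolding case_prod_beta' using measurable_compose[OF measurable_snd LLm]
          by (intro borel_measurable_times_ennreal) auto
      qed
      thus ?thesis unfolding Z_def by (rule sphere.borel_measurable_nn_integral)
    qed
    have "ennreal (c * \<delta> ^ CARD('n)) * (\<integral>\<^sup>+ \<xi>. epowr (T \<xi>) p \<partial>sphere_measure)
        = (\<integral>\<^sup>+ \<xi>. (ennreal (c * \<delta> ^ CARD('n)) * epowr (T \<xi>) (p - 1)) * T \<xi> \<partial>sphere_measure)"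
      by (subst nn_integral_cmult[symmetric]) (auto simp: epowr_mult_self[OF p] mult_ac)
    also have "\<dots> = (\<integral>\<^sup>+ w. \<integral>\<^sup>+ \<xi>. (ennreal (c * \<delta> ^ CARD('n)) * epowr (T \<xi>) (p - 1)) * indicator {\<xi>. P \<xi> w} \<xi> \<partial>sphere_measure \<partial>N)"
      by (rule fubini_section[OF P, folded T_def]) measurable
    also have "\<dots> \<le> (\<integral>\<^sup>+ w. \<integral>\<^sup>+ \<xi>. Z w * indicator {\<xi> \<in> unit_sphere. P \<xi> w} \<xi> \<partial>sphere_measure \<partial>N)"
      by (intro nn_integral_mono) (auto simp: space_N space_sphere_measure split: split_indicator intro!: ineq)
    also have "\<dots> = (\<integral>\<^sup>+ w. Z w * emeasure sphere_measure {\<xi> \<in> unit_sphere. P \<xi> w} \<partial>N)"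
      by (intro nn_integral_cong nn_integral_cmult_indicator) (unfold P_def, measurable)
    also have "\<dots> \<le> (\<integral>\<^sup>+ w. Z w * ennreal (C * \<rho> ^ (2 * CARD('n) - 1) * \<delta> ^ CARD('n)) \<partial>N)"
      unfolding P_def \<delta>_def using r \<rho> by (intro nn_integral_mono mult_left_mono upper) (auto simp: space_N)
    also have "\<dots> = (\<integral>\<^sup>+ w. Z w \<partial>N) * ennreal (C * \<rho> ^ (2 * CARD('n) - 1) * \<delta> ^ CARD('n))"
      by (rule nn_integral_multc[OF Zm])
    \<comment> \<open>The second exchange, in the opposite direction; the factor produced is the
      mass of a region of size 7\<delta>, which is at most L \<xi>.\<close>
    also have "(\<integral>\<^sup>+ w. Z w \<partial>N) = (\<integral>\<^sup>+ \<xi>. epowr (L \<xi>) (p - 1) * emeasure N {w \<in> unit_ball. norm (1 - herm w \<xi>) < 7 * \<delta>} \<partial>sphere_measure)"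
      unfolding Z_def using fubini_section[OF carleson_pred LLm, simplified] by simp
    also have "\<dots> \<le> (\<integral>\<^sup>+ \<xi>. epowr (L \<xi>) p \<partial>sphere_measure)"
    proof (rule nn_integral_mono)
      fix \<xi> :: "complex ^ 'n"
      have "emeasure N {w \<in> unit_ball. norm (1 - herm w \<xi>) < 7 * \<delta>} \<le> L \<xi>"
        unfolding L_def using \<delta> by (intro emeasure_mono carleson_in_sets) (auto simp: carleson_region_eq)
      thus "epowr (L \<xi>) (p - 1) * emeasure N {w \<in> unit_ball. norm (1 - herm w \<xi>) < 7 * \<delta>} \<le> epowr (L \<xi>) p"
        unfolding epowr_mult_self[OF p] by (subst mult.commute) (rule mult_right_mono, auto)
    qed
    finally have main: "ennreal (c * \<delta> ^ CARD('n)) * (\<integral>\<^sup>+ \<xi>. epowr (T \<xi>) p \<partial>sphere_measure)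
      \<le> (\<integral>\<^sup>+ \<xi>. epowr (L \<xi>) p \<partial>sphere_measure) * ennreal (C * \<rho> ^ (2 * CARD('n) - 1) * \<delta> ^ CARD('n))"
      by (simp add: mult_right_mono)
    define q where "q = c * \<delta> ^ CARD('n)"
    have q: "q > 0" using c \<delta> by (simp add: q_def)
    have "(\<integral>\<^sup>+ \<xi>. epowr (T \<xi>) p \<partial>sphere_measure) = ennreal (1 / q) * (ennreal q * (\<integral>\<^sup>+ \<xi>. epowr (T \<xi>) p \<partial>sphere_measure))"
      using q by (simp add: mult.assoc[symmetric] ennreal_mult[symmetric] del: ennreal_1) simp
    also have "\<dots> \<le> ennreal (1 / q) * ((\<integral>\<^sup>+ \<xi>. epowr (L \<xi>) p \<partial>sphere_measure) * ennreal (C * \<rho> ^ (2 * CARD('n) - 1) * \<delta> ^ CARD('n)))"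
      using main unfolding q_def by (rule mult_left_mono) simp
    also have "\<dots> = (ennreal (1 / q) * ennreal (C * \<rho> ^ (2 * CARD('n) - 1) * \<delta> ^ CARD('n))) * (\<integral>\<^sup>+ \<xi>. epowr (L \<xi>) p \<partial>sphere_measure)"
      by (simp only: mult_ac)
    also have "ennreal (1 / q) * ennreal (C * \<rho> ^ (2 * CARD('n) - 1) * \<delta> ^ CARD('n))
      = ennreal (1 / q * (C * \<rho> ^ (2 * CARD('n) - 1) * \<delta> ^ CARD('n)))"
      using q C \<rho> \<delta> by (intro ennreal_mult[symmetric]) auto
    also have "1 / q * (C * \<rho> ^ (2 * CARD('n) - 1) * \<delta> ^ CARD('n)) = C / c * \<rho> ^ (2 * CARD('n) - 1)"
      using c \<delta> by (simp add: q_def)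
    finally show ?thesis unfolding T_def P_def L_def \<delta>_def .
  qed
  moreover have "C / c \<ge> 0" using C c by simp
  ultimately show ?thesis by blast
qed

text \<open>The same use of Fubini, but no decay in 1-r is sought, so T^(p-1) is bounded by a power
  of the total mass. For \<open>w = 0\<close> the dual section is empty because the defining
  inequality is strict.\<close>

lemma origin_estimate:
  assumes p: "1 < p"
  shows "\<exists>C\<ge>0. \<forall>r \<rho>. 0 \<le> r \<longrightarrow> 0 < \<rho> \<longrightarrow> \<rho> \<le> 1 \<longrightarrow>
    (\<integral>\<^sup>+ \<xi>. epowr (emeasure N {w \<in> unit_ball. norm (r *\<^sub>R \<xi> - w) < \<rho> * norm w}) p \<partial>sphere_measure)
    \<le> ennreal (C * \<rho> ^ (2 * CARD('n) - 1))"
proof -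
  obtain C where C: "C \<ge> 0"
    and upper: "\<And>r (w :: complex ^ 'n) \<rho>. 0 \<le> r \<Longrightarrow> w \<noteq> 0 \<Longrightarrow> 0 < \<rho> \<Longrightarrow> \<rho> \<le> 1 \<Longrightarrow>
    emeasure sphere_measure {\<xi> \<in> unit_sphere. norm (r *\<^sub>R \<xi> - w) < \<rho> * norm w}
      \<le> ennreal (C * \<rho> ^ (2 * CARD('n) - 1))"
    using sphere_measure_euclidean_ball[where 'n='n] by blast
  define B where "B = measure N (space N)"
  have B: "emeasure N (space N) = ennreal B" "B \<ge> 0" by (auto simp: B_def emeasure_eq_measure)
  have "(\<integral>\<^sup>+ \<xi>. epowr (emeasure N {w \<in> unit_ball. norm (r *\<^sub>R \<xi> - w) < \<rho> * norm w}) p \<partial>sphere_measure)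
    \<le> ennreal (B powr (p - 1) * B * C * \<rho> ^ (2 * CARD('n) - 1))"
    if r: "0 \<le> r" and \<rho>: "0 < \<rho>" "\<rho> \<le> 1" for r \<rho>
  proof -
    define P where "P \<xi> w \<longleftrightarrow> norm (r *\<^sub>R \<xi> - w) < \<rho> * norm w" for \<xi> w :: "complex ^ 'n"
    define T where "T \<xi> = emeasure N {w \<in> unit_ball. P \<xi> w}" for \<xi>
    have P: "Measurable.pred (borel \<Otimes>\<^sub>M borel) (case_prod P)"
      unfolding P_def by measurable
    have "(\<integral>\<^sup>+ \<xi>. epowr (T \<xi>) p \<partial>sphere_measure) \<le> (\<integral>\<^sup>+ \<xi>. ennreal (B powr (p - 1)) * T \<xi> \<partial>sphere_measure)"
    proof (rule nn_integral_mono)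
      fix \<xi> :: "complex ^ 'n"
      have "T \<xi> \<le> ennreal B" unfolding T_def B(1)[symmetric] by (rule emeasure_space)
      hence "epowr (T \<xi>) (p - 1) \<le> epowr (ennreal B) (p - 1)" using p by (intro epowr_mono) auto
      also have "\<dots> = ennreal (B powr (p - 1))" using B by (simp add: epowr_ennreal max_absorb2)
      finally show "epowr (T \<xi>) p \<le> ennreal (B powr (p - 1)) * T \<xi>"
        unfolding epowr_mult_self[OF p] by (subst mult.commute) (rule mult_right_mono, auto)
    qed
    also have "\<dots> = (\<integral>\<^sup>+ w. \<integral>\<^sup>+ \<xi>. ennreal (B powr (p - 1)) * indicator {\<xi>. P \<xi> w} \<xi> \<partial>sphere_measure \<partial>N)"
      unfolding T_def by (rule fubini_section[OF P]) simp
    also have "\<dots> = (\<integral>\<^sup>+ w. \<integral>\<^sup>+ \<xi>. ennreal (B powr (p - 1)) * indicator {\<xi> \<in> unit_sphere. P \<xi> w} \<xi> \<partial>sphere_measure \<partial>N)"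
      by (intro nn_integral_cong) (auto simp: space_sphere_measure split: split_indicator)
    also have "\<dots> = (\<integral>\<^sup>+ w. ennreal (B powr (p - 1)) * emeasure sphere_measure {\<xi> \<in> unit_sphere. P \<xi> w} \<partial>N)"
      by (intro nn_integral_cong nn_integral_cmult_indicator) (unfold P_def, measurable)
    also have "\<dots> \<le> (\<integral>\<^sup>+ w. ennreal (B powr (p - 1)) * ennreal (C * \<rho> ^ (2 * CARD('n) - 1)) \<partial>N)"
    proof (intro nn_integral_mono mult_left_mono)
      fix w :: "complex ^ 'n"
      show "emeasure sphere_measure {\<xi> \<in> unit_sphere. P \<xi> w} \<le> ennreal (C * \<rho> ^ (2 * CARD('n) - 1))"
      proof (cases "w = 0")
        case True
        have "{\<xi> \<in> unit_sphere. P \<xi> w} = {}" by (auto simp: P_def True)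
        thus ?thesis by (simp only: emeasure_empty zero_le)
      next
        case False
        thus ?thesis unfolding P_def using r \<rho> by (intro upper)
      qed
    qed simp
    also have "\<dots> = ennreal (B powr (p - 1)) * ennreal (C * \<rho> ^ (2 * CARD('n) - 1)) * ennreal B"
      by (simp add: B(1))
    also have "\<dots> = ennreal (B powr (p - 1) * B * C * \<rho> ^ (2 * CARD('n) - 1))"
      using B(2) C \<rho> by (simp add: ennreal_mult mult_ac)
    finally show ?thesis unfolding T_def P_def .
  qed
  moreover have "B powr (p - 1) * B * C \<ge> 0" using B C by simp
  ultimately show ?thesis by blast
qed

end

section \<open>Dyadic decomposition of the Green function\<close>

text \<open>For t > 0 the single term with 2^-(j+1) \<le> t < 2^-j already dominates t^-b. For t = 0
  all terms are present and the sum diverges, matching the infinite inverse.\<close>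

lemma dyadic_inverse_power:
  fixes t :: real
  assumes t: "0 \<le> t" "t < 1" and b: "b > 0"
  shows "inverse (ennreal (t ^ b)) \<le> (\<Sum>j. ennreal (2 ^ (b * Suc j)) * of_bool (t < (1/2) ^ j))"
proof (cases "t = 0")
  case True
  have "ennreal (real m) \<le> (\<Sum>j. ennreal (2 ^ (b * Suc j)) * of_bool (t < (1/2) ^ j))" for m
  proof -
    have "m \<le> b * Suc m" using b by (cases b) auto
    hence "(2::real) ^ m \<le> 2 ^ (b * Suc m)" by (intro power_increasing) auto
    moreover have "real m \<le> 2 ^ m" by (rule less_imp_le[OF of_nat_less_two_power])
    ultimately have "real m \<le> 2 ^ (b * Suc m)" by (rule order_trans[rotated])
    hence "ennreal (real m) \<le> ennreal (2 ^ (b * Suc m)) * of_bool (t < (1/2) ^ m)"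
      using True by (simp add: ennreal_leI)
    also have "\<dots> = (\<Sum>j\<in>{m}. ennreal (2 ^ (b * Suc j)) * of_bool (t < (1/2) ^ j))" by simp
    also have "\<dots> \<le> (\<Sum>j. ennreal (2 ^ (b * Suc j)) * of_bool (t < (1/2) ^ j))"
      by (rule sum_le_suminf) auto
    finally show ?thesis .
  qed
  note ge = this
  have "(\<Sum>j. ennreal (2 ^ (b * Suc j)) * of_bool (t < (1/2) ^ j)) = \<infinity>"
  proof (cases "(\<Sum>j. ennreal (2 ^ (b * Suc j)) * of_bool (t < (1/2) ^ j))")
    case (real x)
    obtain m where "x < real m" using reals_Archimedean2 by blast
    thus ?thesis using ge[of m] real by simp
  qed simp
  thus ?thesis by simp
next
  case False
  hence t0: "t > 0" using t by simp
  define P where "P j \<longleftrightarrow> (1/2) ^ j \<le> t" for j :: nat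
  obtain i where "(1/2) ^ i < t" using real_arch_pow_inv[OF t0, of "1/2"] by auto
  hence "\<exists>j. P j" by (intro exI[of _ i]) (simp add: P_def)
  hence L: "P (LEAST j. P j)" by (rule LeastI_ex)
  have "\<not> P 0" using t by (simp add: P_def)
  then obtain j where j: "(LEAST j. P j) = Suc j" using L by (metis not0_implies_Suc)
  hence "\<not> P j" using not_less_Least[of j P] by simp
  hence j1: "t < (1/2) ^ j" by (simp add: P_def)
  have j2: "(1/2) ^ Suc j \<le> t" using L[unfolded j] by (simp only: P_def)
  have "inverse (t ^ b) \<le> inverse (((1/2) ^ Suc j) ^ b)"
    using j2 by (intro le_imp_inverse_le power_mono) auto
  also have "\<dots> = inverse (1/2) ^ (Suc j * b)" by (simp only: power_mult power_inverse)
  also have "\<dots> = 2 ^ (b * Suc j)" by (simp only: mult.commute) simp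
  finally have "inverse (ennreal (t ^ b)) \<le> ennreal (2 ^ (b * Suc j)) * of_bool (t < (1/2) ^ j)"
    using j1 t0 by (simp add: inverse_ennreal ennreal_leI)
  also have "\<dots> = (\<Sum>j\<in>{j}. ennreal (2 ^ (b * Suc j)) * of_bool (t < (1/2) ^ j))" by simp
  also have "\<dots> \<le> (\<Sum>j. ennreal (2 ^ (b * Suc j)) * of_bool (t < (1/2) ^ j))"
    by (rule sum_le_suminf) auto
  finally show ?thesis .
qed

lemma ennreal_inverse_antimono:
  fixes x y :: ennreal
  assumes "x \<le> y"
  shows "inverse y \<le> inverse x"
proof (cases "x = 0 \<or> y = top")
  case False
  then obtain a b where ab: "x = ennreal a" "0 < a" "y = ennreal b" "0 \<le> b"
    using assms by (cases x; cases y) (auto simp: top_unique)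
  moreover have "a \<le> b" using assms ab by simp
  ultimately show ?thesis by (simp add: inverse_ennreal ennreal_leI)
qed auto

lemma pseudo_dist2_bounds:
  assumes "norm z < 1" "norm w < 1"
  shows "0 \<le> pseudo_dist2 z w" "pseudo_dist2 z w \<le> 1"
    "1 - pseudo_dist2 z w = (1 - (norm z)\<^sup>2) * (1 - (norm w)\<^sup>2) / (norm (1 - herm z w))\<^sup>2"
proof -
  show "0 \<le> pseudo_dist2 z w" using norm_ball_aut[OF assms] by (metis zero_le_power2)
  show eq: "1 - pseudo_dist2 z w = (1 - (norm z)\<^sup>2) * (1 - (norm w)\<^sup>2) / (norm (1 - herm z w))\<^sup>2"
    by (simp add: pseudo_dist2_def)
  have "0 \<le> (1 - (norm z)\<^sup>2) * (1 - (norm w)\<^sup>2) / (norm (1 - herm z w))\<^sup>2"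
    using assms by (intro divide_nonneg_nonneg mult_nonneg_nonneg) (auto simp: power_le_one)
  thus "pseudo_dist2 z w \<le> 1" using eq by simp
qed

lemma norm_ball_aut_le:
  assumes "norm z < 1" "norm w < 1"
  shows "norm (ball_aut w z) \<le> 1"
  using pseudo_dist2_bounds(2)[OF assms] unfolding norm_ball_aut[OF assms, symmetric]
  by (simp add: power_le_one_iff)

lemma one_minus_square_bounds:
  fixes s :: real
  assumes "0 \<le> s" "s \<le> 1"
  shows "1 - s \<le> 1 - s\<^sup>2" "1 - s\<^sup>2 \<le> 2 * (1 - s)"
proof -
  have "s * s \<le> s * 1" using assms by (intro mult_left_mono) auto
  thus "1 - s \<le> 1 - s\<^sup>2" by (simp add: power2_eq_square)
  have "0 \<le> (1 - s)\<^sup>2" by simp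
  thus "1 - s\<^sup>2 \<le> 2 * (1 - s)" by (simp add: power2_eq_square algebra_simps)
qed

text \<open>Let D = |1 - \<langle>r\<xi>,w\<rangle>| lie in the shell from 2^k \<delta> to 2^(k+1)
  \<delta>, with \<delta> = 1 - r. Then 1 - \<rho>^2 \<le> 4 (1-|w|) 4^-k / \<delta>, and the k-th
  summand alone is large enough; the shells start at k = 0 because D \<ge> \<delta>.\<close>

lemma far_kernel_le:
  fixes \<xi> w :: "complex ^ 'n::finite"
  assumes \<xi>: "norm \<xi> = 1" and r: "0 \<le> r" "r < 1" and w: "norm w < 1"
  shows "ennreal ((1 - pseudo_dist2 (r *\<^sub>R \<xi>) w) ^ CARD('n))
    \<le> (\<Sum>k. ennreal (4 ^ CARD('n) * (1 / 4 ^ CARD('n)) ^ k / (1 - r) ^ CARD('n)) *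
        (ennreal ((1 - norm w) ^ CARD('n)) * indicator (carleson_region \<xi> (2 ^ (k + 2) * (1 - r))) w))"
proof -
  let ?n = "CARD('n)"
  define \<delta> s D where "\<delta> = 1 - r" and "s = norm w" and "D = norm (1 - herm (r *\<^sub>R \<xi>) w)"
  have nz: "norm (r *\<^sub>R \<xi>) = r" using \<xi> r by simp
  have \<delta>: "0 < \<delta>" using r by (simp add: \<delta>_def)
  have s: "0 \<le> s" "s < 1" using w by (auto simp: s_def)
  have D: "\<delta> \<le> D" using one_minus_norm_le(1)[of "r *\<^sub>R \<xi>" w] r w \<xi> by (simp add: D_def \<delta>_def)
  define P where "P k \<longleftrightarrow> D < 2 ^ Suc k * \<delta>" for k
  have "\<exists>k. P k"
  proof -
    obtain k where "D / \<delta> < 2 ^ k" using real_arch_pow[of 2 "D / \<delta>"] by auto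
    also have "(2::real) ^ k \<le> 2 ^ Suc k" by simp
    finally show ?thesis using \<delta> by (auto simp: P_def pos_divide_less_eq)
  qed
  hence L: "P (LEAST k. P k)" by (rule LeastI_ex)
  define k where "k = (LEAST k. P k)"
  have k1: "D < 2 ^ Suc k * \<delta>" using L by (simp add: P_def k_def)
  have k2: "2 ^ k * \<delta> \<le> D"
  proof (cases k)
    case (Suc l)
    hence "\<not> P l" using not_less_Least[of l P] by (simp add: k_def)
    thus ?thesis by (simp add: P_def Suc)
  qed (use D in simp)
  have "1 - pseudo_dist2 (r *\<^sub>R \<xi>) w = (1 - r\<^sup>2) * (1 - s\<^sup>2) / D\<^sup>2"
    using pseudo_dist2_bounds(3)[of "r *\<^sub>R \<xi>" w] r w \<xi> by (simp add: D_def s_def)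
  also have "\<dots> \<le> ((2 * \<delta>) * (2 * (1 - s))) / (2 ^ k * \<delta>)\<^sup>2"
    using one_minus_square_bounds[of r] one_minus_square_bounds[of s] r s k2 \<delta> unfolding \<delta>_def[symmetric]
    by (intro frac_le mult_mono power_mono) auto
  also have "\<dots> = 4 * (1 - s) * (1 / 4) ^ k / \<delta>"
    using \<delta> by (simp add: power2_eq_square power_mult_distrib[symmetric] power_divide field_simps)
  finally have "(1 - pseudo_dist2 (r *\<^sub>R \<xi>) w) ^ ?n \<le> (4 * (1 - s) * (1 / 4) ^ k / \<delta>) ^ ?n"
    using pseudo_dist2_bounds(2)[of "r *\<^sub>R \<xi>" w] r w \<xi> by (intro power_mono) auto
  also have "\<dots> = 4 ^ ?n * (1 / 4 ^ ?n) ^ k / \<delta> ^ ?n * (1 - s) ^ ?n"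
  proof -
    have "((1 / 4) ^ k) ^ ?n = (1 / 4 ^ ?n :: real) ^ k"
      by (simp add: power_mult[symmetric] power_divide mult.commute)
    thus ?thesis by (simp only: power_mult_distrib power_divide[of _ \<delta>]) (simp add: mult_ac)
  qed
  finally have "ennreal ((1 - pseudo_dist2 (r *\<^sub>R \<xi>) w) ^ ?n) \<le> ennreal (4 ^ ?n * (1 / 4 ^ ?n) ^ k / \<delta> ^ ?n * (1 - s) ^ ?n)"
    by (rule ennreal_leI)
  also have "\<dots> = ennreal (4 ^ ?n * (1 / 4 ^ ?n) ^ k / \<delta> ^ ?n) * ennreal ((1 - s) ^ ?n)"
    using \<delta> s by (intro ennreal_mult) auto
  also have "ennreal ((1 - s) ^ ?n) = ennreal ((1 - s) ^ ?n) * indicator (carleson_region \<xi> (2 ^ (k + 2) * \<delta>)) w"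
  proof -
    \<comment> \<open>Passing from \<open>r *\<^sub>R \<xi>\<close> to \<xi> costs \<delta>, which
      explains the exponent k + 2 instead of k + 1.\<close>
    have "norm (1 - herm w \<xi>) \<le> D + \<delta>"
      using one_minus_herm_radial(1)[OF \<xi> r w] by (simp add: D_def \<delta>_def)
    also have "\<dots> < 2 ^ Suc k * \<delta> + 1 * \<delta>" using k1 by simp
    also have "\<dots> \<le> 2 ^ Suc k * \<delta> + 2 ^ Suc k * \<delta>" using \<delta> one_le_power[of "2::real" "Suc k"] by (intro add_left_mono mult_right_mono) auto
    also have "\<dots> = 2 ^ (k + 2) * \<delta>" by simp
    finally show ?thesis using w by (simp add: carleson_region_eq)
  qed
  also have "ennreal (4 ^ ?n * (1 / 4 ^ ?n) ^ k / \<delta> ^ ?n) * (ennreal ((1 - s) ^ ?n) * indicator (carleson_region \<xi> (2 ^ (k + 2) * \<delta>)) w)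
    = (\<Sum>k\<in>{k}. ennreal (4 ^ ?n * (1 / 4 ^ ?n) ^ k / \<delta> ^ ?n) * (ennreal ((1 - s) ^ ?n) * indicator (carleson_region \<xi> (2 ^ (k + 2) * \<delta>)) w))"
    by simp
  also have "\<dots> \<le> (\<Sum>k. ennreal (4 ^ ?n * (1 / 4 ^ ?n) ^ k / \<delta> ^ ?n) * (ennreal ((1 - s) ^ ?n) * indicator (carleson_region \<xi> (2 ^ (k + 2) * \<delta>)) w))"
    by (rule sum_le_suminf) auto
  finally show ?thesis unfolding \<delta>_def s_def .
qed

text \<open>Split at \<rho> = 1/2: outside, the singular factor \<rho>^(2-2n) is at most 4^(n-1);
  inside, the factor (1 - \<rho>^2)^n is at most 1 and only the singularity is kept.\<close>

lemma green_le_far_plus_near: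
  fixes z w :: "complex ^ 'n::finite"
  assumes n: "CARD('n) > 1" and z: "norm z < 1" and w: "norm w < 1"
  shows "green z w \<le> ennreal (4 ^ (CARD('n) - 1)) * ennreal ((1 - pseudo_dist2 z w) ^ CARD('n))
    + inverse (ennreal (norm (ball_aut w z) ^ (2 * (CARD('n) - 1)))) * of_bool (pseudo_dist2 z w < 1/4)"
proof -
  let ?b = "2 * (CARD('n) - 1)"
  define u where "u = ball_aut w z"
  have u: "norm u \<le> 1" unfolding u_def by (rule norm_ball_aut_le[OF z w])
  have pd: "pseudo_dist2 z w = (norm u)\<^sup>2" unfolding u_def by (rule norm_ball_aut[OF z w, symmetric])
  have "green z w \<le> green_model u" unfolding green_def u_def[symmetric] by (rule green_le_model(1)[OF n u])
  also have "\<dots> \<le> ennreal (4 ^ (CARD('n) - 1)) * ennreal ((1 - (norm u)\<^sup>2) ^ CARD('n))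
    + inverse (ennreal (norm u ^ ?b)) * of_bool ((norm u)\<^sup>2 < 1/4)"
  proof (cases "(norm u)\<^sup>2 < 1/4")
    case True
    have "green_model u \<le> 1 * inverse (ennreal (norm u ^ ?b))"
      unfolding green_model_def divide_ennreal_def using u
      by (intro mult_right_mono) (auto intro!: power_le_one simp: power_le_one)
    thus ?thesis using True by (simp add: add_increasing)
  next
    case False
    hence "(1/2)\<^sup>2 \<le> (norm u)\<^sup>2" by (simp add: power2_eq_square)
    hence u2: "1/2 \<le> norm u" by (rule power2_le_imp_le) simp
    have "inverse (norm u) ^ ?b \<le> 2 ^ ?b"
      using u2 le_imp_inverse_le[of "1/2" "norm u"] by (intro power_mono) auto
    also have "(2::real) ^ ?b = 4 ^ (CARD('n) - 1)" by (simp add: power_mult)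
    finally have "(1 - (norm u)\<^sup>2) ^ CARD('n) * inverse (norm u) ^ ?b \<le> (1 - (norm u)\<^sup>2) ^ CARD('n) * 4 ^ (CARD('n) - 1)"
      using u by (intro mult_left_mono) (auto simp: power_le_one)
    hence "green_model u \<le> ennreal ((1 - (norm u)\<^sup>2) ^ CARD('n) * 4 ^ (CARD('n) - 1))"
      using u2 u by (subst green_model_eq) (auto intro!: ennreal_leI)
    also have "\<dots> = ennreal (4 ^ (CARD('n) - 1)) * ennreal ((1 - (norm u)\<^sup>2) ^ CARD('n))"
      using u by (subst ennreal_mult[symmetric]) (auto simp: power_le_one mult.commute)
    finally show ?thesis using False by simp
  qed
  finally show ?thesis unfolding pd u_def .
qed

text \<open>The dyadic expansion is applied to t = 2\<rho> < 1, which costs 4^(n-1) and shifts the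
  threshold for \<rho> to 2^-(j+1). The weight of \<lambda> can be inserted because 1-|w| and 1-r
  are comparable here.\<close>

lemma near_kernel_le:
  fixes \<xi> w :: "complex ^ 'n::finite"
  assumes n: "CARD('n) > 1" and \<xi>: "norm \<xi> = 1" and r: "0 \<le> r" "r < 1" and w: "norm w < 1"
  shows "inverse (ennreal (norm (ball_aut w (r *\<^sub>R \<xi>)) ^ (2 * (CARD('n) - 1)))) * of_bool (pseudo_dist2 (r *\<^sub>R \<xi>) w < 1/4)
    \<le> (\<Sum>j. ennreal (4 ^ (CARD('n) - 1) * 2 ^ (2 * (CARD('n) - 1) * Suc j) * 6 ^ CARD('n) / (1 - r) ^ CARD('n)) *
        (ennreal ((1 - norm w) ^ CARD('n)) * indicator {w \<in> unit_ball. pseudo_dist2 (r *\<^sub>R \<xi>) w < ((1/2) ^ Suc j)\<^sup>2} w))"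
proof (cases "pseudo_dist2 (r *\<^sub>R \<xi>) w < 1/4")
  case True
  let ?n = "CARD('n)" and ?b = "2 * (CARD('n) - 1)"
  define z where "z = r *\<^sub>R \<xi>"
  have nz: "norm z = r" using \<xi> r by (simp add: z_def)
  have near: "pseudo_dist2 z w < 1/4" using True by (simp add: z_def)
  define t where "t = 2 * norm (ball_aut w z)"
  have pd: "pseudo_dist2 z w = (norm (ball_aut w z))\<^sup>2" using norm_ball_aut[of z w] nz r w by simp
  have "(norm (ball_aut w z))\<^sup>2 < (1/2)\<^sup>2" using True pd by (simp add: z_def power2_eq_square)
  hence "norm (ball_aut w z) < 1/2" by (rule power2_less_imp_less) simp
  hence t: "0 \<le> t" "t < 1" by (auto simp: t_def)
  have b: "?b > 0" using n by simp
  have s1: "3/16 * (1 - r) \<le> 1 - norm w" using pseudo_dist2_near(2)[of z w] near nz r w by simp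
  \<comment> \<open>The constant 6 exceeds 16/3, the reciprocal of the 3/16 in
    \<open>s1\<close>.\<close>
  have one: "1 \<le> 6 ^ ?n / (1 - r) ^ ?n * (1 - norm w) ^ ?n"
  proof -
    have "1 \<le> (6 / (1 - r) * (1 - norm w)) ^ ?n" using s1 r by (intro one_le_power) (simp add: field_simps)
    thus ?thesis by (simp only: power_mult_distrib power_divide)
  qed
  have ind: "t < (1/2) ^ j \<longleftrightarrow> pseudo_dist2 z w < ((1/2) ^ Suc j)\<^sup>2" for j
  proof -
    have "pseudo_dist2 z w < ((1/2) ^ Suc j)\<^sup>2 \<longleftrightarrow> norm (ball_aut w z) < (1/2) ^ Suc j"
      unfolding pd not_le[symmetric] by (subst power_mono_iff) auto
    thus ?thesis by (simp add: t_def mult.commute)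
  qed
  have "norm (ball_aut w z) ^ ?b = (1 / 4 ^ (CARD('n) - 1)) * t ^ ?b"
    by (simp add: t_def power_mult_distrib power_mult)
  hence "inverse (ennreal (norm (ball_aut w z) ^ ?b)) = inverse (ennreal ((1 / 4 ^ (CARD('n) - 1)) * t ^ ?b))"
    by (simp only:)
  also have "ennreal ((1 / 4 ^ (CARD('n) - 1)) * t ^ ?b) = ennreal (1 / 4 ^ (CARD('n) - 1)) * ennreal (t ^ ?b)"
    using t by (intro ennreal_mult) auto
  also have "inverse (ennreal (1 / 4 ^ (CARD('n) - 1)) * ennreal (t ^ ?b))
      = inverse (ennreal (1 / 4 ^ (CARD('n) - 1))) * inverse (ennreal (t ^ ?b))"
    by (rule ennreal_inverse_mult') auto
  also have "inverse (ennreal (1 / 4 ^ (CARD('n) - 1))) = ennreal (4 ^ (CARD('n) - 1))"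
    by (simp add: inverse_ennreal)
  also have "ennreal (4 ^ (CARD('n) - 1)) * inverse (ennreal (t ^ ?b))
    \<le> ennreal (4 ^ (CARD('n) - 1)) * (\<Sum>j. ennreal (2 ^ (?b * Suc j)) * of_bool (t < (1/2) ^ j))"
    by (intro mult_left_mono dyadic_inverse_power t b) simp
  also have "\<dots> = (\<Sum>j. ennreal (4 ^ (CARD('n) - 1)) * (ennreal (2 ^ (?b * Suc j)) * of_bool (t < (1/2) ^ j)))"
    by (rule ennreal_suminf_cmult[symmetric])
  also have "\<dots> \<le> (\<Sum>j. ennreal (4 ^ (CARD('n) - 1) * 2 ^ (?b * Suc j) * 6 ^ ?n / (1 - r) ^ ?n) *
        (ennreal ((1 - norm w) ^ ?n) * indicator {w \<in> unit_ball. pseudo_dist2 z w < ((1/2) ^ Suc j)\<^sup>2} w))"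
  proof (intro suminf_le allI)
    fix j
    define A where "A = (4::real) ^ (CARD('n) - 1) * 2 ^ (?b * Suc j)"
    have A: "A \<ge> 0" by (simp add: A_def)
    have "A * 1 \<le> A * (6 ^ ?n / (1 - r) ^ ?n * (1 - norm w) ^ ?n)" by (intro mult_left_mono one A)
    hence "ennreal A \<le> ennreal (A * 6 ^ ?n / (1 - r) ^ ?n * (1 - norm w) ^ ?n)" by (intro ennreal_leI) simp
    also have "\<dots> = ennreal (A * 6 ^ ?n / (1 - r) ^ ?n) * ennreal ((1 - norm w) ^ ?n)"
      using A r w by (intro ennreal_mult) auto
    finally have "ennreal A * of_bool (t < (1/2) ^ j) \<le> ennreal (A * 6 ^ ?n / (1 - r) ^ ?n) * ennreal ((1 - norm w) ^ ?n) * of_bool (t < (1/2) ^ j)"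
      by (rule mult_right_mono) simp
    moreover have "of_bool (t < (1/2) ^ j) = (indicator {w \<in> unit_ball. pseudo_dist2 z w < ((1/2) ^ Suc j)\<^sup>2} w :: ennreal)"
      unfolding ind using w by (simp add: indicator_def)
    moreover have "ennreal A = ennreal (4 ^ (CARD('n) - 1)) * ennreal (2 ^ (?b * Suc j))"
      unfolding A_def by (rule ennreal_mult) auto
    ultimately show "ennreal (4 ^ (CARD('n) - 1)) * (ennreal (2 ^ (?b * Suc j)) * of_bool (t < (1/2) ^ j))
      \<le> ennreal (4 ^ (CARD('n) - 1) * 2 ^ (?b * Suc j) * 6 ^ ?n / (1 - r) ^ ?n) *
        (ennreal ((1 - norm w) ^ ?n) * indicator {w \<in> unit_ball. pseudo_dist2 z w < ((1/2) ^ Suc j)\<^sup>2} w)"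
      unfolding A_def[symmetric] by (simp only: mult.assoc)
  qed auto
  finally show ?thesis using True by (simp add: z_def)
qed simp

text \<open>With |z| \<le> 1/2 and \<rho> < 1/2 the point \<open>w\<close> stays away from the
  sphere, so \<rho> \<ge> |z-w|/7. Writing |z-w| = |w| t splits the singularity into |w|^(2-2n),
  comparable to \<open>green_model w\<close>, and t^(2-2n), which is at most 1 or expanded
  dyadically.\<close>

lemma origin_kernel_le:
  fixes \<xi> w :: "complex ^ 'n::finite"
  assumes n: "CARD('n) > 1" and \<xi>: "norm \<xi> = 1" and r: "0 \<le> r" "r \<le> 1/2" and w: "norm w < 1"
  shows "inverse (ennreal (norm (ball_aut w (r *\<^sub>R \<xi>)) ^ (2 * (CARD('n) - 1)))) * of_bool (pseudo_dist2 (r *\<^sub>R \<xi>) w < 1/4)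
    \<le> ennreal (7 ^ (2 * (CARD('n) - 1)) * 11 ^ CARD('n)) *
       (green_model w * 1 + (\<Sum>j. ennreal (2 ^ (2 * (CARD('n) - 1) * Suc j)) *
          (green_model w * indicator {w \<in> unit_ball. norm (r *\<^sub>R \<xi> - w) < (1/2) ^ j * norm w} w)))"
proof (cases "pseudo_dist2 (r *\<^sub>R \<xi>) w < 1/4")
  case True
  let ?n = "CARD('n)" and ?b = "2 * (CARD('n) - 1)"
  define z s where "z = r *\<^sub>R \<xi>" and "s = norm w"
  have near: "pseudo_dist2 z w < 1/4" using True by (simp add: z_def)
  define S where "S = (\<Sum>j. ennreal (2 ^ (?b * Suc j)) * indicator {w \<in> unit_ball. norm (z - w) < (1/2) ^ j * norm w} w)"
  have rhs: "green_model w * 1 + (\<Sum>j. ennreal (2 ^ (?b * Suc j)) * (green_model w * indicator {w \<in> unit_ball. norm (z - w) < (1/2) ^ j * norm w} w))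
     = green_model w * (1 + S)"
    unfolding S_def distrib_left ennreal_suminf_cmult[symmetric] by (simp only: mult.left_commute)
  have b: "?b > 0" using n by simp
  have "inverse (ennreal (norm (ball_aut w z) ^ ?b)) \<le> ennreal (7 ^ ?b * 11 ^ ?n) * (green_model w * (1 + S))"
  proof (cases "w = 0")
    case True
    thus ?thesis by (simp add: green_model_0[OF n] ennreal_top_mult ennreal_mult_top)
  next
    case False
    hence s: "0 < s" "s < 1" using w by (auto simp: s_def)
    have nz: "norm z = r" using \<xi> r by (simp add: z_def)
    have s1: "3/32 \<le> 1 - s"
    proof -
      have "3/16 * (1 - r) \<le> 1 - s"
        using pseudo_dist2_near(2)[of z w] near nz r w by (simp add: s_def)
      thus ?thesis using r by (simp add: field_simps)
    qed
    obtain \<eta> where \<eta>: "norm \<eta> = 1" "w = s *\<^sub>R \<eta>" unfolding s_def by (rule obtain_polar)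
    define h where "h = herm z \<eta>"
    have h1: "norm h \<le> r" using norm_herm_le[of z \<eta>] by (simp add: nz \<eta> h_def)
    have hw: "Re h = z \<bullet> \<eta>" by (simp add: h_def Re_herm)
    define D where "D = norm (1 - herm z w)"
    have D2: "D \<le> 2"
    proof -
      have "D \<le> 1 + norm (herm z w)" unfolding D_def using norm_triangle_ineq4[of 1 "herm z w"] by simp
      also have "norm (herm z w) \<le> r * s" using norm_herm_le[of z w] by (simp add: nz s_def)
      also have "r * s \<le> 1 * 1" using r s by (intro mult_mono) auto
      finally show ?thesis by simp
    qed
    have D0: "0 \<le> D" by (simp add: D_def)
    have dist: "(norm (z - w))\<^sup>2 = (norm (h - of_real s))\<^sup>2 + (r\<^sup>2 - (norm h)\<^sup>2)"
    proof -
      have "(norm (z - w))\<^sup>2 = r\<^sup>2 + s\<^sup>2 - 2 * s * Re h"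
        unfolding \<eta>(2) power2_norm_eq_inner using \<eta>(1) nz
        by (simp add: inner_diff inner_commute hw norm_eq_1 power2_eq_square power2_norm_eq_inner[of z, unfolded power2_eq_square, symmetric])
      thus ?thesis unfolding cmod_power2 by (simp add: power2_eq_square algebra_simps)
    qed
    have "(norm h)\<^sup>2 \<le> r\<^sup>2" using h1 by (intro power_mono) auto
    hence rh: "0 \<le> r\<^sup>2 - (norm h)\<^sup>2" by simp
    have s2: "3/32 \<le> 1 - s\<^sup>2" "1 - s\<^sup>2 \<le> 1" using one_minus_square_bounds(1)[of s] s s1 by auto
    \<comment> \<open>In \<open>pseudo_dist2_polar\<close> the transverse part has weight 1 - s^2
      \<ge> 3/32. With D \<le> 2 this gives |z-w|^2 \<le> (128/3) \<rho>^2, and 128/3 < 7^2.\<close>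
    have "3/32 * (norm (z - w))\<^sup>2 \<le> 1 * (norm (h - of_real s))\<^sup>2 + (1 - s\<^sup>2) * (r\<^sup>2 - (norm h)\<^sup>2)"
      unfolding dist distrib_left using s2 rh by (intro add_mono mult_right_mono) auto
    also have "\<dots> = pseudo_dist2 z w * D\<^sup>2"
      using pseudo_dist2_polar[OF \<eta>(1), of s z] s nz r
      by (simp add: \<eta>(2)[symmetric] D_def h_def)
    also have "\<dots> \<le> pseudo_dist2 z w * 2\<^sup>2"
      using pseudo_dist2_bounds(1)[of z w] nz r w D2 D0 by (intro mult_left_mono power_mono) auto
    also have "pseudo_dist2 z w = (norm (ball_aut w z))\<^sup>2" using norm_ball_aut[of z w] nz r w by simp
    finally have "(norm (z - w))\<^sup>2 \<le> 128/3 * (norm (ball_aut w z))\<^sup>2" by simp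
    also have "\<dots> \<le> (7 * norm (ball_aut w z))\<^sup>2" by (simp add: power_mult_distrib)
    finally have zw: "norm (z - w) \<le> 7 * norm (ball_aut w z)" by (rule power2_le_imp_le) simp
    define t where "t = norm (z - w) / s"
    have t: "0 \<le> t" using s by (simp add: t_def)
    have "s / 7 * t \<le> norm (ball_aut w z)" using zw s by (simp add: t_def)
    hence "(s / 7 * t) ^ ?b \<le> norm (ball_aut w z) ^ ?b" using s t by (intro power_mono) auto
    hence "inverse (ennreal (norm (ball_aut w z) ^ ?b)) \<le> inverse (ennreal ((s / 7 * t) ^ ?b))"
      by (intro ennreal_inverse_antimono ennreal_leI)
    also have "\<dots> = inverse (ennreal ((s / 7) ^ ?b) * ennreal (t ^ ?b))"
      using s t by (simp add: power_mult_distrib ennreal_mult[symmetric] power_divide)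
    also have "\<dots> = inverse (ennreal ((s / 7) ^ ?b)) * inverse (ennreal (t ^ ?b))"
      using s by (intro ennreal_inverse_mult') auto
    also have "inverse (ennreal (t ^ ?b)) \<le> 1 + S"
    proof (cases "t < 1")
      case True
      have "inverse (ennreal (t ^ ?b)) \<le> (\<Sum>j. ennreal (2 ^ (?b * Suc j)) * of_bool (t < (1/2) ^ j))"
        by (rule dyadic_inverse_power[OF t True b])
      also have "\<dots> = S"
        unfolding S_def using s w by (intro suminf_cong arg_cong2[of _ _ _ _ "(*)"] refl)
          (auto simp: t_def indicator_def pos_divide_less_eq s_def mult.commute)
      finally show ?thesis by (simp add: add_increasing)
    next
      case False
      hence "1 \<le> t ^ ?b" by (intro one_le_power) simp
      hence "inverse (ennreal (t ^ ?b)) \<le> inverse (ennreal 1)" by (intro ennreal_inverse_antimono ennreal_leI)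
      thus ?thesis by (simp add: add_increasing2)
    qed
    also have "inverse (ennreal ((s / 7) ^ ?b)) \<le> ennreal (7 ^ ?b * 11 ^ ?n) * green_model w"
    proof -
      \<comment> \<open>Inserts the numerator of \<open>green_model\<close>; 11 exceeds
        32/3.\<close>
      have "1 \<le> (11 * (1 - s\<^sup>2)) ^ ?n" using s2 by (intro one_le_power) simp
      hence "inverse ((s / 7) ^ ?b) * 1 \<le> inverse ((s / 7) ^ ?b) * (11 * (1 - s\<^sup>2)) ^ ?n"
        using s by (intro mult_left_mono) auto
      also have "\<dots> = 7 ^ ?b * 11 ^ ?n * ((1 - s\<^sup>2) ^ ?n * inverse s ^ ?b)"
        by (simp only: power_mult_distrib power_divide inverse_divide divide_inverse power_inverse
            inverse_mult_distrib inverse_inverse_eq mult_ac)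
      finally have "ennreal (inverse ((s / 7) ^ ?b)) \<le> ennreal (7 ^ ?b * 11 ^ ?n * ((1 - s\<^sup>2) ^ ?n * inverse s ^ ?b))"
        by (intro ennreal_leI) simp
      also have "\<dots> = ennreal (7 ^ ?b * 11 ^ ?n) * green_model w"
        using green_model_eq[of w] s s2 by (simp add: s_def[symmetric] ennreal_mult)
      finally show ?thesis using s by (simp add: inverse_ennreal)
    qed
    finally show ?thesis by (simp add: mult.assoc mult_right_mono mult_left_mono)
  qed
  thus ?thesis using True rhs by (simp add: z_def)
qed simp

section \<open>Means of Green potentials\<close>

lemma power_powr_swap: "0 \<le> x \<Longrightarrow> (x ^ k) powr e = (x powr e) ^ k" for x e :: real
  by (induction k) (simp_all add: powr_mult)

text \<open>Coefficients growing like 2^(bj) against L^p norms decaying like 2^(-jN/p): the bounds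
  form a geometric series whose ratio is assumed below 1.\<close>

lemma minkowski_geometric:
  fixes f :: "nat \<Rightarrow> 'a \<Rightarrow> ennreal"
  assumes p: "p > 1" and c: "c > 0" and A: "A > 0"
    and f: "\<And>j. f j \<in> borel_measurable M"
    and le: "\<And>j. (\<integral>\<^sup>+ x. epowr (f j x) p \<partial>M) \<le> ennreal (A powr p * ((1/2) ^ j) ^ N)"
    and less: "2 ^ b * (1/2) powr (real N / p) < 1"
  shows "(\<integral>\<^sup>+ x. epowr (\<Sum>j. ennreal (c * (2 ^ b) ^ j) * f j x) p \<partial>M)
    \<le> ennreal ((\<Sum>j. c * A * (2 ^ b * (1/2) powr (real N / p)) ^ j) powr p)"
proof -
  define \<theta> where "\<theta> = 2 ^ b * (1/2) powr (real N / p)"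
  have \<theta>: "0 < \<theta>" "\<theta> < 1" using less by (auto simp: \<theta>_def)
  define m where "m j = A * ((1/2) powr (real N / p)) ^ j" for j
  have m: "m j > 0" for j using A by (simp add: m_def)
  have cm: "c * (2 ^ b) ^ j * m j = c * A * \<theta> ^ j" for j
    by (simp only: m_def \<theta>_def power_mult_distrib mult_ac)
  have "m j powr p = A powr p * ((1/2) ^ j) ^ N" for j
  proof -
    have "m j powr p = A powr p * (((1/2) powr (real N / p)) powr p) ^ j"
      using A by (simp add: m_def powr_mult power_powr_swap)
    also have "((1/2) powr (real N / p)) powr p = (1/2) ^ N"
      using p by (simp add: powr_powr powr_realpow)
    finally show ?thesis by (simp only: power_mult[symmetric] mult.commute)
  qed
  hence "(\<integral>\<^sup>+ x. epowr (\<Sum>j. ennreal (c * (2 ^ b) ^ j) * f j x) p \<partial>M)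
    \<le> ennreal ((\<Sum>j. c * (2 ^ b) ^ j * m j) powr p)"
    using c m \<theta> le by (intro minkowski_suminf p f) (auto simp: cm intro!: summable_mult summable_geometric)
  thus ?thesis unfolding cm \<theta>_def .
qed

text \<open>The upper bound on p says p (2n-2) < 2n-1: the decay exponent (2n-1)/p of the dyadic
  masses beats the exponent 2n-2 of the singularity.\<close>

lemma exponent_less:
  assumes n: "CARD('n::finite) > 1"
    and p: "1 < p" "p < (2 * real CARD('n) - 1) / (2 * (real CARD('n) - 1))"
  shows "2 ^ (2 * (CARD('n) - 1)) * (1/2) powr (real (2 * CARD('n) - 1) / p) < 1"
proof -
  define b N where "b = 2 * (real CARD('n) - 1)" and "N = 2 * real CARD('n) - 1"
  have b: "b > 0" using n by (simp add: b_def)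
  have bN: "real (2 * (CARD('n) - 1)) = b" "real (2 * CARD('n) - 1) = N"
    using n by (auto simp: b_def N_def of_nat_diff)
  have "p * b < N" using p(2) b unfolding b_def[symmetric] N_def[symmetric] by (simp add: pos_less_divide_eq)
  hence "b < N / p" using p(1) by (simp add: pos_less_divide_eq mult.commute)
  moreover have "2 ^ (2 * (CARD('n) - 1)) * (1/2) powr (N / p) = 2 powr (b - N / p)"
  proof -
    have "(2::real) ^ (2 * (CARD('n) - 1)) = 2 powr b"
      unfolding bN(1)[symmetric] by (rule powr_realpow[symmetric]) simp
    moreover have "(1/2 :: real) powr (N / p) = 1 / 2 powr (N / p)" by (simp add: powr_divide)
    ultimately show ?thesis by (simp add: powr_diff)
  qed
  moreover have "(2::real) powr (b - N / p) < 2 powr 0 \<longleftrightarrow> b - N / p < 0"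
    by (rule powr_less_cancel_iff) simp
  ultimately show ?thesis unfolding bN by simp
qed

lemma mean_sum_le:
  assumes p: "p > 1" and K: "K > 0"
    and F[measurable]: "F \<in> borel_measurable M" and J[measurable]: "J \<in> borel_measurable M"
    and u: "\<And>x. x \<in> space M \<Longrightarrow> u x \<le> ennreal K * F x + J x"
    and X: "(\<integral>\<^sup>+ x. epowr (F x) p \<partial>M) \<le> X" and Y: "(\<integral>\<^sup>+ x. epowr (J x) p \<partial>M) \<le> Y"
  shows "(\<integral>\<^sup>+ x. epowr (u x) p \<partial>M) \<le> ennreal (2 powr p) * (ennreal (K powr p) * X + Y)"
proof -
  have "(\<integral>\<^sup>+ x. epowr (u x) p \<partial>M) \<le> (\<integral>\<^sup>+ x. ennreal (2 powr p) * (ennreal (K powr p) * epowr (F x) p + epowr (J x) p) \<partial>M)"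
  proof (rule nn_integral_mono)
    fix x assume "x \<in> space M"
    hence "epowr (u x) p \<le> epowr (ennreal K * F x + J x) p" using p by (intro epowr_mono u) auto
    also have "\<dots> \<le> ennreal (2 powr p) * (epowr (ennreal K * F x) p + epowr (J x) p)"
      using p by (intro epowr_add_le) simp
    finally show "epowr (u x) p \<le> ennreal (2 powr p) * (ennreal (K powr p) * epowr (F x) p + epowr (J x) p)"
      unfolding epowr_mult_ennreal[OF K] .
  qed
  also have "\<dots> = ennreal (2 powr p) * (ennreal (K powr p) * (\<integral>\<^sup>+ x. epowr (F x) p \<partial>M) + (\<integral>\<^sup>+ x. epowr (J x) p \<partial>M))"
    by (simp add: nn_integral_cmult nn_integral_add)
  also have "\<dots> \<le> ennreal (2 powr p) * (ennreal (K powr p) * X + Y)"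
    by (intro mult_left_mono add_mono X Y) auto
  finally show ?thesis .
qed

lemma means_bounded_onI:
  fixes u :: "complex ^ 'n::finite \<Rightarrow> ennreal"
  assumes p: "p > 0"
    and le: "\<And>r. r \<in> I \<Longrightarrow> (\<integral>\<^sup>+ \<xi>. epowr (u (r *\<^sub>R \<xi>)) p \<partial>sphere_measure) \<le> ennreal A"
  shows "means_bounded_on I p u"
  unfolding means_bounded_on_def
proof (intro exI ballI)
  fix r assume "r \<in> I"
  have "(\<integral>\<^sup>+ \<xi>. epowr (u (r *\<^sub>R \<xi>)) p \<partial>sphere_measure) \<le> ennreal ((\<bar>A\<bar> powr (1 / p)) powr p)"
    using p by (intro order_trans[OF le[OF \<open>r \<in> I\<close>]] ennreal_leI) (simp add: powr_powr)
  thus "integral_mean p r u \<le> ennreal (\<bar>A\<bar> powr (1 / p))"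
    unfolding integral_mean_def using p by (subst epowr_root_le_iff) auto
qed

lemma means_bounded_on_subset: "means_bounded_on I p u \<Longrightarrow> J \<subseteq> I \<Longrightarrow> means_bounded_on J p u"
  unfolding means_bounded_on_def by blast

section \<open>Means of the potential on spheres away from the origin\<close>

locale ball_potential =
  fixes \<mu> :: "(complex ^ 'n::finite) measure"
  assumes n: "CARD('n) > 1"
    and sets_mu: "sets \<mu> = sets (restrict_space borel unit_ball)"
    and fin: "(\<integral>\<^sup>+ w. ennreal ((1 - (norm w)\<^sup>2) ^ CARD('n)) \<partial>\<mu>) < \<infinity>"
begin

lemma space_mu: "space \<mu> = unit_ball"
  using sets_eq_imp_space_eq[OF sets_mu] by (simp add: space_restrict_space)

lemma id_measurable_mu [measurable]: "(\<lambda>w. w) \<in> \<mu> \<rightarrow>\<^sub>M borel"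
  by (subst measurable_cong_sets[OF sets_mu refl]) (rule measurable_restrict_space1, simp)

abbreviation weight :: "complex ^ 'n \<Rightarrow> ennreal" where
  "weight w \<equiv> ennreal ((1 - norm w) ^ CARD('n))"

lemma weight_measurable [measurable]: "weight \<in> borel_measurable \<mu>"
  by measurable

abbreviation lam :: "(complex ^ 'n) measure" where "lam \<equiv> weighted_measure \<mu>"

sublocale lam: finite_ball_measure lam
proof (rule finite_ball_measure.intro)
  have "emeasure lam (space lam) = (\<integral>\<^sup>+ w. weight w \<partial>\<mu>)"
    unfolding weighted_measure_def by (subst emeasure_density) (auto intro!: nn_integral_cong)
  also have "\<dots> \<le> (\<integral>\<^sup>+ w. ennreal ((1 - (norm w)\<^sup>2) ^ CARD('n)) \<partial>\<mu>)"
    using one_minus_square_bounds(1) by (intro nn_integral_mono ennreal_leI power_mono) (auto simp: space_mu)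
  finally have "emeasure lam (space lam) < \<infinity>" using fin by (rule le_less_trans)
  thus "finite_measure lam" by (intro finite_measureI) simp
  show "finite_ball_measure_axioms lam"
    by (simp add: finite_ball_measure_axioms_def weighted_measure_def sets_mu)
qed

lemma sets_lam: "sets lam = sets \<mu>" by (simp add: weighted_measure_def)

lemma nn_integral_weight_indicator:
  "A \<in> sets \<mu> \<Longrightarrow> (\<integral>\<^sup>+ w. weight w * indicator A w \<partial>\<mu>) = emeasure lam A"
  unfolding weighted_measure_def by (subst emeasure_density) auto

lemma nn_integral_weight_suminf:
  fixes c :: "nat \<Rightarrow> ennreal"
  assumes A: "\<And>k. A k \<in> sets \<mu>"
  shows "(\<integral>\<^sup>+ w. (\<Sum>k. c k * (weight w * indicator (A k) w)) \<partial>\<mu>) = (\<Sum>k. c k * emeasure lam (A k))"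
proof -
  have [measurable]: "A k \<in> sets \<mu>" for k by (rule A)
  have "(\<integral>\<^sup>+ w. (\<Sum>k. c k * (weight w * indicator (A k) w)) \<partial>\<mu>)
     = (\<Sum>k. \<integral>\<^sup>+ w. c k * (weight w * indicator (A k) w) \<partial>\<mu>)"
    by (rule nn_integral_suminf) measurable
  also have "\<dots> = (\<Sum>k. c k * (\<integral>\<^sup>+ w. weight w * indicator (A k) w \<partial>\<mu>))"
    by (intro suminf_cong nn_integral_cmult) measurable
  finally show ?thesis by (simp only: nn_integral_weight_indicator[OF A])
qed

text \<open>The integral against \<mu> of the shell bound \<open>far_kernel_le\<close>.\<close>

definition far_sum :: "real \<Rightarrow> complex ^ 'n \<Rightarrow> ennreal" where
  "far_sum r \<xi> = (\<Sum>k. ennreal (4 ^ CARD('n) * (1 / 4 ^ CARD('n)) ^ k / (1 - r) ^ CARD('n)) *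
      emeasure lam (carleson_region \<xi> (2 ^ (k + 2) * (1 - r))))"

lemma far_sum_measurable [measurable]: "far_sum r \<in> borel_measurable sphere_measure"
  unfolding far_sum_def[abs_def] by measurable

text \<open>The majorant \<open>k\<close> of the near part is left open: dyadic pseudo-hyperbolic
  balls serve near the sphere, Euclidean balls near the origin.\<close>

lemma potential_le:
  assumes \<xi>: "norm \<xi> = 1" and r: "0 \<le> r" "r < 1"
    and k[measurable]: "k \<in> borel_measurable \<mu>"
    and le: "\<And>w. norm w < 1 \<Longrightarrow>
      inverse (ennreal (norm (ball_aut w (r *\<^sub>R \<xi>)) ^ (2 * (CARD('n) - 1)))) * of_bool (pseudo_dist2 (r *\<^sub>R \<xi>) w < 1/4) \<le> k w"
  shows "green_potential \<mu> (r *\<^sub>R \<xi>) \<le> ennreal (4 ^ (CARD('n) - 1)) * far_sum r \<xi> + (\<integral>\<^sup>+ w. k w \<partial>\<mu>)"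
proof -
  let ?F = "\<lambda>w. (\<Sum>k. ennreal (4 ^ CARD('n) * (1 / 4 ^ CARD('n)) ^ k / (1 - r) ^ CARD('n)) *
        (weight w * indicator (carleson_region \<xi> (2 ^ (k + 2) * (1 - r))) w))"
  have C[measurable]: "carleson_region \<xi> \<delta> \<in> sets \<mu>" for \<delta>
    using lam.carleson_in_sets[of \<xi> \<delta>] by (simp add: sets_lam)
  have F[measurable]: "?F \<in> borel_measurable \<mu>" by measurable
  have nz: "norm (r *\<^sub>R \<xi>) < 1" using \<xi> r by simp
  have "green_potential \<mu> (r *\<^sub>R \<xi>) \<le> (\<integral>\<^sup>+ w. ennreal (4 ^ (CARD('n) - 1)) * ?F w + k w \<partial>\<mu>)"
    unfolding green_potential_def
  proof (rule nn_integral_mono)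
    fix w assume "w \<in> space \<mu>"
    hence w: "norm w < 1" by (simp add: space_mu)
    show "green (r *\<^sub>R \<xi>) w \<le> ennreal (4 ^ (CARD('n) - 1)) * ?F w + k w"
      by (rule order_trans[OF green_le_far_plus_near[OF n nz w]]) (intro add_mono mult_left_mono far_kernel_le \<xi> r w le, simp)
  qed
  also have "\<dots> = ennreal (4 ^ (CARD('n) - 1)) * (\<integral>\<^sup>+ w. ?F w \<partial>\<mu>) + (\<integral>\<^sup>+ w. k w \<partial>\<mu>)"
    by (subst nn_integral_add, measurable) (subst nn_integral_cmult, measurable)
  also have "(\<integral>\<^sup>+ w. ?F w \<partial>\<mu>) = far_sum r \<xi>"
    unfolding far_sum_def by (rule nn_integral_weight_suminf[OF C])
  finally show ?thesis .
qed

lemma carleson_mean_le: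
  assumes p: "0 \<le> p"
  shows "(\<integral>\<^sup>+ \<xi>. epowr (emeasure lam (carleson_region \<xi> \<delta>)) p \<partial>sphere_measure)
    \<le> ennreal (measure lam (space lam) powr p)"
proof -
  define B where "B = measure lam (space lam)"
  have B: "emeasure lam (space lam) = ennreal B" "B \<ge> 0" by (auto simp: B_def lam.emeasure_eq_measure)
  have "(\<integral>\<^sup>+ \<xi>. epowr (emeasure lam (carleson_region \<xi> \<delta>)) p \<partial>sphere_measure)
    \<le> (\<integral>\<^sup>+ (\<xi> :: complex ^ 'n). ennreal (B powr p) \<partial>sphere_measure)"
  proof (rule nn_integral_mono)
    fix \<xi> :: "complex ^ 'n"
    have "emeasure lam (carleson_region \<xi> \<delta>) \<le> ennreal B" unfolding B(1)[symmetric] by (rule emeasure_space)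
    hence "epowr (emeasure lam (carleson_region \<xi> \<delta>)) p \<le> epowr (ennreal B) p" using p by (intro epowr_mono) auto
    thus "epowr (emeasure lam (carleson_region \<xi> \<delta>)) p \<le> ennreal (B powr p)" using B by (simp add: epowr_ennreal max_absorb2)
  qed
  also have "\<dots> = ennreal (B powr p)" by (simp add: lam.sphere.emeasure_space_1)
  finally show ?thesis unfolding B_def .
qed

text \<open>Dilated regions may have size 1 or more. There \<delta>^n \<ge> 1 and the total mass of
  \<lambda> suffices, so that mass is added to the constant; the summand 1 keeps it positive for
  \<open>minkowski_suminf\<close>.\<close>

lemma growth_all_scales:
  assumes p: "1 < p" and growth: "carleson_growth p lam"
  shows "\<exists>M>0. \<forall>\<delta>>0. (\<integral>\<^sup>+ \<xi>. epowr (emeasure lam (carleson_region \<xi> \<delta>)) p \<partial>sphere_measure)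
    \<le> ennreal ((M * \<delta> ^ CARD('n)) powr p)"
proof -
  obtain C where "\<forall>\<delta>\<in>{0<..<1}. epowr (\<integral>\<^sup>+ \<xi>. epowr (emeasure lam (carleson_region \<xi> \<delta>)) p \<partial>sphere_measure) (1 / p)
      \<le> ennreal (C * \<delta> ^ CARD('n))"
    using growth unfolding carleson_growth_def by blast
  hence C: "epowr (\<integral>\<^sup>+ \<xi>. epowr (emeasure lam (carleson_region \<xi> \<delta>)) p \<partial>sphere_measure) (1 / p)
      \<le> ennreal (C * \<delta> ^ CARD('n))" if "0 < \<delta>" "\<delta> < 1" for \<delta>
    using that by simp
  define B where "B = measure lam (space lam)"
  have B: "B \<ge> 0" by (simp add: B_def)
  define M where "M = \<bar>C\<bar> + B + 1"
  have M: "M > 0" using B by (simp add: M_def)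
  have "(\<integral>\<^sup>+ \<xi>. epowr (emeasure lam (carleson_region \<xi> \<delta>)) p \<partial>sphere_measure)
    \<le> ennreal ((M * \<delta> ^ CARD('n)) powr p)" if \<delta>: "\<delta> > 0" for \<delta>
  proof (cases "\<delta> < 1")
    case True
    have "ennreal (C * \<delta> ^ CARD('n)) \<le> ennreal (M * \<delta> ^ CARD('n))"
      using \<delta> B by (intro ennreal_leI mult_right_mono) (auto simp: M_def)
    with C[OF \<delta> True] have "epowr (\<integral>\<^sup>+ \<xi>. epowr (emeasure lam (carleson_region \<xi> \<delta>)) p \<partial>sphere_measure) (1 / p)
          \<le> ennreal (M * \<delta> ^ CARD('n))" by (rule order_trans)
    thus ?thesis using p M \<delta> by (subst (asm) epowr_root_le_iff) auto
  next
    case False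
    have "(\<integral>\<^sup>+ \<xi>. epowr (emeasure lam (carleson_region \<xi> \<delta>)) p \<partial>sphere_measure) \<le> ennreal (B powr p)"
      unfolding B_def using p by (intro carleson_mean_le) simp
    also have "\<dots> \<le> ennreal ((M * \<delta> ^ CARD('n)) powr p)"
    proof (intro ennreal_leI powr_mono2)
      have "B * 1 \<le> M * \<delta> ^ CARD('n)" using False B by (intro mult_mono one_le_power) (auto simp: M_def)
      thus "B \<le> M * \<delta> ^ CARD('n)" by simp
    qed (use p B in auto)
    finally show ?thesis .
  qed
  with M show ?thesis by blast
qed

text \<open>The coefficient 4^n 4^(-kn) \<delta>^-n times the norm bound M (2^(k+2) \<delta>)^n
  equals 16^n M 2^(-kn): \<delta> cancels and the series is geometric.\<close>

lemma far_mean: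
  assumes p: "1 < p" and M: "M > 0"
    and growth: "\<And>\<delta>. \<delta> > 0 \<Longrightarrow> (\<integral>\<^sup>+ \<xi>. epowr (emeasure lam (carleson_region \<xi> \<delta>)) p \<partial>sphere_measure)
      \<le> ennreal ((M * \<delta> ^ CARD('n)) powr p)"
    and r: "r < 1"
  shows "(\<integral>\<^sup>+ \<xi>. epowr (far_sum r \<xi>) p \<partial>sphere_measure)
    \<le> ennreal ((\<Sum>k. 16 ^ CARD('n) * M * (1 / 2 ^ CARD('n)) ^ k) powr p)"
proof -
  let ?n = "CARD('n)"
  define \<delta> where "\<delta> = 1 - r"
  have \<delta>: "\<delta> > 0" using r by (simp add: \<delta>_def)
  define c where "c k = 4 ^ ?n * (1 / 4 ^ ?n) ^ k / \<delta> ^ ?n" for k :: nat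
  define m where "m k = M * (2 ^ (k + 2) * \<delta>) ^ ?n" for k :: nat
  have cm: "c k * m k = 16 ^ ?n * M * (1 / 2 ^ ?n) ^ k" for k
  proof -
    have "(2 ^ (k + 2) * \<delta>) ^ ?n = 4 ^ ?n * (2 ^ ?n) ^ k * \<delta> ^ ?n"
      by (simp add: power_add power_mult_distrib power_mult[symmetric] mult_ac)
    hence "c k * m k = (4 ^ ?n * 4 ^ ?n) * M * ((1 / 4 ^ ?n) ^ k * (2 ^ ?n) ^ k)"
      using \<delta> by (simp add: c_def m_def)
    also have "(1 / 4 ^ ?n) ^ k * (2 ^ ?n) ^ k = (1 / 2 ^ ?n :: real) ^ k"
    proof -
      have "(4::real) ^ ?n = 2 ^ ?n * 2 ^ ?n" by (simp flip: power_mult_distrib)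
      hence "1 / 4 ^ ?n * 2 ^ ?n = (1 / 2 ^ ?n :: real)" by simp
      thus ?thesis by (simp only: power_mult_distrib[symmetric])
    qed
    also have "(4::real) ^ ?n * 4 ^ ?n = 16 ^ ?n" by (simp flip: power_mult_distrib)
    finally show ?thesis .
  qed
  have "(\<integral>\<^sup>+ \<xi>. epowr (\<Sum>k. ennreal (c k) * emeasure lam (carleson_region \<xi> (2 ^ (k + 2) * \<delta>))) p \<partial>sphere_measure)
    \<le> ennreal ((\<Sum>k. c k * m k) powr p)"
  proof (rule minkowski_suminf[OF p])
    show "c k > 0" "m k > 0" for k using \<delta> M by (auto simp: c_def m_def)
    show "summable (\<lambda>k. c k * m k)"
      unfolding cm by (intro summable_mult summable_geometric) simp
    show "(\<integral>\<^sup>+ \<xi>. epowr (emeasure lam (carleson_region \<xi> (2 ^ (k + 2) * \<delta>))) p \<partial>sphere_measure)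
      \<le> ennreal (m k powr p)" for k
      unfolding m_def using \<delta> by (intro growth) simp
  qed measurable
  thus ?thesis unfolding cm unfolding far_sum_def c_def \<delta>_def .
qed

text \<open>The far part is \<open>far_mean\<close>. In the near part \<open>near_estimate\<close>
  with \<rho> = 2^-(j+1), combined with growth at scale 200\<delta>, bounds the L^p norm of the j-th
  mass by O(\<delta>^n 2^(-j(2n-1)/p)), and the kernel supplies the factor \<delta>^-n.\<close>

lemma bounded_near_sphere:
  assumes p: "1 < p" "p < (2 * real CARD('n) - 1) / (2 * (real CARD('n) - 1))"
    and growth: "carleson_growth p lam" and r0: "0 < r0"
  shows "means_bounded_on {r0<..<1} p (green_potential \<mu>)"
proof -
  let ?n = "CARD('n)" and ?b = "2 * (CARD('n) - 1)" and ?N = "2 * CARD('n) - 1"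
  obtain M where M: "M > 0"
    and g: "\<And>\<delta>. \<delta> > 0 \<Longrightarrow> (\<integral>\<^sup>+ \<xi>. epowr (emeasure lam (carleson_region \<xi> \<delta>)) p \<partial>sphere_measure)
      \<le> ennreal ((M * \<delta> ^ ?n) powr p)"
    using growth_all_scales[OF p(1) growth] by auto
  obtain C where C: "C \<ge> 0"
    and near: "\<And>r \<rho>. r0 \<le> r \<Longrightarrow> r < 1 \<Longrightarrow> 0 < \<rho> \<Longrightarrow> \<rho> \<le> 1/2 \<Longrightarrow>
    (\<integral>\<^sup>+ \<xi>. epowr (emeasure lam {w \<in> unit_ball. pseudo_dist2 (r *\<^sub>R \<xi>) w < \<rho>\<^sup>2}) p \<partial>sphere_measure)
    \<le> ennreal (C * \<rho> ^ ?N) *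
       (\<integral>\<^sup>+ \<xi>. epowr (emeasure lam (carleson_region \<xi> (200 * (1 - r)))) p \<partial>sphere_measure)"
    using lam.near_estimate[OF p(1) r0] by blast
  define \<theta> where "\<theta> = 2 ^ ?b * (1/2) powr (real ?N / p)"
  \<comment> \<open>Chosen so that E^p = C + 1, which moves the constant of
    \<open>near_estimate\<close> inside the p-th power and keeps it positive.\<close>
  define E where "E = (C + 1) powr (1 / p)"
  have E: "E > 0" using C by (simp add: E_def)
  define H where "H = 4 ^ (?n - 1) * 2 ^ ?b * 6 ^ ?n * E * M * 200 ^ ?n"
  define A where "A = ennreal (2 powr p) * (ennreal ((4 ^ (?n - 1)) powr p) * ennreal ((\<Sum>k. 16 ^ ?n * M * (1 / 2 ^ ?n) ^ k) powr p)
      + ennreal ((\<Sum>j. H * \<theta> ^ j) powr p))"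
  have \<theta>: "\<theta> < 1" unfolding \<theta>_def by (rule exponent_less[OF n p])
  have "(\<integral>\<^sup>+ \<xi>. epowr (green_potential \<mu> (r *\<^sub>R \<xi>)) p \<partial>sphere_measure) \<le> A"
    if r: "r \<in> {r0<..<1}" for r
  proof -
    define \<delta> where "\<delta> = 1 - r"
    have \<delta>: "\<delta> > 0" using r by (simp add: \<delta>_def)
    have r': "0 \<le> r" "r < 1" "r0 \<le> r" using r r0 by auto
    define T where "T j \<xi> = emeasure lam {w \<in> unit_ball. pseudo_dist2 (r *\<^sub>R \<xi>) w < ((1/2) ^ Suc j)\<^sup>2}" for j \<xi>
    define c where "c = 4 ^ (?n - 1) * 2 ^ ?b * 6 ^ ?n / \<delta> ^ ?n"
    define J where "J \<xi> = (\<Sum>j. ennreal (c * (2 ^ ?b) ^ j) * T j \<xi>)" for \<xi>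
    have Tm[measurable]: "T j \<in> borel_measurable sphere_measure" for j
      unfolding T_def using lam.pseudo_pred by (intro lam.emeasure_section_measurable) simp
    have "(\<integral>\<^sup>+ \<xi>. epowr (J \<xi>) p \<partial>sphere_measure)
      \<le> ennreal ((\<Sum>j. c * (E * (M * (200 * \<delta>) ^ ?n)) * \<theta> ^ j) powr p)"
      unfolding J_def \<theta>_def
    proof (rule minkowski_geometric[OF p(1)])
      show "c > 0" "E * (M * (200 * \<delta>) ^ ?n) > 0" using \<delta> E M by (auto simp: c_def)
      show "2 ^ ?b * (1/2) powr (real ?N / p) < 1" using \<theta> by (simp add: \<theta>_def)
      fix j
      have half: "(1/2) ^ Suc j \<le> (1/2 :: real)" using power_le_one[of "1/2::real" j] by simp
      have "(\<integral>\<^sup>+ \<xi>. epowr (T j \<xi>) p \<partial>sphere_measure)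
        \<le> ennreal (C * ((1/2) ^ Suc j) ^ ?N) * (\<integral>\<^sup>+ \<xi>. epowr (emeasure lam (carleson_region \<xi> (200 * (1 - r)))) p \<partial>sphere_measure)"
        unfolding T_def using half by (intro near r') auto
      also have "\<dots> \<le> ennreal ((C + 1) * ((1/2) ^ j) ^ ?N) * ennreal ((M * (200 * \<delta>) ^ ?n) powr p)"
        unfolding \<delta>_def[symmetric] using C \<delta> by (intro mult_mono ennreal_leI mult_mono power_mono g) auto
      also have "\<dots> = ennreal (E powr p * (M * (200 * \<delta>) ^ ?n) powr p * ((1/2) ^ j) ^ ?N)"
        using C p by (subst ennreal_mult[symmetric]) (auto simp: E_def powr_powr mult_ac)
      also have "E powr p * (M * (200 * \<delta>) ^ ?n) powr p = (E * (M * (200 * \<delta>) ^ ?n)) powr p"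
        using E M \<delta> by (simp add: powr_mult)
      finally show "(\<integral>\<^sup>+ \<xi>. epowr (T j \<xi>) p \<partial>sphere_measure)
        \<le> ennreal ((E * (M * (200 * \<delta>) ^ ?n)) powr p * ((1/2) ^ j) ^ ?N)" .
    qed (rule Tm)
    \<comment> \<open>The powers of \<delta> cancel here, so the bound does not depend on r.\<close>
    also have "c * (E * (M * (200 * \<delta>) ^ ?n)) = H"
      using \<delta> by (simp add: c_def H_def power_mult_distrib)
    finally have Jint: "(\<integral>\<^sup>+ \<xi>. epowr (J \<xi>) p \<partial>sphere_measure) \<le> ennreal ((\<Sum>j. H * \<theta> ^ j) powr p)" .
    have Jm[measurable]: "J \<in> borel_measurable sphere_measure" unfolding J_def by measurable
    have pot: "green_potential \<mu> (r *\<^sub>R \<xi>) \<le> ennreal (4 ^ (?n - 1)) * far_sum r \<xi> + J \<xi>"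
      if \<xi>: "norm \<xi> = 1" for \<xi>
    proof -
      let ?S = "\<lambda>j. {w \<in> unit_ball. pseudo_dist2 (r *\<^sub>R \<xi>) w < ((1/2) ^ Suc j)\<^sup>2}"
      have S[measurable]: "?S j \<in> sets \<mu>" for j
        using lam.section_in_sets[OF lam.pseudo_pred] by (simp add: sets_lam)
      have c: "4 ^ (?n - 1) * 2 ^ (?b * Suc j) * 6 ^ ?n / (1 - r) ^ ?n = c * (2 ^ ?b) ^ j" for j
        by (simp add: c_def \<delta>_def power_mult power_add)
      have "green_potential \<mu> (r *\<^sub>R \<xi>) \<le> ennreal (4 ^ (?n - 1)) * far_sum r \<xi> +
        (\<integral>\<^sup>+ w. (\<Sum>j. ennreal (4 ^ (?n - 1) * 2 ^ (?b * Suc j) * 6 ^ ?n / (1 - r) ^ ?n) * (weight w * indicator (?S j) w)) \<partial>\<mu>)"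
        by (rule potential_le[OF \<xi> r'(1,2)]) (measurable, rule near_kernel_le[OF n \<xi> r'(1,2)])
      also have "(\<integral>\<^sup>+ w. (\<Sum>j. ennreal (4 ^ (?n - 1) * 2 ^ (?b * Suc j) * 6 ^ ?n / (1 - r) ^ ?n) * (weight w * indicator (?S j) w)) \<partial>\<mu>) = J \<xi>"
        unfolding c J_def T_def by (rule nn_integral_weight_suminf[OF S])
      finally show ?thesis .
    qed
    show ?thesis
      unfolding A_def
    proof (rule mean_sum_le[OF p(1)])
      show "green_potential \<mu> (r *\<^sub>R \<xi>) \<le> ennreal (4 ^ (?n - 1)) * far_sum r \<xi> + J \<xi>"
        if "\<xi> \<in> space sphere_measure" for \<xi>
        using that pot by (simp add: space_sphere_measure)
      show "(\<integral>\<^sup>+ \<xi>. epowr (far_sum r \<xi>) p \<partial>sphere_measure) \<le> ennreal ((\<Sum>k. 16 ^ ?n * M * (1 / 2 ^ ?n) ^ k) powr p)"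
        by (rule far_mean[OF p(1) M g r'(2)])
    qed (use Jint in simp_all)
  qed
  moreover have "A < \<infinity>" by (simp add: A_def ennreal_mult_eq_top_iff less_top[symmetric])
  ultimately show ?thesis
    using p(1) by (intro means_bounded_onI[of p _ _ "enn2real A"]) (auto simp: ennreal_enn2real)
qed

end

section \<open>Radii near the origin, and necessity of the growth condition\<close>

lemma ennreal_le_cmultD:
  fixes x y :: ennreal
  assumes c: "c > 0" and le: "x \<le> ennreal c * y"
  shows "ennreal (1 / c) * x \<le> y"
proof -
  have "ennreal (1 / c) * x \<le> ennreal (1 / c) * (ennreal c * y)" by (intro mult_left_mono le) simp
  also have "\<dots> = ennreal (1 / c * c) * y" using c by (subst ennreal_mult) (auto simp: mult.assoc)
  also have "\<dots> = y" using c by simp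
  finally show ?thesis .
qed

lemma ball_aut_at_0: "ball_aut w 0 = w"
  by (simp add: ball_aut_def proj_on_def herm_def)

context ball_potential
begin

text \<open>Since \<phi>_w(0) = w, the potential at 0 integrates the Green profile of
  \<open>w\<close>, which is comparable to the model.\<close>

lemma green_model_integral_finite:
  assumes "green_potential \<mu> 0 < \<infinity>"
  shows "(\<integral>\<^sup>+ w. green_model w \<partial>\<mu>) < \<infinity>"
proof -
  define c where "c = 4 * real CARD('n)"
  have c: "c > 0" by (simp add: c_def)
  have [measurable]: "green_model \<in> borel_measurable \<mu>"
    by (rule measurable_compose[OF id_measurable_mu green_model_measurable])
  have "ennreal (1 / c) * (\<integral>\<^sup>+ w. green_model w \<partial>\<mu>) = (\<integral>\<^sup>+ w. ennreal (1 / c) * green_model w \<partial>\<mu>)"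
    by (rule nn_integral_cmult[symmetric]) measurable
  also have "\<dots> \<le> green_potential \<mu> 0"
    unfolding green_potential_def green_def ball_aut_at_0 using green_le_model(2)[OF n]
    by (intro nn_integral_mono ennreal_le_cmultD c) (auto simp: space_mu c_def)
  finally have "ennreal (1 / c) * (\<integral>\<^sup>+ w. green_model w \<partial>\<mu>) < \<infinity>" using assms by (rule le_less_trans)
  thus ?thesis using c by (auto simp: ennreal_mult_less_top)
qed

text \<open>Finiteness at 0 makes \<nu> a finite measure. By \<open>origin_kernel_le\<close> the
  near part is at most a multiple of its total mass plus a dyadic series of \<nu>-masses, controlled
  by \<open>origin_estimate\<close>; the far part is again \<open>far_mean\<close>.\<close>

lemma bounded_near_origin:
  assumes p: "1 < p" "p < (2 * real CARD('n) - 1) / (2 * (real CARD('n) - 1))"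
    and growth: "carleson_growth p lam" and finite0: "green_potential \<mu> 0 < \<infinity>"
  shows "means_bounded_on {0<..1/2} p (green_potential \<mu>)"
proof -
  let ?n = "CARD('n)" and ?b = "2 * (CARD('n) - 1)" and ?N = "2 * CARD('n) - 1"
  obtain M where M: "M > 0"
    and g: "\<And>\<delta>. \<delta> > 0 \<Longrightarrow> (\<integral>\<^sup>+ \<xi>. epowr (emeasure lam (carleson_region \<xi> \<delta>)) p \<partial>sphere_measure)
      \<le> ennreal ((M * \<delta> ^ ?n) powr p)"
    using growth_all_scales[OF p(1) growth] by auto
  define \<nu> where "\<nu> = density \<mu> green_model"
  have gm[measurable]: "green_model \<in> borel_measurable \<mu>"
    by (rule measurable_compose[OF id_measurable_mu green_model_measurable])
  have sets_nu: "sets \<nu> = sets \<mu>" by (simp add: \<nu>_def)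
  have total: "emeasure \<nu> (space \<nu>) = (\<integral>\<^sup>+ w. green_model w \<partial>\<mu>)"
    unfolding \<nu>_def by (subst emeasure_density) (auto intro!: nn_integral_cong)
  interpret \<nu>: finite_ball_measure \<nu>
  proof (rule finite_ball_measure.intro)
    show "finite_measure \<nu>"
      using green_model_integral_finite[OF finite0] by (intro finite_measureI) (simp add: total)
    show "finite_ball_measure_axioms \<nu>"
      by (simp add: finite_ball_measure_axioms_def sets_nu sets_mu)
  qed
  obtain C where C: "C \<ge> 0"
    and origin: "\<And>r \<rho>. 0 \<le> r \<Longrightarrow> 0 < \<rho> \<Longrightarrow> \<rho> \<le> 1 \<Longrightarrow>
    (\<integral>\<^sup>+ \<xi>. epowr (emeasure \<nu> {w \<in> unit_ball. norm (r *\<^sub>R \<xi> - w) < \<rho> * norm w}) p \<partial>sphere_measure)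
    \<le> ennreal (C * \<rho> ^ ?N)"
    using \<nu>.origin_estimate[OF p(1)] by blast
  define \<theta> where "\<theta> = 2 ^ ?b * (1/2) powr (real ?N / p)"
  define E where "E = (C + 1) powr (1 / p)"
  have E: "E > 0" using C by (simp add: E_def)
  have Ep: "E powr p = C + 1" using C p by (simp add: E_def powr_powr)
  define K where "K = (7::real) ^ ?b * 11 ^ ?n"
  have K: "K > 0" by (simp add: K_def)
  define B where "B = measure \<nu> (space \<nu>)"
  have B: "emeasure \<nu> (space \<nu>) = ennreal B" "B \<ge> 0" by (auto simp: B_def \<nu>.emeasure_eq_measure)
  define Y where "Y = ennreal (2 powr p) * (ennreal (K powr p) * ennreal (B powr p)
      + ennreal ((\<Sum>j. K * 2 ^ ?b * E * \<theta> ^ j) powr p))"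
  define A where "A = ennreal (2 powr p) * (ennreal ((4 ^ (?n - 1)) powr p) * ennreal ((\<Sum>k. 16 ^ ?n * M * (1 / 2 ^ ?n) ^ k) powr p) + Y)"
  have \<theta>: "\<theta> < 1" unfolding \<theta>_def by (rule exponent_less[OF n p])
  have "(\<integral>\<^sup>+ \<xi>. epowr (green_potential \<mu> (r *\<^sub>R \<xi>)) p \<partial>sphere_measure) \<le> A"
    if r: "r \<in> {0<..1/2}" for r
  proof -
    have r': "0 \<le> r" "r < 1" "r \<le> 1/2" using r by auto
    define S where "S j \<xi> = {w \<in> unit_ball. norm (r *\<^sub>R \<xi> - w) < (1/2) ^ j * norm w}" for j and \<xi> :: "complex ^ 'n"
    define J where "J \<xi> = (\<Sum>j. ennreal (K * 2 ^ ?b * (2 ^ ?b) ^ j) * emeasure \<nu> (S j \<xi>))" for \<xi>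
    have P: "Measurable.pred (borel \<Otimes>\<^sub>M borel) (\<lambda>(\<xi>, w :: complex ^ 'n). norm (r *\<^sub>R \<xi> - w) < (1/2) ^ j * norm w)" for j
      by measurable
    have Tm[measurable]: "(\<lambda>\<xi>. emeasure \<nu> (S j \<xi>)) \<in> borel_measurable sphere_measure" for j
      unfolding S_def using P by (intro \<nu>.emeasure_section_measurable) simp
    have Jm[measurable]: "J \<in> borel_measurable sphere_measure" unfolding J_def by measurable
    have Jint: "(\<integral>\<^sup>+ \<xi>. epowr (J \<xi>) p \<partial>sphere_measure) \<le> ennreal ((\<Sum>j. K * 2 ^ ?b * E * \<theta> ^ j) powr p)"
      unfolding J_def \<theta>_def
    proof (rule minkowski_geometric[OF p(1)])
      show "K * 2 ^ ?b > 0" "E > 0" using K E by auto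
      show "2 ^ ?b * (1/2) powr (real ?N / p) < 1" using \<theta> by (simp add: \<theta>_def)
      fix j
      have "(\<integral>\<^sup>+ \<xi>. epowr (emeasure \<nu> (S j \<xi>)) p \<partial>sphere_measure) \<le> ennreal (C * ((1/2) ^ j) ^ ?N)"
        unfolding S_def by (intro origin r') (auto simp: power_le_one)
      also have "\<dots> \<le> ennreal (E powr p * ((1/2) ^ j) ^ ?N)"
        unfolding Ep by (intro ennreal_leI mult_right_mono) auto
      finally show "(\<integral>\<^sup>+ \<xi>. epowr (emeasure \<nu> (S j \<xi>)) p \<partial>sphere_measure) \<le> ennreal (E powr p * ((1/2) ^ j) ^ ?N)" .
    qed (rule Tm)
    have Yint: "(\<integral>\<^sup>+ \<xi>. epowr (ennreal K * ennreal B + J \<xi>) p \<partial>sphere_measure) \<le> Y"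
      unfolding Y_def
    proof (rule mean_sum_le[OF p(1) K _ Jm order_refl _ Jint])
      show "(\<integral>\<^sup>+ (\<xi> :: complex ^ 'n). epowr (ennreal B) p \<partial>sphere_measure) \<le> ennreal (B powr p)"
        using B(2) by (simp add: epowr_ennreal max_absorb2 lam.sphere.emeasure_space_1)
    qed simp
    have pot: "green_potential \<mu> (r *\<^sub>R \<xi>) \<le> ennreal (4 ^ (?n - 1)) * far_sum r \<xi> + (ennreal K * ennreal B + J \<xi>)"
      if \<xi>: "norm \<xi> = 1" for \<xi>
    proof -
      have S[measurable]: "S j \<xi> \<in> sets \<mu>" for j
        using \<nu>.section_in_sets[OF P] by (simp add: sets_nu S_def)
      let ?k = "\<lambda>w. ennreal K * (green_model w * 1 + (\<Sum>j. ennreal (2 ^ (?b * Suc j)) * (green_model w * indicator (S j \<xi>) w)))"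
      have km: "?k \<in> borel_measurable \<mu>" by measurable
      have "green_potential \<mu> (r *\<^sub>R \<xi>) \<le> ennreal (4 ^ (?n - 1)) * far_sum r \<xi> + (\<integral>\<^sup>+ w. ?k w \<partial>\<mu>)"
        unfolding S_def K_def
        by (rule potential_le[OF \<xi> r'(1,2)]) (use km in \<open>simp add: S_def K_def\<close>, rule origin_kernel_le[OF n \<xi> r'(1,3)])
      also have "(\<integral>\<^sup>+ w. ?k w \<partial>\<mu>) = ennreal K * ((\<integral>\<^sup>+ w. green_model w \<partial>\<mu>)
          + (\<Sum>j. ennreal (2 ^ (?b * Suc j)) * (\<integral>\<^sup>+ w. green_model w * indicator (S j \<xi>) w \<partial>\<mu>)))"
        by (simp add: nn_integral_cmult nn_integral_add nn_integral_suminf)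
      also have "(\<integral>\<^sup>+ w. green_model w \<partial>\<mu>) = ennreal B" using total B by simp
      also have "(\<lambda>j. \<integral>\<^sup>+ w. green_model w * indicator (S j \<xi>) w \<partial>\<mu>) = (\<lambda>j. emeasure \<nu> (S j \<xi>))"
        unfolding \<nu>_def by (simp add: emeasure_density)
      also have "ennreal K * (ennreal B + (\<Sum>j. ennreal (2 ^ (?b * Suc j)) * emeasure \<nu> (S j \<xi>))) = ennreal K * ennreal B + J \<xi>"
      proof -
        have "ennreal K * (ennreal (2 ^ (?b * Suc j)) * x) = ennreal (K * 2 ^ ?b * (2 ^ ?b) ^ j) * x" for j x
        proof -
          have "K * 2 ^ ?b * (2 ^ ?b) ^ j = K * 2 ^ (?b * Suc j)"
            by (simp add: power_add power_mult)
          hence "ennreal (K * 2 ^ ?b * (2 ^ ?b) ^ j) = ennreal K * ennreal (2 ^ (?b * Suc j))"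
            using K by (simp only: ennreal_mult zero_le_power less_imp_le zero_le_numeral)
          thus ?thesis by (simp only: mult.assoc)
        qed
        thus ?thesis unfolding J_def distrib_left ennreal_suminf_cmult[symmetric] by simp
      qed
      finally show ?thesis .
    qed
    show ?thesis
      unfolding A_def
    proof (rule mean_sum_le[OF p(1)])
      show "green_potential \<mu> (r *\<^sub>R \<xi>) \<le> ennreal (4 ^ (?n - 1)) * far_sum r \<xi> + (ennreal K * ennreal B + J \<xi>)"
        if "\<xi> \<in> space sphere_measure" for \<xi>
        using that pot by (simp add: space_sphere_measure)
      show "(\<integral>\<^sup>+ \<xi>. epowr (far_sum r \<xi>) p \<partial>sphere_measure) \<le> ennreal ((\<Sum>k. 16 ^ ?n * M * (1 / 2 ^ ?n) ^ k) powr p)"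
        by (rule far_mean[OF p(1) M g r'(2)])
    qed (use Yint in simp_all)
  qed
  moreover have "A < \<infinity>" by (simp add: A_def Y_def ennreal_mult_eq_top_iff less_top[symmetric])
  ultimately show ?thesis
    using p(1) by (intro means_bounded_onI[of p _ _ "enn2real A"]) (auto simp: ennreal_enn2real)
qed

text \<open>For w in C(\<xi>,\<delta>) and z = (1-\<delta>)\<xi> one has |1 - \<langle>z,w\<rangle>|
  \<le> 2\<delta>, hence 1 - \<rho>^2 \<ge> (1-|w|)/(4\<delta>), and the Green function is at least
  (1 - \<rho>^2)^n / (4n).\<close>

lemma carleson_le_potential:
  assumes \<xi>: "norm \<xi> = 1" and \<delta>: "0 < \<delta>" "\<delta> < 1"
  shows "emeasure lam (carleson_region \<xi> \<delta>)
    \<le> ennreal (4 * real CARD('n) * 4 ^ CARD('n) * \<delta> ^ CARD('n)) * green_potential \<mu> ((1 - \<delta>) *\<^sub>R \<xi>)"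
proof -
  let ?n = "CARD('n)"
  define z where "z = (1 - \<delta>) *\<^sub>R \<xi>"
  have nz: "norm z = 1 - \<delta>" using \<xi> \<delta> by (simp add: z_def)
  define c where "c = 4 * real ?n * 4 ^ ?n * \<delta> ^ ?n"
  have c: "c > 0" using \<delta> by (simp add: c_def)
  have C[measurable]: "carleson_region \<xi> \<delta> \<in> sets \<mu>"
    using lam.carleson_in_sets[of \<xi> \<delta>] by (simp add: sets_lam)
  \<comment> \<open>With the constant on this side it is pulled out of an integrand known to be
    measurable, while the Green function is only compared pointwise.\<close>
  have "ennreal (1 / c) * emeasure lam (carleson_region \<xi> \<delta>)
      = (\<integral>\<^sup>+ w. ennreal (1 / c) * (weight w * indicator (carleson_region \<xi> \<delta>) w) \<partial>\<mu>)"
    unfolding nn_integral_weight_indicator[OF C, symmetric] by (rule nn_integral_cmult[symmetric]) measurable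
  also have "\<dots> \<le> green_potential \<mu> z"
    unfolding green_potential_def
  proof (intro nn_integral_mono ennreal_le_cmultD c)
    fix w assume "w \<in> space \<mu>"
    hence w: "norm w < 1" by (simp add: space_mu)
    show "weight w * indicator (carleson_region \<xi> \<delta>) w \<le> ennreal c * green z w"
    proof (cases "w \<in> carleson_region \<xi> \<delta>")
      case True
      define s D u where "s = norm w" and "D = norm (1 - herm z w)" and "u = ball_aut w z"
      have s: "0 \<le> s" "s < 1" using w by (auto simp: s_def)
      have u: "norm u \<le> 1" unfolding u_def using nz \<delta> w by (intro norm_ball_aut_le) auto
      have D0: "D > 0" unfolding D_def using nz \<delta> w by (intro norm_one_minus_herm_pos) auto
      have D: "D \<le> 2 * \<delta>"
        using one_minus_herm_radial(2)[OF \<xi>, of "1 - \<delta>" w] \<delta> w True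
        by (simp add: carleson_region_eq D_def z_def)
      have "(1 - s) / (4 * \<delta>) = \<delta> * (1 - s) / (2 * \<delta>)\<^sup>2"
        using \<delta> by (simp add: power2_eq_square)
      also have "\<dots> \<le> (1 - (1 - \<delta>)\<^sup>2) * (1 - s\<^sup>2) / D\<^sup>2"
        using one_minus_square_bounds[of "1 - \<delta>"] one_minus_square_bounds[of s] \<delta> s D D0
        by (intro frac_le mult_mono power_mono) auto
      also have "\<dots> = 1 - (norm u)\<^sup>2"
        using pseudo_dist2_bounds(3)[of z w] norm_ball_aut[of z w] nz \<delta> w by (simp add: u_def D_def s_def)
      finally have "((1 - s) / (4 * \<delta>)) ^ ?n \<le> (1 - (norm u)\<^sup>2) ^ ?n"
        using s \<delta> by (intro power_mono) auto
      hence "(4 * \<delta>) ^ ?n * ((1 - s) / (4 * \<delta>)) ^ ?n \<le> (4 * \<delta>) ^ ?n * (1 - (norm u)\<^sup>2) ^ ?n"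
        using \<delta> by (intro mult_left_mono) auto
      also have "(4 * \<delta>) ^ ?n * ((1 - s) / (4 * \<delta>)) ^ ?n = (1 - s) ^ ?n"
        unfolding power_mult_distrib[symmetric] using \<delta> by simp
      finally have "weight w \<le> ennreal ((4 * \<delta>) ^ ?n * (1 - (norm u)\<^sup>2) ^ ?n)"
        unfolding s_def by (rule ennreal_leI)
      also have "\<dots> = ennreal ((4 * \<delta>) ^ ?n) * ennreal ((1 - (norm u)\<^sup>2) ^ ?n)"
        using \<delta> u by (intro ennreal_mult) (auto simp: power_le_one)
      also have "\<dots> \<le> ennreal ((4 * \<delta>) ^ ?n) * (ennreal (4 * real ?n) * green_profile u)"
        by (intro mult_left_mono order_trans[OF green_model_ge[OF n u] green_le_model(2)[OF n u]]) simp
      also have "\<dots> = ennreal c * green z w"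
      proof -
        have "c = (4 * \<delta>) ^ ?n * (4 * real ?n)" by (simp add: c_def power_mult_distrib)
        moreover have "ennreal ((4 * \<delta>) ^ ?n * (4 * real ?n)) = ennreal ((4 * \<delta>) ^ ?n) * ennreal (4 * real ?n)"
          using \<delta> by (intro ennreal_mult) auto
        ultimately show ?thesis by (simp only: green_def u_def[symmetric] mult.assoc)
      qed
      finally show ?thesis using True by simp
    qed simp
  qed
  finally have le: "ennreal (1 / c) * emeasure lam (carleson_region \<xi> \<delta>) \<le> green_potential \<mu> z" .
  have "ennreal (1 / (1 / c)) * (ennreal (1 / c) * emeasure lam (carleson_region \<xi> \<delta>)) = emeasure lam (carleson_region \<xi> \<delta>)"
    unfolding mult.assoc[symmetric] using c by (subst ennreal_mult[symmetric]) auto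
  moreover have "ennreal (1 / (1 / c)) * (ennreal (1 / c) * emeasure lam (carleson_region \<xi> \<delta>)) \<le> ennreal (1 / (1 / c)) * green_potential \<mu> z"
    by (intro mult_left_mono le) simp
  ultimately show ?thesis by (simp add: c_def z_def)
qed

text \<open>If \<delta> < 1 - r0, the radius 1-\<delta> is admissible and
  \<open>carleson_le_potential\<close> is integrated over the sphere. For larger \<delta> the total
  mass is enough, since \<delta>^n is bounded below.\<close>

lemma growth_of_bounded:
  assumes p: "1 < p" and r0: "0 < r0" "r0 < 1" and bounded: "means_bounded_on {r0<..<1} p (green_potential \<mu>)"
  shows "carleson_growth p lam"
proof -
  let ?n = "CARD('n)"
  obtain C where C: "\<And>r. r0 < r \<Longrightarrow> r < 1 \<Longrightarrow> integral_mean p r (green_potential \<mu>) \<le> ennreal C"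
    using bounded unfolding means_bounded_on_def Ball_def greaterThanLessThan_iff by blast
  define B where "B = measure lam (space lam)"
  have B: "B \<ge> 0" by (simp add: B_def)
  define K where "K = 4 * real ?n * 4 ^ ?n"
  have K: "K > 0" by (simp add: K_def)
  \<comment> \<open>The first summand serves small \<delta>, the second \<delta> \<ge> 1 -
    r0.\<close>
  define C' where "C' = K * \<bar>C\<bar> + B / (1 - r0) ^ ?n"
  have C'0: "C' \<ge> 0" using K B r0 by (simp add: C'_def)
  have "(\<integral>\<^sup>+ \<xi>. epowr (emeasure lam (carleson_region \<xi> \<delta>)) p \<partial>sphere_measure) \<le> ennreal ((C' * \<delta> ^ ?n) powr p)"
    if \<delta>: "0 < \<delta>" "\<delta> < 1" for \<delta>
  proof (cases "\<delta> < 1 - r0")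
    case True
    define c where "c = K * \<delta> ^ ?n"
    have c: "c > 0" using K \<delta> by (simp add: c_def)
    let ?L = "\<lambda>\<xi>. emeasure lam (carleson_region \<xi> \<delta>)"
    have "ennreal ((1 / c) powr p) * (\<integral>\<^sup>+ \<xi>. epowr (?L \<xi>) p \<partial>sphere_measure)
      = (\<integral>\<^sup>+ \<xi>. epowr (ennreal (1 / c) * ?L \<xi>) p \<partial>sphere_measure)"
      using c by (subst nn_integral_cmult[symmetric]) (auto simp: epowr_mult_ennreal)
    also have "\<dots> \<le> (\<integral>\<^sup>+ \<xi>. epowr (green_potential \<mu> ((1 - \<delta>) *\<^sub>R \<xi>)) p \<partial>sphere_measure)"
      using carleson_le_potential[OF _ \<delta>] p c
      by (intro nn_integral_mono epowr_mono ennreal_le_cmultD) (auto simp: space_sphere_measure c_def K_def)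
    also have "\<dots> \<le> ennreal (\<bar>C\<bar> powr p)"
    proof -
      have "integral_mean p (1 - \<delta>) (green_potential \<mu>) \<le> ennreal \<bar>C\<bar>"
        using True \<delta> by (intro order_trans[OF C ennreal_leI]) auto
      thus ?thesis unfolding integral_mean_def using p by (subst (asm) epowr_root_le_iff) auto
    qed
    finally have "ennreal (1 / ((1 / c) powr p)) * (ennreal ((1 / c) powr p) * (\<integral>\<^sup>+ \<xi>. epowr (?L \<xi>) p \<partial>sphere_measure))
      \<le> ennreal (1 / ((1 / c) powr p)) * ennreal (\<bar>C\<bar> powr p)" by (rule mult_left_mono) simp
    also have "ennreal (1 / ((1 / c) powr p)) * (ennreal ((1 / c) powr p) * (\<integral>\<^sup>+ \<xi>. epowr (?L \<xi>) p \<partial>sphere_measure))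
       = (\<integral>\<^sup>+ \<xi>. epowr (?L \<xi>) p \<partial>sphere_measure)"
      unfolding mult.assoc[symmetric] using c by (subst ennreal_mult[symmetric]) auto
    also have "ennreal (1 / ((1 / c) powr p)) * ennreal (\<bar>C\<bar> powr p) = ennreal ((c * \<bar>C\<bar>) powr p)"
      using c by (subst ennreal_mult[symmetric]) (auto simp: powr_mult powr_divide)
    also have "\<dots> \<le> ennreal ((C' * \<delta> ^ ?n) powr p)"
    proof (intro ennreal_leI powr_mono2)
      have "0 \<le> B / (1 - r0) ^ ?n * \<delta> ^ ?n" using B r0 \<delta> by simp
      thus "c * \<bar>C\<bar> \<le> C' * \<delta> ^ ?n" by (simp add: c_def C'_def algebra_simps)
    qed (use p c in auto)
    finally show ?thesis .
  next
    case False
    have "(\<integral>\<^sup>+ \<xi>. epowr (emeasure lam (carleson_region \<xi> \<delta>)) p \<partial>sphere_measure) \<le> ennreal (B powr p)"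
      unfolding B_def using p by (intro carleson_mean_le) simp
    also have "\<dots> \<le> ennreal ((C' * \<delta> ^ ?n) powr p)"
    proof (intro ennreal_leI powr_mono2)
      have "B = B / (1 - r0) ^ ?n * (1 - r0) ^ ?n" using r0 by simp
      also have "\<dots> \<le> C' * \<delta> ^ ?n"
        using False B K r0 \<delta> by (intro mult_mono power_mono) (auto simp: C'_def)
      finally show "B \<le> C' * \<delta> ^ ?n" .
    qed (use p B in auto)
    finally show ?thesis .
  qed
  thus ?thesis
    unfolding carleson_growth_def using p C'0
    by (intro exI[of _ C'] ballI) (auto simp: epowr_root_le_iff)
qed

end

text \<open>Radii tending to 0 detect the pole of the Green function, as
  \<open>point_mass_at_0\<close> shows, so the clause on all radii asks for a finite potential at 0;
  the other clause keeps the radii away from 0.\<close>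

theorem corollary2:
  fixes \<mu> :: "(complex ^ 'n::finite) measure" and p :: real
  assumes "CARD('n) > 1"
    and "1 < p" and "p < (2 * real CARD('n) - 1) / (2 * (real CARD('n) - 1))"
    and "sets \<mu> = sets (restrict_space borel unit_ball)"
    and "(\<integral>\<^sup>+ w. ennreal ((1 - (norm w)\<^sup>2) ^ CARD('n)) \<partial>\<mu>) < \<infinity>"
  shows "(green_potential \<mu> 0 < \<infinity> \<longrightarrow>
            (means_bounded_on {0<..<1} p (green_potential \<mu>) \<longleftrightarrow>
             carleson_growth p (weighted_measure \<mu>)))
       \<and> (\<forall>r\<^sub>0\<in>{0<..<1}.
            means_bounded_on {r\<^sub>0<..<1} p (green_potential \<mu>) \<longleftrightarrow>
            carleson_growth p (weighted_measure \<mu>))"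
proof -
  interpret ball_potential \<mu> by (rule ball_potential.intro[OF assms(1,4,5)])
  have annulus: "means_bounded_on {r\<^sub>0<..<1} p (green_potential \<mu>) \<longleftrightarrow> carleson_growth p lam"
    if "0 < r\<^sub>0" "r\<^sub>0 < 1" for r\<^sub>0
    using bounded_near_sphere[OF assms(2,3) _ that(1)] growth_of_bounded[OF assms(2) that] by blast
  moreover have "means_bounded_on {0<..<1} p (green_potential \<mu>) \<longleftrightarrow> carleson_growth p lam"
    if 0: "green_potential \<mu> 0 < \<infinity>"
  proof
    assume "means_bounded_on {0<..<1} p (green_potential \<mu>)"
    hence "means_bounded_on {1/2<..<1} p (green_potential \<mu>)"
      by (rule means_bounded_on_subset) auto
    thus "carleson_growth p lam" using annulus[of "1/2"] by simp
  next
    assume growth: "carleson_growth p lam"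
    have "means_bounded_on {1/2<..<1} p (green_potential \<mu>)" using growth annulus[of "1/2"] by simp
    then obtain C1 where C1: "\<And>r. r \<in> {1/2<..<1} \<Longrightarrow> integral_mean p r (green_potential \<mu>) \<le> ennreal C1"
      unfolding means_bounded_on_def by blast
    obtain C2 where C2: "\<And>r. r \<in> {0<..1/2} \<Longrightarrow> integral_mean p r (green_potential \<mu>) \<le> ennreal C2"
      using bounded_near_origin[OF assms(2,3) growth 0] unfolding means_bounded_on_def by blast
    have "integral_mean p r (green_potential \<mu>) \<le> ennreal (max C1 C2)" if "r \<in> {0<..<1}" for r
    proof (cases "r \<le> 1/2")
      case True
      thus ?thesis using that by (intro order_trans[OF C2 ennreal_leI]) auto
    next
      case False
      thus ?thesis using that by (intro order_trans[OF C1 ennreal_leI]) auto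
    qed
    thus "means_bounded_on {0<..<1} p (green_potential \<mu>)" unfolding means_bounded_on_def by blast
  qed
  ultimately show ?thesis by simp
qed

end
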